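(* Let $N\ge 1$ and $q>q_c:=\frac{N+2}{N+1}$. Let $u_0\in L^1(\mathbb{R}^N)\cap W^{1,\infty}(\mathbb{R}^N)$ be non-negative with $u_0\not\equiv 0$, and let $u$ be the solution of $u_t-\Delta u+|\nabla u|^q=0$ in $\mathbb{R}^N\times(0,\infty)$, $u(\cdot,0)=u_0$. Set $$I_\infty:=\lim_{t\to\infty}\int_{\mathbb{R}^N}u(x,t)\,dx=\int_{\mathbb{R}^N}u_0(x)\,dx-\int_0^\infty\int_{\mathbb{R}^N}|\nabla u(x,s)|^q\,dx\,ds .$$ Then for every $p\in[1,\infty]$, $$\lim_{t\to\infty}t^{(N/2)(1-1/p)}\,\|u(t)-I_\infty G(t)\|_p=0$$ and $$\lim_{t\to\infty}t^{(N/2)(1-1/p)+1/2}\,\|\nabla u(t)-I_\infty\nabla G(t)\|_p=0 ,$$ where $G(x,t)=(4\pi t)^{-N/2}\exp(-|x|^2/(4t))$ is the fundamental solution of the heat equation.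
   Context: For $q>1$ and every $u_0\in W^{1,\infty}(\mathbb{R}^N)$, the Cauchy problem $u_t-\Delta u+|\nabla u|^q=0$, $u(\cdot,0)=u_0$, has a unique global-in-time classical solution $u\in\mathcal{C}(\mathbb{R}^N\times[0,\infty))\cap\mathcal{C}^{2,1}(\mathbb{R}^N\times(0,\infty))$; it satisfies $\|u(t)\|_\infty\le\|u_0\|_\infty$ and $\|\nabla u(t)\|_\infty\le\|\nabla u_0\|_\infty$ for all $t>0$. "The solution" means this one. If $u_0\ge 0$ then $u\ge 0$. For non-negative integrable $u_0$, $t\mapsto\|u(t)\|_1$ is non-increasing and $|\nabla u|\in L^q(\mathbb{R}^N\times(0,\infty))$, so that $I_\infty$ is well defined. $\|\cdot\|_p$ is the $L^p(\mathbb{R}^N)$-norm, $u(t)=u(\cdot,t)$, and $1/p=0$ if $p=\infty$. *)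

theory Defs
  imports "HOL-Analysis.Analysis" "HOL-Probability.Essential_Supremum"
begin

text \<open>
  The space \<open>\<real>\<^sup>N\<close> is an arbitrary Euclidean space \<open>'a\<close> with \<open>N = DIM('a)\<close>, carrying Lebesgue
  measure. Space-time functions are written time first, so that \<open>u t\<close> is the spatial profile
  \<open>u(\<cdot>, t)\<close>; only the values for \<open>t \<ge> 0\<close> matter.
\<close>

section \<open>Norms and differential operators\<close>

text \<open>
  The norm takes values in \<open>[0, \<infinity>]\<close>, so finiteness is never lost to a default value. It applies
  to scalar and to vector fields. The inner conditional extends \<open>r \<mapsto> r powr (1/p)\<close> to \<open>r = \<infinity>\<close>.
\<close>

definition Lp_norm :: "ennreal \<Rightarrow> ('a::euclidean_space \<Rightarrow> 'b::real_normed_vector) \<Rightarrow> ennreal" where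
  "Lp_norm p f =
     (if p = \<infinity> then esssup lebesgue (\<lambda>x. ennreal (norm (f x)))
      else (let r = \<integral>\<^sup>+ x. ennreal (norm (f x) powr enn2real p) \<partial>lebesgue
            in if r = \<infinity> then \<infinity> else ennreal (enn2real r powr (1 / enn2real p))))"

definition gradient :: "('a::euclidean_space \<Rightarrow> real) \<Rightarrow> 'a \<Rightarrow> 'a" where
  "gradient f x = (THE D. GDERIV f x :> D)"

lemma gradient_eqI: "GDERIV f x :> D \<Longrightarrow> gradient f x = D"
  unfolding gradient_def
proof (rule the_equality)
  fix E assume "GDERIV f x :> D" "GDERIV f x :> E"
  then have "(\<lambda>h. h \<bullet> D) = (\<lambda>h. h \<bullet> E)"
    unfolding gderiv_def by (rule has_derivative_unique)
  then show "E = D"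
    by (metis vector_eq_ldot)
qed

definition laplacian :: "('a::euclidean_space \<Rightarrow> real) \<Rightarrow> 'a \<Rightarrow> real" where
  "laplacian f x = (\<Sum>i\<in>Basis. frechet_derivative (gradient f) (at x) i \<bullet> i)"

section \<open>The Sobolev space \<open>W\<^sup>1\<^sup>,\<^sup>\<infinity>\<close>\<close>

text \<open>
  Test functions are the compactly supported functions of class \<open>C\<^sup>1\<close>; by mollification,
  these define the same weak gradients as the compactly supported smooth functions.
\<close>

definition test_function :: "('a::euclidean_space \<Rightarrow> real) \<Rightarrow> bool" where
  "test_function \<phi> \<longleftrightarrow>
     (\<forall>x. \<phi> differentiable at x) \<and> continuous_on UNIV (gradient \<phi>) \<and>
     compact (closure {x. \<phi> x \<noteq> 0})"

definition locally_integrable ::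
    "('a::euclidean_space \<Rightarrow> 'b::{banach, second_countable_topology}) \<Rightarrow> bool" where
  "locally_integrable f \<longleftrightarrow> (\<forall>K. compact K \<longrightarrow> set_integrable lebesgue K f)"

definition has_weak_gradient :: "('a::euclidean_space \<Rightarrow> real) \<Rightarrow> ('a \<Rightarrow> 'a) \<Rightarrow> bool" where
  "has_weak_gradient f g \<longleftrightarrow>
     locally_integrable f \<and> locally_integrable g \<and>
     (\<forall>\<phi>. test_function \<phi> \<longrightarrow> (\<forall>i\<in>Basis.
        (LINT x|lebesgue. f x * (gradient \<phi> x \<bullet> i)) = - (LINT x|lebesgue. (g x \<bullet> i) * \<phi> x)))"

definition W1_inf :: "('a::euclidean_space \<Rightarrow> real) \<Rightarrow> bool" where
  "W1_inf f \<longleftrightarrow> Lp_norm \<infinity> f < \<infinity> \<and> (\<exists>g. has_weak_gradient f g \<and> Lp_norm \<infinity> g < \<infinity>)"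

section \<open>The Cauchy problem\<close>

definition C21 :: "(real \<Rightarrow> 'a::euclidean_space \<Rightarrow> real) \<Rightarrow> bool" where
  "C21 u \<longleftrightarrow>
     (\<forall>t>0. \<forall>x. (\<lambda>s. u s x) differentiable at t \<and> u t differentiable at x \<and>
        gradient (u t) differentiable at x) \<and>
     continuous_on ({0<..} \<times> UNIV) (\<lambda>(t, x). u t x) \<and>
     continuous_on ({0<..} \<times> UNIV) (\<lambda>(t, x). deriv (\<lambda>s. u s x) t) \<and>
     continuous_on ({0<..} \<times> UNIV) (\<lambda>(t, x). gradient (u t) x) \<and>
     (\<forall>i\<in>Basis. continuous_on ({0<..} \<times> UNIV)
        (\<lambda>(t, x). frechet_derivative (gradient (u t)) (at x) i))"

text \<open>
  The initial datum is an element of a Lebesgue space, hence the initial condition is an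
  equality almost everywhere (\<open>u 0\<close> is then the continuous representative).
\<close>

definition classical_solution ::
    "real \<Rightarrow> ('a::euclidean_space \<Rightarrow> real) \<Rightarrow> (real \<Rightarrow> 'a \<Rightarrow> real) \<Rightarrow> bool" where
  "classical_solution q u\<^sub>0 u \<longleftrightarrow>
     continuous_on ({0..} \<times> UNIV) (\<lambda>(t, x). u t x) \<and> C21 u \<and>
     (\<forall>t>0. \<forall>x. deriv (\<lambda>s. u s x) t - laplacian (u t) x + norm (gradient (u t) x) powr q = 0) \<and>
     (AE x in lebesgue. u 0 x = u\<^sub>0 x)"

text \<open>
  The solution of the Cauchy problem with datum in \<open>W\<^sup>1\<^sup>,\<^sup>\<infinity>\<close>: the classical solution obeying the
  two maximum principles \<open>\<parallel>u(t)\<parallel>\<^sub>\<infinity> \<le> \<parallel>u\<^sub>0\<parallel>\<^sub>\<infinity>\<close> and \<open>\<parallel>\<nabla>u(t)\<parallel>\<^sub>\<infinity> \<le> \<parallel>\<nabla>u\<^sub>0\<parallel>\<^sub>\<infinity>\<close>. These bounds are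
  part of the existence and uniqueness theorem for this problem; they fix the class of functions,
  bounded with bounded gradient, in which the solution is unique. The weak gradient \<open>g\<close> of
  \<open>u\<^sub>0\<close> is unique up to a null set, so it does not matter which one is used.
\<close>

definition is_the_solution ::
    "real \<Rightarrow> ('a::euclidean_space \<Rightarrow> real) \<Rightarrow> (real \<Rightarrow> 'a \<Rightarrow> real) \<Rightarrow> bool" where
  "is_the_solution q u\<^sub>0 u \<longleftrightarrow>
     classical_solution q u\<^sub>0 u \<and>
     (\<forall>t>0. Lp_norm \<infinity> (u t) \<le> Lp_norm \<infinity> u\<^sub>0) \<and>
     (\<forall>g. has_weak_gradient u\<^sub>0 g \<longrightarrow> (\<forall>t>0. Lp_norm \<infinity> (gradient (u t)) \<le> Lp_norm \<infinity> g))"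

definition I_infty :: "(real \<Rightarrow> 'a::euclidean_space \<Rightarrow> real) \<Rightarrow> real" where
  "I_infty u = Lim at_top (\<lambda>t. LINT x|lebesgue. u t x)"

definition heat_kernel :: "real \<Rightarrow> 'a::euclidean_space \<Rightarrow> real" where
  "heat_kernel t x =
     (4 * pi * t) powr (- real DIM('a) / 2) * exp (- (norm x)\<^sup>2 / (4 * t))"

text \<open>The exponent \<open>(N/2)(1 - 1/p)\<close>; in \<^typ>\<open>ennreal\<close>, \<open>1 / \<infinity> = 0\<close>.\<close>

definition decay_exponent :: "nat \<Rightarrow> ennreal \<Rightarrow> real" where
  "decay_exponent N p = real N / 2 * (1 - enn2real (1 / p))"

end

theory Submission
  imports Defs "HOL-Probability.Distributions" "HOL-Real_Asymp.Real_Asymp"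
begin

text \<open>
  Write \<open>G\<close> for the heat kernel and \<open>F = |\<nabla>u|\<^sup>q\<close>. Testing the equation with \<open>G\<close> and with a
  directional derivative of \<open>G\<close> gives Duhamel's formulas for \<open>u\<close> and \<open>\<nabla>u\<close>. Since \<open>u \<ge> 0\<close> by the
  maximum principle, integrating the first one in space gives \<open>F \<in> L\<^sup>1\<close>, and \<open>u(t) - I\<^sub>\<infinity> G(t) \<rightarrow> 0\<close> in \<open>L\<^sup>1\<close>:
  restart at a late time \<open>T\<close>, after which absorption removes only little mass.

  On a time interval of length \<open>\<delta>\<close> where \<open>|\<nabla>u| \<le> m\<close> and \<open>m\<^sup>q\<^sup>-\<^sup>1 \<delta>\<^sup>1\<^sup>/\<^sup>2\<close> is small, the drift
  \<open>|\<nabla>u|\<^sup>q\<^sup>-\<^sup>2 \<nabla>u\<close> is a perturbation, and \<open>|\<nabla>u|\<close> is bounded by \<open>C \<delta>\<^sup>-\<^sup>1\<^sup>/\<^sup>2\<close> times a heat flow of \<open>u\<close>. Hence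
  \<open>\<parallel>\<nabla>u(t)\<parallel>\<^sub>\<infinity> = O(t\<^sup>-\<^sup>\<alpha>)\<close> improves to the exponent \<open>min (\<alpha>(q-1)) (1/2) + N/2\<close>. For \<open>q > q\<^sub>c\<close> finitely many
  steps reach \<open>(N+1)/2\<close>, the decay of the heat equation. With it the source in Duhamel's formulas on
  \<open>[t/2, t]\<close> is negligible, so that the \<open>L\<^sup>1\<close> convergence at time \<open>t/2\<close> yields the convergence of \<open>u\<close> in
  \<open>L\<^sup>\<infinity>\<close> and that of \<open>\<nabla>u\<close> in \<open>L\<^sup>1\<close> and \<open>L\<^sup>\<infinity>\<close>; interpolation gives every \<open>p\<close>.
\<close>

section \<open>The heat kernel\<close>

text \<open>One kernel inequality shapes the proof:
  \<open>|\<nabla>G(t)| \<le> C t^(-1/2) G(2t)\<close> pointwise (\<open>heat_dir_bound\<close>).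
  Its right side is again a heat kernel, so the semigroup law still applies after each use, and the
  nonlinear term is treated as a perturbation pointwise, against the heat flow of \<open>u\<close>,
  without estimates for equations with drift. As \<open>u\<close> and \<open>F\<close> are
  non-negative, Duhamel's formula for \<open>u\<close> is stated in \<open>ennreal\<close>, with the
  absorbed part added to \<open>u\<close>; Tonelli and monotone convergence then need no
  integrability in advance. The condition \<open>q > q_c\<close> says \<open>(N+1)(q-1) > 1\<close>.
  It bounds the gain of a bootstrap step from below, and it makes
  \<open>\<nu> = ((N+1)(q-1) - 1)/2\<close> positive. Once the gradient decays as for the heat
  equation, the source is \<open>O(s^(-\<nu>-1))\<close> in \<open>L^1\<close>, so over
  \<open>[\<tau>, 2\<tau>]\<close> it is smaller than the heat rates by the factor
  \<open>\<tau>^(-\<nu>)\<close>. Times \<open>\<tau>\<close> and \<open>2\<tau>\<close> are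
  compared because the heat flow over time \<open>\<tau>\<close> maps \<open>G(\<tau>)\<close> to
  \<open>G(2\<tau>)\<close>.\<close>

lemma mult_swap: "a * b * (c * d) = a * c * (b * (d::real))"
  by (simp add: mult_ac)

section \<open>Invariance of Lebesgue integrals under translation and reflection\<close>

lemma nn_integral_lborel_translate:
  fixes f :: "'a::euclidean_space \<Rightarrow> ennreal"
  assumes [measurable]: "f \<in> borel_measurable borel"
  shows "(\<integral>\<^sup>+x. f (c + x) \<partial>lborel) = (\<integral>\<^sup>+x. f x \<partial>lborel)"
proof -
  have "(\<integral>\<^sup>+x. f x \<partial>distr lborel borel ((+) c)) = (\<integral>\<^sup>+x. f (c + x) \<partial>lborel)"
    by (subst nn_integral_distr) auto
  then show ?thesis
    by (simp add: lborel_distr_plus)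
qed

lemma nn_integral_lborel_reflect:
  fixes f :: "'a::euclidean_space \<Rightarrow> ennreal"
  assumes [measurable]: "f \<in> borel_measurable borel"
  shows "(\<integral>\<^sup>+x. f (c - x) \<partial>lborel) = (\<integral>\<^sup>+x. f x \<partial>lborel)"
proof -
  have "lborel = distr lborel borel (\<lambda>x. c - x)"
    using lborel_affine[of "-1" c] by (simp add: density_1)
  then have "(\<integral>\<^sup>+x. f x \<partial>lborel) = (\<integral>\<^sup>+x. f x \<partial>distr lborel borel (\<lambda>x. c - x))"
    by simp
  also have "\<dots> = (\<integral>\<^sup>+x. f (c - x) \<partial>lborel)"
    by (subst nn_integral_distr) auto
  finally show ?thesis by simp
qed

lemma integrable_lborel_translate:
  fixes f :: "'a::euclidean_space \<Rightarrow> 'b::{banach, second_countable_topology}"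
  assumes "integrable lborel f"
  shows "integrable lborel (\<lambda>x. f (c + x))"
proof -
  have "integrable (distr lborel borel ((+) c)) f"
    using assms by (simp add: lborel_distr_plus)
  then show ?thesis
    by (subst (asm) integrable_distr_eq) (use assms in auto)
qed

lemma integral_lborel_translate:
  fixes f :: "'a::euclidean_space \<Rightarrow> 'b::{banach, second_countable_topology}"
  assumes [measurable]: "f \<in> borel_measurable borel"
  shows "(LINT x|lborel. f (c + x)) = (LINT x|lborel. f x)"
proof -
  have "(LINT x|distr lborel borel ((+) c). f x) = (LINT x|lborel. f (c + x))"
    by (subst integral_distr) auto
  then show ?thesis
    by (simp add: lborel_distr_plus)
qed

lemma heat_kernel_measurable [measurable]:
  assumes [measurable]: "f \<in> borel_measurable M" "g \<in> borel_measurable M"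
  shows "(\<lambda>x. heat_kernel (f x) (g x :: 'a::euclidean_space)) \<in> borel_measurable M"
  unfolding heat_kernel_def by measurable

lemma heat_kernel_nonneg [simp]: "0 \<le> heat_kernel t x"
  by (simp add: heat_kernel_def)

lemma heat_kernel_minus [simp]: "heat_kernel t (- x) = heat_kernel t x"
  by (simp add: heat_kernel_def)

lemma heat_kernel_commute: "heat_kernel t (x - y) = heat_kernel t (y - x)"
  by (simp add: heat_kernel_def norm_minus_commute)

lemma continuous_on_heat_kernel [continuous_intros]:
  fixes g :: "'b::topological_space \<Rightarrow> 'a::euclidean_space"
  assumes "continuous_on S f" "continuous_on S g" "\<And>x. x \<in> S \<Longrightarrow> f x > 0"
  shows "continuous_on S (\<lambda>x. heat_kernel (f x) (g x))"
  unfolding heat_kernel_def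
  by (intro continuous_intros assms) (use assms(3) in fastforce)+

lemma heat_kernel_bound:
  fixes x :: "'a::euclidean_space"
  assumes "t > 0"
  shows "heat_kernel t x \<le> (4 * pi * t) powr (- real DIM('a) / 2)"
  unfolding heat_kernel_def using assms
  by (intro mult_left_le) auto

text \<open>Each factor is the centred normal law of variance \<open>2 * t\<close>, so the unit mass
  of the kernel in every dimension reduces to the one-dimensional Gaussian integral.\<close>

lemma heat_kernel_eq_prod:
  fixes x :: "'a::euclidean_space"
  assumes t: "t > 0"
  shows "heat_kernel t x = (\<Prod>b\<in>Basis. normal_density 0 (sqrt (2 * t)) (x \<bullet> b))"
proof -
  have "(\<Prod>b\<in>(Basis::'a set). normal_density 0 (sqrt (2 * t)) (x \<bullet> b)) =
    (\<Prod>b\<in>(Basis::'a set). 1 / sqrt (4 * pi * t)) * (\<Prod>b\<in>(Basis::'a set). exp (- (x \<bullet> b)\<^sup>2 / (4 * t)))"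
    unfolding prod.distrib[symmetric] normal_density_def using t
    by (intro prod.cong) (auto simp: algebra_simps)
  also have "(\<Prod>b\<in>(Basis::'a set). exp (- (x \<bullet> b)\<^sup>2 / (4 * t))) = exp (- (norm x)\<^sup>2 / (4 * t))"
    unfolding exp_sum[symmetric, OF finite_Basis] norm_conv_dist euclidean_dist_l2[of x] L2_set_def
    by (simp add: sum_divide_distrib[symmetric] sum_negf sum_nonneg)
  also have "(\<Prod>b\<in>(Basis::'a set). 1 / sqrt (4 * pi * t)) = (4 * pi * t) powr (- real DIM('a) / 2)"
    using t by (simp add: powr_minus_divide powr_half_sqrt_powr powr_realpow real_sqrt_power power_one_over)
  finally show ?thesis
    by (simp add: heat_kernel_def)
qed

lemma nn_integral_heat_kernel_0:
  assumes "t > 0"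
  shows "(\<integral>\<^sup>+y. ennreal (heat_kernel t (y::'a::euclidean_space)) \<partial>lborel) = 1"
proof -
  have "(\<integral>\<^sup>+y. ennreal (heat_kernel t (y::'a)) \<partial>lborel) =
     (\<integral>\<^sup>+y. (\<Prod>b\<in>Basis. ennreal (normal_density 0 (sqrt (2 * t)) (y \<bullet> b))) \<partial>(lborel::'a measure))"
    using assms by (intro nn_integral_cong) (simp add: heat_kernel_eq_prod prod_ennreal)
  also have "\<dots> = (\<Prod>b\<in>(Basis::'a set). (\<integral>\<^sup>+y. ennreal (normal_density 0 (sqrt (2 * t)) y) \<partial>lborel))"
    by (rule nn_integral_lborel_prod) auto
  also have "(\<integral>\<^sup>+y. ennreal (normal_density 0 (sqrt (2 * t)) y) \<partial>lborel) = 1"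
    using assms by (subst nn_integral_eq_integral) auto
  finally show ?thesis by simp
qed

lemma nn_integral_heat_kernel:
  assumes "t > 0"
  shows "(\<integral>\<^sup>+y. ennreal (heat_kernel t (x - y :: 'a::euclidean_space)) \<partial>lborel) = 1"
  using nn_integral_lborel_reflect[of "\<lambda>y. ennreal (heat_kernel t y)" x] nn_integral_heat_kernel_0[OF assms]
  by simp

lemma nn_integral_heat_kernel':
  assumes "t > 0"
  shows "(\<integral>\<^sup>+y. ennreal (heat_kernel t (y - x :: 'a::euclidean_space)) \<partial>lborel) = 1"
  using nn_integral_heat_kernel[OF assms, of x] by (simp add: heat_kernel_commute)

lemma has_bochner_integral_heat_kernel:
  assumes "t > 0"
  shows "has_bochner_integral lborel (\<lambda>y. heat_kernel t (x - y :: 'a::euclidean_space)) 1"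
  by (rule has_bochner_integral_nn_integral) (use assms in \<open>auto simp: nn_integral_heat_kernel\<close>)

lemma integrable_heat_kernel:
  assumes "t > 0"
  shows "integrable lborel (\<lambda>y. heat_kernel t (x - y :: 'a::euclidean_space))"
  using has_bochner_integral_heat_kernel[OF assms] by (rule has_bochner_integral_iff[THEN iffD1, THEN conjunct1])

lemma has_bochner_integral_heat_kernel':
  assumes "t > 0"
  shows "has_bochner_integral lborel (\<lambda>y. heat_kernel t (y - x :: 'a::euclidean_space)) 1"
  using has_bochner_integral_heat_kernel[OF assms, of x] by (simp add: heat_kernel_commute)

text \<open>Completing the square in \<open>y\<close>: the exponents add up to one Gaussian in
  \<open>x\<close> alone and one in \<open>y\<close> centred at a fraction of \<open>x\<close>.
  Integrating in \<open>y\<close> gives the semigroup law; the explicit form is used again for the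
  derivative of the kernel.\<close>

lemma heat_kernel_mult:
  fixes x y :: "'a::euclidean_space"
  assumes s: "s > 0" and t: "t > 0"
  shows "heat_kernel s (x - y) * heat_kernel t y =
    heat_kernel (s + t) x * heat_kernel (s * t / (s + t)) (y - (t / (s + t)) *\<^sub>R x)"
proof -
  have 1: "(norm (x - y))\<^sup>2 / (4 * s) + (norm y)\<^sup>2 / (4 * t) =
      (norm x)\<^sup>2 / (4 * (s + t)) + (norm (y - (t / (s + t)) *\<^sub>R x))\<^sup>2 / (4 * (s * t / (s + t)))"
  proof -
    define X Y Z where "X = x \<bullet> x" "Y = y \<bullet> y" "Z = x \<bullet> y"
    have n: "s + t \<noteq> 0" using s t by simp
    have 2: "(norm (y - (t / (s + t)) *\<^sub>R x))\<^sup>2 = Y - 2 * (t / (s + t)) * Z + (t / (s + t))\<^sup>2 * X"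
      unfolding power2_norm_eq_inner X_Y_Z_def
      by (simp add: inner_diff_left inner_diff_right inner_commute[of y x] power2_eq_square right_diff_distrib)
    have 3: "(norm (x - y))\<^sup>2 = X - 2 * Z + Y"
      unfolding power2_norm_eq_inner X_Y_Z_def
      by (simp add: inner_diff_left inner_diff_right inner_commute[of y x])
    have 4: "(norm x)\<^sup>2 = X" "(norm y)\<^sup>2 = Y" by (simp_all add: power2_norm_eq_inner X_Y_Z_def)
    show ?thesis
      unfolding 2 3 4 using s t n by (simp add: divide_simps) algebra
  qed
  have 2: "(4 * pi * s) * (4 * pi * t) = (4 * pi * (s + t)) * (4 * pi * (s * t / (s + t)))"
    using s t by (simp add: divide_simps)
  have 3: "((4 * pi * s) * (4 * pi * t)) powr (- real DIM('a) / 2) =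
      (4 * pi * s) powr (- real DIM('a) / 2) * (4 * pi * t) powr (- real DIM('a) / 2)"
    by (rule powr_mult)
  have 4: "((4 * pi * (s + t)) * (4 * pi * (s * t / (s + t)))) powr (- real DIM('a) / 2) =
      (4 * pi * (s + t)) powr (- real DIM('a) / 2) * (4 * pi * (s * t / (s + t))) powr (- real DIM('a) / 2)"
    by (rule powr_mult)
  have "heat_kernel s (x - y) * heat_kernel t y = ((4 * pi * s) * (4 * pi * t)) powr (- real DIM('a) / 2)
      * exp (- ((norm (x - y))\<^sup>2 / (4 * s) + (norm y)\<^sup>2 / (4 * t)))"
    unfolding 3 heat_kernel_def minus_add_distrib exp_add minus_divide_left by (rule mult_swap)
  also have "\<dots> = heat_kernel (s + t) x * heat_kernel (s * t / (s + t)) (y - (t / (s + t)) *\<^sub>R x)"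
    unfolding 1 2 4 heat_kernel_def minus_add_distrib exp_add minus_divide_left by (rule mult_swap)
  finally show ?thesis .
qed

lemma heat_kernel_semigroup:
  fixes x z :: "'a::euclidean_space"
  assumes s: "s > 0" and t: "t > 0"
  shows "(\<integral>\<^sup>+y. ennreal (heat_kernel s (x - y) * heat_kernel t (y - z)) \<partial>lborel) = ennreal (heat_kernel (s + t) (x - z))"
proof -
  have "(\<integral>\<^sup>+y. ennreal (heat_kernel s (x - y) * heat_kernel t (y - z)) \<partial>lborel) =
     (\<integral>\<^sup>+y. ennreal (heat_kernel s (x - (z + y)) * heat_kernel t (z + y - z)) \<partial>lborel)"
    by (rule nn_integral_lborel_translate[symmetric]) auto
  also have "\<dots> = (\<integral>\<^sup>+y. ennreal (heat_kernel (s + t) (x - z)) *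
      ennreal (heat_kernel (s * t / (s + t)) (y - (t / (s + t)) *\<^sub>R (x - z))) \<partial>lborel)"
    using heat_kernel_mult[OF s t, of "x - z"] by (intro nn_integral_cong) (simp add: ennreal_mult[symmetric] algebra_simps)
  also have "\<dots> = ennreal (heat_kernel (s + t) (x - z))"
    using s t by (subst nn_integral_cmult) (auto simp: nn_integral_heat_kernel')
  finally show ?thesis .
qed

text \<open>The prefactor decreases in time and the exponential increases, so the kernel at the
  latest time dominates after paying the ratio of the prefactors. This provides integrable majorants
  uniform on a time interval.\<close>

lemma heat_kernel_time_mono:
  fixes x :: "'a::euclidean_space"
  assumes "0 < a" "a \<le> s" "s \<le> b"
  shows "heat_kernel s x \<le> (b / a) powr (real DIM('a) / 2) * heat_kernel b x"
proof -
  have "(4 * pi * s) powr (- real DIM('a) / 2) \<le> (4 * pi * a) powr (- real DIM('a) / 2)"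
    using assms by (intro powr_mono2') auto
  also have "\<dots> = (b / a) powr (real DIM('a) / 2) * (4 * pi * b) powr (- real DIM('a) / 2)"
    using assms by (simp add: powr_mult powr_divide powr_minus_divide)
  finally have 1: "(4 * pi * s) powr (- real DIM('a) / 2) \<le>
    (b / a) powr (real DIM('a) / 2) * (4 * pi * b) powr (- real DIM('a) / 2)" .
  have 2: "exp (- (norm x)\<^sup>2 / (4 * s)) \<le> exp (- (norm x)\<^sup>2 / (4 * b))"
    using assms by (auto intro!: divide_left_mono)
  show ?thesis
    using mult_mono[OF 1 2] by (simp add: heat_kernel_def mult.assoc)
qed

text \<open>Half of the Gaussian exponent is set aside. The spare factor
  \<open>exp (- (norm x)^2 / (8 * t))\<close> absorbs powers of \<open>norm x / sqrt t\<close>, at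
  the price of doubling the time in the kernel that remains.\<close>

lemma heat_kernel_double:
  fixes x :: "'a::euclidean_space"
  assumes "t > 0"
  shows "heat_kernel t x = 2 powr (real DIM('a) / 2) * exp (- (norm x)\<^sup>2 / (8 * t)) * heat_kernel (2 * t) x"
proof -
  have "exp (- (norm x)\<^sup>2 / (4 * t)) = exp (- (norm x)\<^sup>2 / (8 * t)) * exp (- (norm x)\<^sup>2 / (4 * (2 * t)))"
    unfolding exp_add[symmetric] by (rule arg_cong[where f=exp]) (use assms in \<open>simp add: field_simps\<close>)
  moreover have "(4 * pi * t) powr (- real DIM('a) / 2) =
      2 powr (real DIM('a) / 2) * (4 * pi * (2 * t)) powr (- real DIM('a) / 2)"
  proof -
    have "(4 * pi * (2 * t)) powr (- real DIM('a) / 2) =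
        2 powr (- real DIM('a) / 2) * (4 * pi * t) powr (- real DIM('a) / 2)"
      unfolding powr_mult[symmetric] by (simp add: mult_ac)
    moreover have "2 powr (real DIM('a) / 2) * 2 powr (- real DIM('a) / 2) = (1::real)"
      by (simp add: powr_add[symmetric])
    ultimately show ?thesis
      by (metis mult.assoc mult_1)
  qed
  ultimately show ?thesis
    by (simp add: heat_kernel_def)
qed

lemma heat_kernel_le_double:
  fixes x :: "'a::euclidean_space"
  assumes "t > 0"
  shows "heat_kernel t x \<le> 2 powr (real DIM('a) / 2) * heat_kernel (2 * t) x"
proof -
  have "exp (- (norm x)\<^sup>2 / (8 * t)) \<le> 1"
    using assms by simp
  then have "2 powr (real DIM('a) / 2) * exp (- (norm x)\<^sup>2 / (8 * t)) * heat_kernel (2 * t) x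
    \<le> 2 powr (real DIM('a) / 2) * 1 * heat_kernel (2 * t) x"
    by (intro mult_right_mono mult_left_mono) auto
  then show ?thesis
    using heat_kernel_double[OF assms, of x] by simp
qed

lemma heat_kernel_norm_sq_bound:
  fixes x :: "'a::euclidean_space"
  assumes "t > 0"
  shows "(norm x)\<^sup>2 * heat_kernel t x \<le> 8 * t * 2 powr (real DIM('a) / 2) * heat_kernel (2 * t) x"
proof -
  have "(norm x)\<^sup>2 / (8 * t) \<le> exp ((norm x)\<^sup>2 / (8 * t))"
    using exp_ge_add_one_self[of "(norm x)\<^sup>2 / (8 * t)"] by linarith
  then have "(norm x)\<^sup>2 * exp (- (norm x)\<^sup>2 / (8 * t)) \<le> 8 * t"
    using assms by (simp add: exp_minus field_simps)
  then have "((norm x)\<^sup>2 * exp (- (norm x)\<^sup>2 / (8 * t))) * (2 powr (real DIM('a) / 2) * heat_kernel (2 * t) x) \<le>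
      8 * t * (2 powr (real DIM('a) / 2) * heat_kernel (2 * t) x)"
    by (intro mult_right_mono) auto
  then show ?thesis
    by (subst heat_kernel_double[OF assms]) (simp add: mult_ac)
qed

lemma heat_kernel_norm_bound:
  fixes x :: "'a::euclidean_space"
  assumes "t > 0"
  shows "norm x / (2 * t) * heat_kernel t x \<le> 2 powr (real DIM('a) / 2) * t powr (-1/2) * heat_kernel (2 * t) x"
proof -
  define r where "r = norm x / sqrt t"
  have r: "r\<^sup>2 = (norm x)\<^sup>2 / t" "norm x / (2 * t) = t powr (-1/2) * (r / 2)"
    using assms by (auto simp: r_def power_divide powr_minus_divide powr_half_sqrt real_div_sqrt field_simps)
  \<comment> \<open>The square yields even \<open>1/2 + r^2 / 8\<close>; the constant 1 is the one
    in \<open>1 + a \<le> exp a\<close>.\<close>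
  have "r / 2 \<le> 1 + r\<^sup>2 / 8"
    using zero_le_power2[of "r - 2"] by (simp add: power2_eq_square algebra_simps)
  also have "\<dots> \<le> exp (r\<^sup>2 / 8)" by (rule exp_ge_add_one_self)
  finally have "r / 2 * exp (- (norm x)\<^sup>2 / (8 * t)) \<le> 1"
    using assms unfolding r(1) by (simp add: exp_minus field_simps)
  then have "(r / 2 * exp (- (norm x)\<^sup>2 / (8 * t))) * (t powr (-1/2) * 2 powr (real DIM('a) / 2) * heat_kernel (2 * t) x)
      \<le> 1 * (t powr (-1/2) * 2 powr (real DIM('a) / 2) * heat_kernel (2 * t) x)"
    by (intro mult_right_mono) auto
  then show ?thesis
    by (subst heat_kernel_double[OF assms], subst r(2)) (simp add: mult_ac)
qed

section \<open>Derivatives of the heat kernel\<close>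

lemma heat_kernel_deriv_time:
  fixes x :: "'a::euclidean_space"
  assumes "t > 0"
  shows "((\<lambda>t. heat_kernel t x) has_real_derivative
     ((norm x)\<^sup>2 / (4 * t\<^sup>2) - real DIM('a) / (2 * t)) * heat_kernel t x) (at t)"
proof -
  \<comment> \<open>A single exponential makes the logarithmic derivative visible. It agrees with
    the kernel for positive times only, hence the transfer on an open half-line at the end.\<close>
  let ?g = "\<lambda>t. exp (- real DIM('a) / 2 * ln (4 * pi * t) + - (norm x)\<^sup>2 / (4 * t))"
  have eq: "?g s = heat_kernel s x" if "s > 0" for s
    using that unfolding exp_add by (simp add: heat_kernel_def powr_def)
  have "(?g has_real_derivative
     ((norm x)\<^sup>2 / (4 * t\<^sup>2) - real DIM('a) / (2 * t)) * ?g t) (at t)"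
  proof -
    have 1: "((\<lambda>t. ln (4 * pi * t)) has_real_derivative 1 / t) (at t)"
      using assms by (auto intro!: derivative_eq_intros)
    have 2: "((\<lambda>t. - (norm x)\<^sup>2 / (4 * t)) has_real_derivative (norm x)\<^sup>2 / (4 * t\<^sup>2)) (at t)"
      using assms by (auto intro!: derivative_eq_intros simp: power2_eq_square)
    have "((\<lambda>t. - real DIM('a) / 2 * ln (4 * pi * t) + - (norm x)\<^sup>2 / (4 * t)) has_real_derivative
       - real DIM('a) / 2 * (1 / t) + (norm x)\<^sup>2 / (4 * t\<^sup>2)) (at t)"
      by (intro DERIV_add DERIV_cmult 1 2)
    from DERIV_fun_exp[OF this] show ?thesis
      by (simp add: mult.commute)
  qed
  then have "(?g has_real_derivative
     ((norm x)\<^sup>2 / (4 * t\<^sup>2) - real DIM('a) / (2 * t)) * heat_kernel t x) (at t)"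
    by (simp only: eq[OF assms])
  then show ?thesis
    by (rule has_field_derivative_transform_within_open[where S="{0<..}"])
      (use assms in \<open>simp_all only: eq open_greaterThan greaterThan_iff\<close>)
qed

lemma heat_kernel_deriv_line:
  fixes x e :: "'a::euclidean_space"
  assumes "t > 0"
  shows "((\<lambda>h. heat_kernel t (x + h *\<^sub>R e)) has_real_derivative
     - ((x \<bullet> e) / (2 * t)) * heat_kernel t x) (at 0)"
proof -
  have eq: "(\<lambda>h. heat_kernel t (x + h *\<^sub>R e)) =
     (\<lambda>h. (4 * pi * t) powr (- real DIM('a) / 2) * exp (- (x \<bullet> x + 2 * h * (x \<bullet> e) + h\<^sup>2 * (e \<bullet> e)) / (4 * t)))"
    unfolding heat_kernel_def power2_norm_eq_inner
    by (simp add: inner_add_left inner_add_right inner_commute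
        power2_eq_square algebra_simps fun_eq_iff)
  have "((\<lambda>h. - (x \<bullet> x + 2 * h * (x \<bullet> e) + h\<^sup>2 * (e \<bullet> e)) / (4 * t)) has_real_derivative - ((x \<bullet> e) / (2 * t))) (at 0)"
    using assms by (auto intro!: derivative_eq_intros)
  from DERIV_cmult[OF DERIV_fun_exp[OF this], of "(4 * pi * t) powr (- real DIM('a) / 2)"]
  show ?thesis
    unfolding eq by (simp add: heat_kernel_def power2_norm_eq_inner mult_ac)
qed

lemma heat_kernel_gderiv:
  fixes x :: "'a::euclidean_space"
  assumes "t > 0"
  shows "GDERIV (heat_kernel t) x :> - (heat_kernel t x / (2 * t)) *\<^sub>R x"
proof -
  have "(heat_kernel t has_derivative (\<lambda>h. (4 * pi * t) powr (- real DIM('a) / 2) *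
     (exp (- (x \<bullet> x) / (4 * t)) * (- (2 * (x \<bullet> h)) / (4 * t))))) (at x)"
    unfolding heat_kernel_def[abs_def] power2_norm_eq_inner using assms
    by (auto intro!: derivative_eq_intros simp: inner_commute)
  then show ?thesis
    unfolding gderiv_def
    by (rule has_derivative_eq_rhs) (use assms in \<open>auto simp: heat_kernel_def power2_norm_eq_inner fun_eq_iff inner_commute field_simps\<close>)
qed

lemma gradient_heat_kernel:
  "t > 0 \<Longrightarrow> gradient (heat_kernel t) x = - (heat_kernel t x / (2 * t)) *\<^sub>R x"
  by (rule gradient_eqI[OF heat_kernel_gderiv])

section \<open>\<open>L^1\<close> distance between two heat kernels\<close>

lemma tendsto_0_ennrealI:
  fixes f :: "'b \<Rightarrow> ennreal"
  assumes "\<And>e. e > 0 \<Longrightarrow> \<forall>\<^sub>F x in F. f x \<le> ennreal e"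
  shows "(f \<longlongrightarrow> 0) F"
proof (rule order_tendstoI)
  fix a :: ennreal assume "0 < a"
  obtain e where e: "e > 0" "ennreal e < a"
  proof (cases a)
    case (real r)
    with \<open>0 < a\<close> show ?thesis by (intro that[of "r / 2"]) (auto simp: ennreal_less_iff)
  next
    case top then show ?thesis by (intro that[of 1]) auto
  qed
  show "\<forall>\<^sub>F x in F. f x < a"
    using assms[OF e(1)] by eventually_elim (use e in auto)
qed auto

text \<open>Up to a constant, the square root of the kernel at time \<open>t\<close> is the kernel
  at time \<open>2 * t\<close>. The constant is split on purpose: the first factor compares the
  geometric with the arithmetic mean of \<open>s\<close> and \<open>t\<close>, and the second
  cancels the prefactor of the kernel at time \<open>2 * s + 2 * t\<close>.\<close>

lemma sqrt_heat_kernel_mult: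
  fixes x z :: "'a::euclidean_space"
  assumes s: "s > 0" and t: "t > 0"
  shows "sqrt (heat_kernel s z) * sqrt (heat_kernel t x) =
     (2 * sqrt (s * t) / (s + t)) powr (real DIM('a) / 2) * (8 * pi * (s + t)) powr (real DIM('a) / 2) *
     (heat_kernel (2 * s) z * heat_kernel (2 * t) x)"
proof -
  define p where "p = real DIM('a) / 2"
  have 1: "heat_kernel r y = (4 * pi * r) powr (- p) * exp (- (norm y)\<^sup>2 / (4 * r))" for r and y :: 'a
    by (simp add: heat_kernel_def p_def)
  have sq: "sqrt (heat_kernel r y) = (4 * pi * r) powr (- p / 2) * exp (- (norm y)\<^sup>2 / (8 * r))"
    if "r > 0" for r and y :: 'a
    using that unfolding 1
    by (simp add: powr_half_sqrt[symmetric] powr_mult powr_powr exp_powr_real)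
  have st: "(4 * pi * s) powr (- p / 2) * (4 * pi * t) powr (- p / 2) = (4 * pi * sqrt (s * t)) powr (- p)"
  proof -
    have "4 * pi * sqrt (s * t) = ((4 * pi * s) * (4 * pi * t)) powr (1/2)"
      using s t by (simp add: powr_half_sqrt real_sqrt_mult)
    then have "(4 * pi * sqrt (s * t)) powr (- p) = ((4 * pi * s) * (4 * pi * t)) powr (- p / 2)"
      using s t by (simp add: powr_powr)
    then show ?thesis by (simp only: powr_mult)
  qed
  have c: "(4 * pi * sqrt (s * t)) powr (- p) = (2 * sqrt (s * t) / (s + t)) powr p * (8 * pi * (s + t)) powr p *
     ((4 * pi * (2 * s)) powr (- p) * (4 * pi * (2 * t)) powr (- p))"
  proof -
    have "2 * sqrt (s * t) / (s + t) * (8 * pi * (s + t)) * (4 * pi * sqrt (s * t)) = (4 * pi * (2 * s)) * (4 * pi * (2 * t))"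
    proof -
      have 1: "sqrt (s * t) * sqrt (s * t) = s * t" using s t by simp
      have 2: "2 * a / c * (8 * b * c) * (4 * b * a) = 64 * b * b * (a * a)" if "c \<noteq> 0" for a b c :: real
        using that by simp
      have "s + t \<noteq> 0" using s t by simp
      then show ?thesis unfolding 2[OF \<open>s + t \<noteq> 0\<close>] 1 by (simp only: mult_ac)
    qed
    then have "(2 * sqrt (s * t) / (s + t)) powr p * (8 * pi * (s + t)) powr p * (4 * pi * sqrt (s * t)) powr p =
       (4 * pi * (2 * s)) powr p * (4 * pi * (2 * t)) powr p"
      unfolding powr_mult[symmetric] by (simp only:)
    then show ?thesis
      using s t by (simp add: powr_minus divide_simps)
  qed
  have "sqrt (heat_kernel s z) * sqrt (heat_kernel t x) =
     ((4 * pi * s) powr (- p / 2) * (4 * pi * t) powr (- p / 2)) * (exp (- (norm z)\<^sup>2 / (8 * s)) * exp (- (norm x)\<^sup>2 / (8 * t)))"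
    using s t by (simp add: sq)
  then show ?thesis
    unfolding st c 1 p_def[symmetric] by (simp add: mult_ac)
qed

text \<open>The Hellinger affinity (Bhattacharyya coefficient) of two Gaussian laws. By the previous
  identity it is a constant multiple of a convolution of kernels, which the semigroup law
  evaluates.\<close>

lemma heat_kernel_affinity:
  fixes y :: "'a::euclidean_space"
  assumes s: "s > 0" and t: "t > 0"
  shows "has_bochner_integral lborel (\<lambda>x. sqrt (heat_kernel s (y - x)) * sqrt (heat_kernel t x))
    ((2 * sqrt (s * t) / (s + t)) powr (real DIM('a) / 2) * exp (- (norm y)\<^sup>2 / (8 * (s + t))))"
    (is "has_bochner_integral _ _ ?A")
proof (rule has_bochner_integral_nn_integral)
  define c where "c = (2 * sqrt (s * t) / (s + t)) powr (real DIM('a) / 2) * (8 * pi * (s + t)) powr (real DIM('a) / 2)"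
  have "(\<integral>\<^sup>+x. ennreal (sqrt (heat_kernel s (y - x)) * sqrt (heat_kernel t x)) \<partial>lborel) =
     (\<integral>\<^sup>+x. ennreal c * ennreal (heat_kernel (2 * s) (y - x) * heat_kernel (2 * t) (x - 0)) \<partial>lborel)"
    using s t unfolding sqrt_heat_kernel_mult[OF s t] c_def[symmetric]
    by (intro nn_integral_cong) (simp add: ennreal_mult[symmetric] c_def)
  also have "\<dots> = ennreal c * ennreal (heat_kernel (2 * s + 2 * t) (y - 0))"
    using s t by (subst nn_integral_cmult) (simp_all only: heat_kernel_semigroup, auto)
  also have "\<dots> = ennreal ?A"
  proof -
    have "c * heat_kernel (2 * s + 2 * t) y = ?A"
      using s t unfolding c_def heat_kernel_def
      by (simp add: powr_minus algebra_simps) (simp add: divide_simps distrib_left[symmetric])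
    then show ?thesis by (simp add: ennreal_mult[symmetric] c_def)
  qed
  finally show "(\<integral>\<^sup>+x. ennreal (sqrt (heat_kernel s (y - x)) * sqrt (heat_kernel t x)) \<partial>lborel) = ennreal ?A" .
qed (use s t in auto)

text \<open>With \<open>a = sqrt f\<close> and \<open>b = sqrt g\<close>, Young's inequality with
  parameter \<open>h\<close> bounds \<open>|f - g| = |a - b| (a + b)\<close> by
  \<open>(a - b)^2 / (2h) + h (a + b)^2 / 2\<close>. The integrals of \<open>(a - b)^2\<close> and
  \<open>(a + b)^2\<close> are \<open>2 - 2A\<close> and \<open>2 + 2A\<close>, where
  \<open>A\<close> is the affinity.\<close>

lemma heat_kernel_L1_dist:
  fixes y :: "'a::euclidean_space"
  assumes s: "s > 0" and t: "t > 0" and h: "h > 0"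
  defines "A \<equiv> (2 * sqrt (s * t) / (s + t)) powr (real DIM('a) / 2) * exp (- (norm y)\<^sup>2 / (8 * (s + t)))"
  shows "(\<integral>\<^sup>+x. ennreal \<bar>heat_kernel s (x - y) - heat_kernel t x\<bar> \<partial>lborel) \<le> ennreal ((1 - A) / h + h * (1 + A))"
proof -
  define f where "f x = heat_kernel s (y - x)" for x
  define g where "g x = heat_kernel t x" for x :: 'a
  have fg: "f x \<ge> 0" "g x \<ge> 0" for x by (auto simp: f_def g_def)
  have I: "has_bochner_integral lborel f 1" "has_bochner_integral lborel g 1"
     "has_bochner_integral lborel (\<lambda>x. sqrt (f x) * sqrt (g x)) A"
    using has_bochner_integral_heat_kernel[OF s, of y] has_bochner_integral_heat_kernel'[OF t, of 0]
      heat_kernel_affinity[OF s t, of y]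
    by (simp_all add: f_def[abs_def] g_def[abs_def] A_def)
  let ?b = "\<lambda>x. (1 / (2 * h) + h / 2) * (f x + g x) + (h - 1 / h) * (sqrt (f x) * sqrt (g x))"
  have le: "\<bar>f x - g x\<bar> \<le> ?b x" for x
  proof -
    define a b where "a = sqrt (f x)" "b = sqrt (g x)"
    have ab: "f x = a\<^sup>2" "g x = b\<^sup>2" "a \<ge> 0" "b \<ge> 0"
      using fg by (auto simp: a_b_def)
    have 1: "\<bar>a\<^sup>2 - b\<^sup>2\<bar> = \<bar>a - b\<bar> * (a + b)"
    proof -
      have "a\<^sup>2 - b\<^sup>2 = (a - b) * (a + b)" by (simp add: power2_eq_square algebra_simps)
      then show ?thesis using ab by (simp add: abs_mult)
    qed
    have "0 \<le> (\<bar>a - b\<bar> - h * (a + b))\<^sup>2 / (2 * h)"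
      using h by simp
    also have "\<dots> = (1 / (2 * h) + h / 2) * (a\<^sup>2 + b\<^sup>2) + (h - 1 / h) * (a * b) - \<bar>a - b\<bar> * (a + b)"
      using h by (simp add: power2_diff power_mult_distrib power2_eq_square field_simps)
    finally show ?thesis
      unfolding ab 1 using ab by (simp add: real_sqrt_mult[symmetric] real_sqrt_abs)
  qed
  have B: "has_bochner_integral lborel ?b ((1 / (2 * h) + h / 2) * (1 + 1) + (h - 1 / h) * A)"
    by (intro has_bochner_integral_add has_bochner_integral_mult_right I)
  have "(\<integral>\<^sup>+x. ennreal \<bar>heat_kernel s (x - y) - heat_kernel t x\<bar> \<partial>lborel) = (\<integral>\<^sup>+x. ennreal \<bar>f x - g x\<bar> \<partial>lborel)"
    by (simp add: f_def g_def heat_kernel_commute)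
  also have "\<dots> \<le> (\<integral>\<^sup>+x. ennreal (?b x) \<partial>lborel)"
    by (intro nn_integral_mono ennreal_leI le)
  also have "\<dots> = ennreal ((1 / (2 * h) + h / 2) * (1 + 1) + (h - 1 / h) * A)"
    using B le by (subst nn_integral_eq_integral) (auto simp: has_bochner_integral_iff intro!: AE_I2 order.trans[OF abs_ge_zero le])
  also have "(1 / (2 * h) + h / 2) * (1 + 1) + (h - 1 / h) * A = (1 - A) / h + h * (1 + A)"
    using h by (simp add: field_simps)
  finally show ?thesis .
qed

text \<open>For fixed \<open>y\<close> and \<open>T\<close> the affinity tends to 1. With
  \<open>h = e / 4\<close> chosen beforehand the limit of the explicit bound is
  \<open>2 * h = e / 2\<close>, strictly below \<open>e\<close>.\<close>

lemma heat_kernel_shift_L1_tendsto: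
  fixes y :: "'a::euclidean_space"
  shows "((\<lambda>t. \<integral>\<^sup>+x. ennreal \<bar>heat_kernel (t - T) (x - y) - heat_kernel t x\<bar> \<partial>lborel) \<longlongrightarrow> 0) at_top"
proof (rule tendsto_0_ennrealI)
  fix e :: real assume e: "e > 0"
  define h where "h = e / 4"
  have h: "h > 0" using e by (simp add: h_def)
  define A where "A t = (2 * sqrt ((t - T) * t) / ((t - T) + t)) powr (real DIM('a) / 2) * exp (- (norm y)\<^sup>2 / (8 * ((t - T) + t)))" for t
  have "((\<lambda>t. 2 * sqrt ((t - T) * t) / ((t - T) + t)) \<longlongrightarrow> 1) at_top" by real_asymp
  moreover have "((\<lambda>t. exp (- (norm y)\<^sup>2 / (8 * ((t - T) + t)))) \<longlongrightarrow> 1) at_top" by real_asymp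
  ultimately have "(A \<longlongrightarrow> 1 powr (real DIM('a) / 2) * 1) at_top"
    unfolding A_def by (intro tendsto_intros) auto
  then have "((\<lambda>t. (1 - A t) / h + h * (1 + A t)) \<longlongrightarrow> (1 - 1) / h + h * (1 + 1)) at_top"
    using h by (intro tendsto_intros) auto
  then have "\<forall>\<^sub>F t in at_top. (1 - A t) / h + h * (1 + A t) < e"
    using h e by (intro order_tendstoD(2)[of _ "(1 - 1) / h + h * (1 + 1)"]) (auto simp: h_def)
  then show "\<forall>\<^sub>F t in at_top. (\<integral>\<^sup>+x. ennreal \<bar>heat_kernel (t - T) (x - y) - heat_kernel t x\<bar> \<partial>lborel) \<le> ennreal e"
    using eventually_gt_at_top[of "max 0 T"]
  proof eventually_elim
    case (elim t)
    then show ?case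
      using heat_kernel_L1_dist[of "t - T" t h y] h
      by (intro order.trans[OF heat_kernel_L1_dist[of "t - T" t h y]] ennreal_leI) (auto simp: A_def)
  qed
qed

section \<open>Green's identity for parabolic equations\<close>

lemma DERIV_along_line_shift:
  fixes F F' :: "'a::real_normed_vector \<Rightarrow> real"
  assumes "\<And>y. ((\<lambda>h. F (y + h *\<^sub>R e)) has_real_derivative F' y) (at 0)"
  shows "((\<lambda>h. F (y + h *\<^sub>R e)) has_real_derivative F' (y + r *\<^sub>R e)) (at r)"
  using assms[of "y + r *\<^sub>R e"] DERIV_shift[of "\<lambda>h. F (y + h *\<^sub>R e)" "F' (y + r *\<^sub>R e)" 0 r]
  by (simp add: scaleR_add_left add_ac)

text \<open>Integrate \<open>F'\<close> along segments of direction \<open>e\<close> over a unit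
  time: in one order of integration this is the integral of \<open>F (y + e) - F y\<close>, which
  vanishes by translation invariance; in the other order it is the integral of \<open>F'\<close>.
  All integrations by parts below rest on this.\<close>

lemma integral_directional_derivative_eq_0:
  fixes F F' :: "'a::euclidean_space \<Rightarrow> real" and e :: 'a
  assumes F: "integrable lborel F" and F': "integrable lborel F'"
    and cont: "continuous_on UNIV F'"
    and der: "\<And>y. ((\<lambda>h. F (y + h *\<^sub>R e)) has_real_derivative F' y) (at 0)"
  shows "(LINT y|lborel. F' y) = 0"
proof -
  have [measurable]: "F' \<in> borel_measurable borel"
    using cont by (rule borel_measurable_continuous_onI)
  have der': "((\<lambda>h. F (y + h *\<^sub>R e)) has_real_derivative F' (y + r *\<^sub>R e)) (at r)" for y r
    by (rule DERIV_along_line_shift) (rule der)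
  have "(LINT r|lborel. indicator {0..1} r *\<^sub>R F' (y + r *\<^sub>R e)) = F (y + 1 *\<^sub>R e) - F (y + 0 *\<^sub>R e)" for y
    by (rule integral_FTC_atLeastAtMost)
       (auto intro!: has_field_derivative_at_within[OF der'] continuous_intros continuous_on_compose2[OF cont]
         simp flip: has_real_derivative_iff_has_vector_derivative)
  then have "(LINT y|lborel. (LINT r|lborel. indicator {0..1} r *\<^sub>R F' (y + r *\<^sub>R e))) =
     (LINT y|lborel. F (e + y) - F y)"
    by (simp add: add.commute)
  also have "\<dots> = 0"
    using F integrable_lborel_translate[OF F, of e]
    by (simp add: integral_lborel_translate)
  finally have 0: "(LINT y|lborel. (LINT r|lborel. indicator {0..1} r *\<^sub>R F' (y + r *\<^sub>R e))) = 0" .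
  have norm_eq: "(LINT y|lborel. norm (indicator {0..1} r *\<^sub>R F' (y + r *\<^sub>R e))) =
      indicator {0..1} r *\<^sub>R (LINT y|lborel. \<bar>F' y\<bar>)" for r :: real
    using integral_lborel_translate[of "\<lambda>y. \<bar>F' y\<bar>" "r *\<^sub>R e"]
    by (simp add: abs_mult add.commute)
  have "integrable (lborel \<Otimes>\<^sub>M lborel) (\<lambda>(r, y). indicator {0..1::real} r *\<^sub>R F' (y + r *\<^sub>R e))"
  proof (rule lborel_pair.Fubini_integrable)
    show "integrable lborel (\<lambda>r. LINT y|lborel. norm (case (r, y) of (r, y) \<Rightarrow> indicator {0..1::real} r *\<^sub>R F' (y + r *\<^sub>R e)))"
      unfolding prod.case norm_eq by (intro integrable_scaleR_left integrable_real_indicator) auto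
    show "AE r in lborel. integrable lborel (\<lambda>y. case (r, y) of (r, y) \<Rightarrow> indicator {0..1::real} r *\<^sub>R F' (y + r *\<^sub>R e))"
    proof (rule AE_I2)
      show "integrable lborel (\<lambda>y. case (r, y) of (r, y) \<Rightarrow> indicator {0..1::real} r *\<^sub>R F' (y + r *\<^sub>R e))" for r
        using integrable_lborel_translate[OF F', of "r *\<^sub>R e"] by (simp add: add.commute)
    qed
  qed measurable
  from lborel_pair.Fubini_integral[OF this] 0
  have "0 = (LINT r|lborel. (LINT y|lborel. indicator {0..1::real} r *\<^sub>R F' (y + r *\<^sub>R e)))"
    by simp
  also have "\<dots> = (LINT r|lborel. indicator {0..1::real} r *\<^sub>R (LINT y|lborel. F' y))"
  proof (intro Bochner_Integration.integral_cong refl)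
    show "(LINT y|lborel. indicator {0..1::real} r *\<^sub>R F' (y + r *\<^sub>R e)) = indicator {0..1::real} r *\<^sub>R (LINT y|lborel. F' y)" for r
      using integral_lborel_translate[of F' "r *\<^sub>R e"] by (simp add: add.commute)
  qed
  also have "\<dots> = (LINT y|lborel. F' y)"
    by (subst integral_scaleR_left) auto
  finally show ?thesis by simp
qed

text \<open>Squaring removes the kink of the truncated paraboloid and makes it \<open>C^1\<close>.
  One derivative suffices, since Green's identity puts at most one on the cutoff; its size is of
  order \<open>1 / Suc n\<close>. The successor keeps the radius positive.\<close>

definition cutoff :: "nat \<Rightarrow> 'a::euclidean_space \<Rightarrow> real" where
  "cutoff n y = (max 0 (1 - (norm y)\<^sup>2 / (real (Suc n))\<^sup>2))\<^sup>2"

definition cutoff_deriv :: "nat \<Rightarrow> 'a::euclidean_space \<Rightarrow> 'a \<Rightarrow> real" where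
  "cutoff_deriv n e y = 2 * max 0 (1 - (norm y)\<^sup>2 / (real (Suc n))\<^sup>2) * (- (2 * (y \<bullet> e) / (real (Suc n))\<^sup>2))"

lemma DERIV_max_0_square: "((\<lambda>r::real. (max 0 r)\<^sup>2) has_real_derivative 2 * max 0 r) (at r)"
proof -
  consider "r > 0" | "r < 0" | "r = 0" by linarith
  then show ?thesis
  proof cases
    case 1
    have "((\<lambda>r::real. r\<^sup>2) has_real_derivative 2 * max 0 r) (at r)"
      using 1 by (auto intro!: derivative_eq_intros)
    then show ?thesis
      by (rule has_field_derivative_transform_within_open[where S="{0<..}"]) (use 1 in auto)
  next
    case 2
    have "((\<lambda>r::real. 0) has_real_derivative 2 * max 0 r) (at r)"
      using 2 by (auto intro!: derivative_eq_intros)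
    then show ?thesis
      by (rule has_field_derivative_transform_within_open[where S="{..<0}"]) (use 2 in auto)
  next
    case 3
    have "((\<lambda>h::real. max 0 h) \<longlongrightarrow> max 0 0) (at 0)"
      by (intro tendsto_intros)
    then have "((\<lambda>h::real. ((max 0 (0 + h))\<^sup>2 - (max 0 0)\<^sup>2) / h) \<longlongrightarrow> 0) (at 0)"
      by (rule Lim_transform_eventually[OF tendsto_eq_rhs])
        (auto simp: eventually_at_filter max_def power2_eq_square)
    then show ?thesis
      by (simp add: DERIV_def 3)
  qed
qed

lemma cutoff_has_derivative:
  fixes y e :: "'a::euclidean_space"
  shows "((\<lambda>h. cutoff n (y + h *\<^sub>R e)) has_real_derivative cutoff_deriv n e y) (at 0)"
proof -
  define R where "R = (real (Suc n))\<^sup>2"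
  have R: "R > 0" by (simp add: R_def)
  have eq: "1 - (norm (y + h *\<^sub>R e))\<^sup>2 / R = 1 - (y \<bullet> y + 2 * h * (y \<bullet> e) + h\<^sup>2 * (e \<bullet> e)) / R" for h
    unfolding power2_norm_eq_inner
    by (simp add: inner_add_left inner_add_right inner_commute[of e y] power2_eq_square algebra_simps)
  have 1: "((\<lambda>h. 1 - (norm (y + h *\<^sub>R e))\<^sup>2 / R) has_real_derivative - (2 * (y \<bullet> e) / R)) (at 0)"
    unfolding eq using R by (auto intro!: derivative_eq_intros)
  show ?thesis
    using DERIV_chain2[OF DERIV_max_0_square 1]
    by (simp add: cutoff_def cutoff_deriv_def R_def)
qed

lemma continuous_on_cutoff [continuous_intros]:
  "continuous_on S (cutoff n)" "continuous_on S (cutoff_deriv n e)"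
  unfolding cutoff_def cutoff_deriv_def by (intro continuous_intros; simp)+

lemma cutoff_outside:
  assumes "norm y \<ge> real (Suc n)"
  shows "cutoff n y = 0" "cutoff_deriv n e y = 0"
proof -
  have "(real (Suc n))\<^sup>2 \<le> (norm y)\<^sup>2"
    using assms by (intro power_mono) auto
  then have "1 \<le> (norm y)\<^sup>2 / (real (Suc n))\<^sup>2"
    by (subst le_divide_eq_1_pos) (auto simp del: of_nat_Suc)
  then show "cutoff n y = 0" "cutoff_deriv n e y = 0"
    by (auto simp: cutoff_def cutoff_deriv_def max_def)
qed

lemma cutoff_bounds: "0 \<le> cutoff n y" "cutoff n y \<le> 1"
proof -
  show "0 \<le> cutoff n y" by (simp add: cutoff_def)
  have "max 0 (1 - (norm y)\<^sup>2 / (real (Suc n))\<^sup>2) \<le> 1" by simp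
  then show "cutoff n y \<le> 1"
    unfolding cutoff_def by (intro power_le_one) auto
qed

lemma cutoff_deriv_bound:
  assumes e: "norm e \<le> 1"
  shows "\<bar>cutoff_deriv n e y\<bar> \<le> 4 / real (Suc n)"
proof (cases "norm y \<ge> real (Suc n)")
  case True
  then show ?thesis by (simp add: cutoff_outside)
next
  case False
  define m where "m = max 0 (1 - (norm y)\<^sup>2 / (real (Suc n))\<^sup>2)"
  have m: "0 \<le> m" "m \<le> 1" by (auto simp: m_def)
  have "\<bar>y \<bullet> e\<bar> \<le> norm y * norm e" by (rule Cauchy_Schwarz_ineq2)
  also have "\<dots> \<le> real (Suc n) * 1"
    using False e by (intro mult_mono) auto
  finally have ye: "\<bar>y \<bullet> e\<bar> \<le> real (Suc n)" by simp
  have "\<bar>cutoff_deriv n e y\<bar> = m * (4 * \<bar>y \<bullet> e\<bar> / (real (Suc n))\<^sup>2)"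
    using m unfolding cutoff_deriv_def m_def[symmetric] by (simp add: abs_mult del: of_nat_Suc)
  also have "\<dots> \<le> 1 * (4 * real (Suc n) / (real (Suc n))\<^sup>2)"
    using m ye by (intro mult_mono divide_right_mono) auto
  also have "\<dots> = 4 / real (Suc n)"
    by (simp add: power2_eq_square del: of_nat_Suc)
  finally show ?thesis .
qed

lemma cutoff_tendsto_1: "(\<lambda>n. cutoff n y) \<longlonglongrightarrow> 1"
proof -
  have "(\<lambda>n. (max 0 (1 - (norm y)\<^sup>2 / (real (Suc n))\<^sup>2))\<^sup>2) \<longlonglongrightarrow> (max 0 (1 - 0))\<^sup>2"
    by (intro tendsto_power tendsto_max tendsto_diff tendsto_const) real_asymp
  then show ?thesis by (simp add: cutoff_def)
qed

text \<open>
  \<open>C\<^sup>2\<^sup>,\<^sup>1\<close> regularity in terms of one-dimensional derivatives: \<open>v1 i\<close> and \<open>v2 i\<close> are the first and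
  the second derivative in the coordinate direction \<open>i\<close>.
\<close>

definition C21_line :: "real set \<Rightarrow> (real \<Rightarrow> 'a::euclidean_space \<Rightarrow> real) \<Rightarrow> (real \<Rightarrow> 'a \<Rightarrow> real) \<Rightarrow>
    ('a \<Rightarrow> real \<Rightarrow> 'a \<Rightarrow> real) \<Rightarrow> ('a \<Rightarrow> real \<Rightarrow> 'a \<Rightarrow> real) \<Rightarrow> bool" where
  "C21_line I v vt v1 v2 \<longleftrightarrow>
     continuous_on (I \<times> UNIV) (\<lambda>(s, y). v s y) \<and> continuous_on (I \<times> UNIV) (\<lambda>(s, y). vt s y) \<and>
     (\<forall>i\<in>Basis. continuous_on (I \<times> UNIV) (\<lambda>(s, y). v1 i s y) \<and> continuous_on (I \<times> UNIV) (\<lambda>(s, y). v2 i s y)) \<and>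
     (\<forall>s\<in>I. \<forall>y. ((\<lambda>s. v s y) has_real_derivative vt s y) (at s) \<and>
        (\<forall>i\<in>Basis. ((\<lambda>h. v s (y + h *\<^sub>R i)) has_real_derivative v1 i s y) (at 0) \<and>
           ((\<lambda>h. v1 i s (y + h *\<^sub>R i)) has_real_derivative v2 i s y) (at 0)))"

lemma integrable_continuous_support:
  fixes g :: "'a::euclidean_space \<Rightarrow> real"
  assumes "continuous_on S g" "compact S" "\<And>y. y \<notin> S \<Longrightarrow> g y = 0"
  shows "integrable lborel g"
proof -
  have "integrable lborel (\<lambda>x. indicator S x *\<^sub>R g x)"
    using assms(2,1) by (rule borel_integrable_compact)
  also have "(\<lambda>x. indicator S x *\<^sub>R g x) = g"
    using assms(3) by (auto simp: indicator_def fun_eq_iff)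
  finally show ?thesis .
qed

text \<open>As \<open>\<phi>\<close> solves the backward heat equation, the time derivative of
  \<open>\<phi> u\<close> is the divergence of \<open>\<phi> \<nabla>u - u \<nabla>\<phi>\<close>
  minus \<open>\<phi> f\<close>. Against the cutoff the divergence is moved to the cutoff, which
  produces the remainder \<open>B\<close>; only first derivatives of \<open>\<phi>\<close> and
  \<open>u\<close> survive in it.\<close>

lemma green_identity_cutoff:
  fixes \<phi> \<phi>t u ut f :: "real \<Rightarrow> 'a::euclidean_space \<Rightarrow> real" and \<phi>1 \<phi>2 u1 u2 :: "'a \<Rightarrow> real \<Rightarrow> 'a \<Rightarrow> real" and n :: nat
  assumes s: "s1 \<le> s2"
    and \<phi>: "C21_line {s1..s2} \<phi> \<phi>t \<phi>1 \<phi>2" and u: "C21_line {s1..s2} u ut u1 u2"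
    and \<phi>eq: "\<And>s y. s \<in> {s1..s2} \<Longrightarrow> \<phi>t s y = - (\<Sum>i\<in>Basis. \<phi>2 i s y)"
    and ueq: "\<And>s y. s \<in> {s1..s2} \<Longrightarrow> ut s y = (\<Sum>i\<in>Basis. u2 i s y) - f s y"
  defines "B \<equiv> \<lambda>s y. \<Sum>i\<in>Basis. cutoff_deriv n i y * (\<phi> s y * u1 i s y - u s y * \<phi>1 i s y)"
  shows "(LINT y|lborel. \<phi> s2 y * u s2 y * cutoff n y) - (LINT y|lborel. \<phi> s1 y * u s1 y * cutoff n y) =
     - (LINT p|(lborel \<Otimes>\<^sub>M lborel). indicator {s1..s2} (fst p) * (\<phi> (fst p) (snd p) * f (fst p) (snd p) * cutoff n (snd p)))
     - (LINT p|(lborel \<Otimes>\<^sub>M lborel). indicator {s1..s2} (fst p) * B (fst p) (snd p))"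
proof -
  let ?K = "cball 0 (real (Suc n)) :: 'a set"
  let ?\<chi> = "cutoff n :: 'a \<Rightarrow> real"
  define D where "D s y = (\<phi>t s y * u s y + \<phi> s y * ut s y) * ?\<chi> y" for s y
  define E where "E s y = \<phi> s y * f s y * ?\<chi> y" for s y
  have supp: "?\<chi> y = 0" "cutoff_deriv n i y = 0" if "y \<notin> ?K" for i y
    using that by (auto intro!: cutoff_outside)
  have slice: "continuous_on S (g s)" if "continuous_on ({s1..s2} \<times> UNIV) (\<lambda>(s, y). g s y)" "s \<in> {s1..s2}"
    for g :: "real \<Rightarrow> 'a \<Rightarrow> real" and s S
  proof -
    have "continuous_on S (\<lambda>y. (s, y))" by (intro continuous_intros)
    from continuous_on_compose2[OF that(1) this] that(2) show ?thesis
      by (simp add: image_subset_iff)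
  qed
  have tslice: "continuous_on {s1..s2} (\<lambda>s. g s y)" if "continuous_on ({s1..s2} \<times> UNIV) (\<lambda>(s, y). g s y)"
    for g :: "real \<Rightarrow> 'a \<Rightarrow> real" and y
  proof -
    have "continuous_on {s1..s2} (\<lambda>s. (s, y))" by (intro continuous_intros)
    from continuous_on_compose2[OF that this] show ?thesis
      by (simp add: image_subset_iff)
  qed
  have cu: "continuous_on ({s1..s2} \<times> UNIV) (\<lambda>(s, y). u s y)" "continuous_on ({s1..s2} \<times> UNIV) (\<lambda>(s, y). ut s y)"
    "i \<in> Basis \<Longrightarrow> continuous_on ({s1..s2} \<times> UNIV) (\<lambda>(s, y). u1 i s y)"
    "i \<in> Basis \<Longrightarrow> continuous_on ({s1..s2} \<times> UNIV) (\<lambda>(s, y). u2 i s y)"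
    "continuous_on ({s1..s2} \<times> UNIV) (\<lambda>(s, y). \<phi> s y)" "continuous_on ({s1..s2} \<times> UNIV) (\<lambda>(s, y). \<phi>t s y)"
    "i \<in> Basis \<Longrightarrow> continuous_on ({s1..s2} \<times> UNIV) (\<lambda>(s, y). \<phi>1 i s y)"
    "i \<in> Basis \<Longrightarrow> continuous_on ({s1..s2} \<times> UNIV) (\<lambda>(s, y). \<phi>2 i s y)" for i
    using u \<phi> unfolding C21_line_def by auto
  have cf: "continuous_on ({s1..s2} \<times> UNIV) (\<lambda>(s, y). f s y)"
  proof -
    have "continuous_on ({s1..s2} \<times> UNIV) (\<lambda>p. (\<Sum>i\<in>Basis. u2 i (fst p) (snd p)) - ut (fst p) (snd p))"
      using cu by (intro continuous_intros) (auto simp: case_prod_beta')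
    then show ?thesis
      by (rule continuous_on_eq) (auto simp: ueq)
  qed
  have c\<chi>: "continuous_on S (\<lambda>p. ?\<chi> (snd p))" "continuous_on S (\<lambda>p. cutoff_deriv n i (snd p))" for S :: "(real \<times> 'a) set" and i
    using continuous_on_compose2[OF continuous_on_cutoff(1)[of UNIV n], of S snd]
      continuous_on_compose2[OF continuous_on_cutoff(2)[of UNIV n i], of S snd]
      continuous_on_snd[OF continuous_on_id, of S]
    by auto
  note c2 = cu[unfolded case_prod_beta'] cf[unfolded case_prod_beta'] c\<chi>
  have cont2: "continuous_on ({s1..s2} \<times> UNIV) (\<lambda>p. D (fst p) (snd p))"
      "continuous_on ({s1..s2} \<times> UNIV) (\<lambda>p. E (fst p) (snd p))"
      "continuous_on ({s1..s2} \<times> UNIV) (\<lambda>p. B (fst p) (snd p))"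
    unfolding D_def E_def B_def by (intro continuous_intros c2; assumption)+
  have int2: "integrable (lborel \<Otimes>\<^sub>M lborel) (\<lambda>p. indicator {s1..s2} (fst p) * g (fst p) (snd p))"
    if "continuous_on ({s1..s2} \<times> UNIV) (\<lambda>p. g (fst p) (snd p))" "\<And>s y. y \<notin> ?K \<Longrightarrow> g s y = 0"
    for g :: "real \<Rightarrow> 'a \<Rightarrow> real"
    unfolding lborel_prod
  proof (rule integrable_continuous_support[where S="{s1..s2} \<times> ?K"])
    show "continuous_on ({s1..s2} \<times> ?K) (\<lambda>p. indicator {s1..s2} (fst p) * g (fst p) (snd p))"
      by (rule continuous_on_eq[OF continuous_on_subset[OF that(1)]]) auto
    show "indicator {s1..s2} (fst p) * g (fst p) (snd p) = 0" if p: "p \<notin> {s1..s2} \<times> ?K" for p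
      using p \<open>\<And>s y. y \<notin> ?K \<Longrightarrow> g s y = 0\<close>[of "snd p" "fst p"]
      by (auto simp: indicator_def mem_Times_iff simp del: mem_cball mem_cball_0)
  qed (auto intro!: compact_Times)
  have supp3: "y \<notin> ?K \<Longrightarrow> D s y = 0" "y \<notin> ?K \<Longrightarrow> E s y = 0" "y \<notin> ?K \<Longrightarrow> B s y = 0" for s y
    by (simp_all add: D_def E_def B_def supp)
  note intD = int2[OF cont2(1) supp3(1)] and intE = int2[OF cont2(2) supp3(2)] and intB = int2[OF cont2(3) supp3(3)]
  have time: "(LINT s|lborel. indicator {s1..s2} s *\<^sub>R D s y) = \<phi> s2 y * u s2 y * ?\<chi> y - \<phi> s1 y * u s1 y * ?\<chi> y" for y
  proof (rule integral_FTC_atLeastAtMost[OF s])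
    show "((\<lambda>s. \<phi> s y * u s y * ?\<chi> y) has_vector_derivative D s y) (at s within {s1..s2})" if "s1 \<le> s" "s \<le> s2" for s
    proof -
      have 1: "((\<lambda>s. \<phi> s y) has_real_derivative \<phi>t s y) (at s)" "((\<lambda>s. u s y) has_real_derivative ut s y) (at s)"
        using \<phi> u that by (auto simp: C21_line_def)
      have "((\<lambda>s. \<phi> s y * u s y * ?\<chi> y) has_real_derivative D s y) (at s)"
        unfolding D_def by (rule derivative_eq_intros 1 refl)+ (simp add: algebra_simps)
      then show ?thesis
        unfolding has_real_derivative_iff_has_vector_derivative by (rule has_vector_derivative_at_within)
    qed
    show "continuous_on {s1..s2} (\<lambda>s. D s y)"
      by (rule tslice) (use cont2(1) in \<open>simp add: case_prod_beta'\<close>)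
  qed
  have sup_int: "integrable lborel (\<lambda>y. \<phi> s y * u s y * ?\<chi> y)" if "s \<in> {s1..s2}" for s
    by (rule integrable_continuous_support[where S="?K"])
       (use that in \<open>auto simp: supp intro!: continuous_intros slice[OF cu(1)] slice[OF cu(5)]\<close>)
  \<comment> \<open>\<open>D + E + B\<close> is the divergence of the compactly supported field with
    components \<open>F i\<close>, so each summand integrates to zero along its own
    coordinate.\<close>
  have space: "(LINT y|lborel. D s y + E s y + B s y) = 0" if sI: "s \<in> {s1..s2}" for s
  proof -
    define F where "F i y = ?\<chi> y * (\<phi> s y * u1 i s y - u s y * \<phi>1 i s y)" for i y
    define F' where "F' i y = cutoff_deriv n i y * (\<phi> s y * u1 i s y - u s y * \<phi>1 i s y) +
        ?\<chi> y * (\<phi> s y * u2 i s y - u s y * \<phi>2 i s y)" for i y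
    note sl = slice[OF cu(1) sI] slice[OF cu(3) sI] slice[OF cu(4) sI] slice[OF cu(5) sI] slice[OF cu(7) sI] slice[OF cu(8) sI]
    have cF: "continuous_on S (F i)" "continuous_on S (F' i)" if "i \<in> Basis" for i S
      unfolding F_def F'_def by (intro continuous_intros sl that)+
    have iF: "integrable lborel (F i)" "integrable lborel (F' i)" if "i \<in> Basis" for i
      by (rule integrable_continuous_support[where S="?K"]; use cF that in \<open>auto simp: supp F_def F'_def\<close>)+
    have "(LINT y|lborel. F' i y) = 0" if i: "i \<in> Basis" for i
    proof (rule integral_directional_derivative_eq_0[OF iF[OF i] cF(2)[OF i]])
      fix y
      have 1: "((\<lambda>h. \<phi> s (y + h *\<^sub>R i)) has_real_derivative \<phi>1 i s y) (at 0)"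
        "((\<lambda>h. \<phi>1 i s (y + h *\<^sub>R i)) has_real_derivative \<phi>2 i s y) (at 0)"
        "((\<lambda>h. u s (y + h *\<^sub>R i)) has_real_derivative u1 i s y) (at 0)"
        "((\<lambda>h. u1 i s (y + h *\<^sub>R i)) has_real_derivative u2 i s y) (at 0)"
        using \<phi> u sI i by (auto simp: C21_line_def)
      show "((\<lambda>h. F i (y + h *\<^sub>R i)) has_real_derivative F' i y) (at 0)"
        unfolding F_def F'_def by (rule derivative_eq_intros 1 cutoff_has_derivative refl)+ (simp add: algebra_simps)
    qed
    then have "0 = (LINT y|lborel. (\<Sum>i\<in>Basis. F' i y))"
      using iF by (subst Bochner_Integration.integral_sum) auto
    also have "(\<lambda>y. \<Sum>i\<in>Basis. F' i y) = (\<lambda>y. D s y + E s y + B s y)"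
    proof
      fix y
      have "(\<Sum>i\<in>Basis. F' i y) = B s y + ?\<chi> y * (\<phi> s y * (\<Sum>i\<in>Basis. u2 i s y) + u s y * (- (\<Sum>i\<in>Basis. \<phi>2 i s y)))"
        by (simp add: F'_def B_def sum.distrib sum_distrib_left sum_subtractf right_diff_distrib sum_negf)
      also have "\<dots> = D s y + E s y + B s y"
      proof -
        have 1: "(\<Sum>i\<in>Basis. u2 i s y) = ut s y + f s y" "(\<Sum>i\<in>Basis. \<phi>2 i s y) = - \<phi>t s y"
          using ueq[OF sI, of y] \<phi>eq[OF sI, of y] by simp_all
        show ?thesis unfolding 1 by (simp add: D_def E_def algebra_simps)
      qed
      finally show "(\<Sum>i\<in>Basis. F' i y) = D s y + E s y + B s y" .
    qed
    finally show ?thesis by simp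
  qed
  have "(LINT y|lborel. \<phi> s2 y * u s2 y * ?\<chi> y) - (LINT y|lborel. \<phi> s1 y * u s1 y * ?\<chi> y) =
      (LINT y|lborel. (LINT s|lborel. indicator {s1..s2} s * D s y))"
    using time s by (simp add: Bochner_Integration.integral_diff sup_int)
  also have "\<dots> = (LINT p|(lborel \<Otimes>\<^sub>M lborel). indicator {s1..s2} (fst p) * D (fst p) (snd p))"
    using lborel_pair.integral_snd[of "\<lambda>s y. indicator {s1..s2} s * D s y"] intD by (simp add: case_prod_beta')
  finally have 1: "(LINT y|lborel. \<phi> s2 y * u s2 y * ?\<chi> y) - (LINT y|lborel. \<phi> s1 y * u s1 y * ?\<chi> y) =
     (LINT p|(lborel \<Otimes>\<^sub>M lborel). indicator {s1..s2} (fst p) * D (fst p) (snd p))" .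
  let ?I = "\<lambda>g. \<lambda>p. indicator {s1..s2} (fst p) * (g (fst p) (snd p) :: real)"
  have intDEB: "integrable (lborel \<Otimes>\<^sub>M lborel) (\<lambda>p. ?I D p + ?I E p + ?I B p)"
    using intD intE intB by auto
  have "(LINT p|(lborel \<Otimes>\<^sub>M lborel). ?I D p + ?I E p + ?I B p) =
     (LINT s|lborel. (LINT y|lborel. indicator {s1..s2} s * (D s y + E s y + B s y)))"
    using lborel_pair.integral_fst'[OF intDEB] by (simp add: distrib_left)
  also have "\<dots> = (LINT s|(lborel :: real measure). 0::real)"
  proof -
    have "(LINT y|lborel. indicator {s1..s2} s * (D s y + E s y + B s y)) = 0" for s
      using space[of s] by (cases "s \<in> {s1..s2}") auto
    then show ?thesis by (simp only:)
  qed
  finally have "(LINT p|(lborel \<Otimes>\<^sub>M lborel). ?I D p + ?I E p + ?I B p) = 0" by simp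
  then have "(LINT p|(lborel \<Otimes>\<^sub>M lborel). ?I D p) = - (LINT p|(lborel \<Otimes>\<^sub>M lborel). ?I E p) - (LINT p|(lborel \<Otimes>\<^sub>M lborel). ?I B p)"
    using intD intE intB by simp
  then show ?thesis
    unfolding 1 by (simp add: E_def)
qed

lemma integrable_indicator_times:
  fixes \<Psi> :: "'a::euclidean_space \<Rightarrow> real"
  assumes "integrable lborel \<Psi>"
  shows "integrable (lborel \<Otimes>\<^sub>M lborel) (\<lambda>p. indicator {s1..s2::real} (fst p) * \<Psi> (snd p))"
proof -
  have [measurable]: "\<Psi> \<in> borel_measurable borel" using assms by auto
  have "integrable (lborel \<Otimes>\<^sub>M lborel) (\<lambda>(s, y). indicator {s1..s2::real} s * \<Psi> y)"
  proof (rule lborel_pair.Fubini_integrable)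
    have "(LINT y|lborel. norm (case (s, y) of (s, y) \<Rightarrow> indicator {s1..s2::real} s * \<Psi> y)) =
        indicator {s1..s2} s * (LINT y|lborel. \<bar>\<Psi> y\<bar>)" for s :: real
      by (simp add: abs_mult)
    then show "integrable lborel (\<lambda>s. LINT y|lborel. norm (case (s, y) of (s, y) \<Rightarrow> indicator {s1..s2::real} s * \<Psi> y))"
      by (auto intro!: integrable_real_mult_indicator integrable_mult_left integrable_real_indicator simp: emeasure_lborel_Icc_eq)
  qed (use assms in auto)
  then show ?thesis by (simp add: case_prod_beta')
qed

text \<open>Let the cutoff tend to 1. Boundedness of \<open>u\<close>, \<open>u1\<close> and
  \<open>f\<close>, together with one integrable majorant \<open>\<Psi>\<close> for
  \<open>\<phi>\<close> and its slopes, permits dominated convergence everywhere; the remainder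
  carries the factor \<open>1 / Suc n\<close> and disappears.\<close>

lemma green_identity:
  fixes \<phi> \<phi>t u ut f :: "real \<Rightarrow> 'a::euclidean_space \<Rightarrow> real" and \<phi>1 \<phi>2 u1 u2 :: "'a \<Rightarrow> real \<Rightarrow> 'a \<Rightarrow> real"
  assumes s: "s1 \<le> s2"
    and \<phi>: "C21_line {s1..s2} \<phi> \<phi>t \<phi>1 \<phi>2" and u: "C21_line {s1..s2} u ut u1 u2"
    and \<phi>eq: "\<And>s y. s \<in> {s1..s2} \<Longrightarrow> \<phi>t s y = - (\<Sum>i\<in>Basis. \<phi>2 i s y)"
    and ueq: "\<And>s y. s \<in> {s1..s2} \<Longrightarrow> ut s y = (\<Sum>i\<in>Basis. u2 i s y) - f s y"
    and ub: "\<And>s y. s \<in> {s1..s2} \<Longrightarrow> \<bar>u s y\<bar> \<le> M" "\<And>s y i. s \<in> {s1..s2} \<Longrightarrow> i \<in> Basis \<Longrightarrow> \<bar>u1 i s y\<bar> \<le> M"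
      "\<And>s y. s \<in> {s1..s2} \<Longrightarrow> \<bar>f s y\<bar> \<le> M"
    and \<phi>b: "\<And>s y. s \<in> {s1..s2} \<Longrightarrow> \<bar>\<phi> s y\<bar> \<le> \<Psi> y" "\<And>s y i. s \<in> {s1..s2} \<Longrightarrow> i \<in> Basis \<Longrightarrow> \<bar>\<phi>1 i s y\<bar> \<le> \<Psi> y"
    and \<Psi>: "integrable lborel \<Psi>"
  shows "integrable (lborel \<Otimes>\<^sub>M lborel) (\<lambda>p. indicator {s1..s2} (fst p) * (\<phi> (fst p) (snd p) * f (fst p) (snd p)))"
    and "(LINT y|lborel. \<phi> s2 y * u s2 y) - (LINT y|lborel. \<phi> s1 y * u s1 y) =
     - (LINT p|(lborel \<Otimes>\<^sub>M lborel). indicator {s1..s2} (fst p) * (\<phi> (fst p) (snd p) * f (fst p) (snd p)))"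
proof -
  let ?P = "lborel \<Otimes>\<^sub>M lborel :: (real \<times> 'a) measure"
  define B where "B n s y = (\<Sum>i\<in>Basis. cutoff_deriv n i y * (\<phi> s y * u1 i s y - u s y * \<phi>1 i s y))" for n s y
  have M: "0 \<le> M" using ub(1)[of s1] s by (auto intro: order.trans[OF abs_ge_zero])
  have \<Psi>0: "0 \<le> \<Psi> y" for y using \<phi>b(1)[of s1 y] s by (auto intro: order.trans[OF abs_ge_zero])
  have cu: "continuous_on ({s1..s2} \<times> UNIV) (\<lambda>p. u (fst p) (snd p))" "continuous_on ({s1..s2} \<times> UNIV) (\<lambda>p. ut (fst p) (snd p))"
    "i \<in> Basis \<Longrightarrow> continuous_on ({s1..s2} \<times> UNIV) (\<lambda>p. u1 i (fst p) (snd p))"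
    "i \<in> Basis \<Longrightarrow> continuous_on ({s1..s2} \<times> UNIV) (\<lambda>p. u2 i (fst p) (snd p))"
    "continuous_on ({s1..s2} \<times> UNIV) (\<lambda>p. \<phi> (fst p) (snd p))"
    "i \<in> Basis \<Longrightarrow> continuous_on ({s1..s2} \<times> UNIV) (\<lambda>p. \<phi>1 i (fst p) (snd p))" for i
    using u \<phi> unfolding C21_line_def case_prod_beta' by auto
  have cf: "continuous_on ({s1..s2} \<times> UNIV) (\<lambda>p. f (fst p) (snd p))"
  proof -
    have "continuous_on ({s1..s2} \<times> UNIV) (\<lambda>p. (\<Sum>i\<in>Basis. u2 i (fst p) (snd p)) - ut (fst p) (snd p))"
      by (intro continuous_intros cu)
    then show ?thesis
      by (rule continuous_on_eq) (auto simp: ueq)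
  qed
  have c\<chi>: "continuous_on S (\<lambda>p. cutoff n (snd p))" "continuous_on S (\<lambda>p. cutoff_deriv n i (snd p))"
    for S :: "(real \<times> 'a) set" and i n
    using continuous_on_compose2[OF continuous_on_cutoff(1)[of UNIV n], of S snd]
      continuous_on_compose2[OF continuous_on_cutoff(2)[of UNIV n i], of S snd]
      continuous_on_snd[OF continuous_on_id, of S]
    by auto
  have meas: "(\<lambda>p. indicator {s1..s2} (fst p) * g p) \<in> borel_measurable ?P"
    if "continuous_on ({s1..s2} \<times> UNIV) g" for g :: "real \<times> 'a \<Rightarrow> real"
  proof -
    have "(\<lambda>p. indicator ({s1..s2} \<times> UNIV) p *\<^sub>R g p) \<in> borel_measurable borel"
      using that by (intro borel_measurable_continuous_on_indicator) (auto intro!: borel_closed closed_Times)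
    then show ?thesis
      unfolding lborel_prod by (simp add: indicator_times)
  qed
  have slice: "(\<lambda>y. g s y) \<in> borel_measurable lborel" if "continuous_on ({s1..s2} \<times> UNIV) (\<lambda>p. g (fst p) (snd p))" "s \<in> {s1..s2}"
    for g :: "real \<Rightarrow> 'a \<Rightarrow> real" and s
  proof -
    have "continuous_on UNIV (\<lambda>y. (s, y))" by (intro continuous_intros)
    from continuous_on_compose2[OF that(1) this] that(2) have "continuous_on UNIV (g s)"
      by (simp add: image_subset_iff)
    then show ?thesis by (simp add: borel_measurable_continuous_onI)
  qed
  have cutm [measurable]: "cutoff n \<in> borel_measurable borel" for n
    by (intro borel_measurable_continuous_onI continuous_intros)
  note dom = integrable_indicator_times[OF \<Psi>, of s1 s2]
  have I1: "integrable ?P (\<lambda>p. M * (indicator {s1..s2} (fst p) * \<Psi> (snd p)))"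
    using dom by simp
  \<comment> \<open>Per coordinate: 4 from the slope of the cutoff times
    \<open>2 * M * \<Psi>\<close> from the two products in \<open>B\<close>.\<close>
  have I2: "integrable ?P (\<lambda>p. 8 * M * real DIM('a) * (indicator {s1..s2} (fst p) * \<Psi> (snd p)))"
    using dom by (rule integrable_mult_right)
  let ?E = "\<lambda>p. indicator {s1..s2} (fst p) * (\<phi> (fst p) (snd p) * f (fst p) (snd p))"
  let ?En = "\<lambda>n p. indicator {s1..s2} (fst p) * (\<phi> (fst p) (snd p) * f (fst p) (snd p) * cutoff n (snd p))"
  have mE: "?E \<in> borel_measurable ?P" "?En n \<in> borel_measurable ?P" for n
    by (intro meas continuous_intros cu cf c\<chi>)+
  have \<phi>f: "\<bar>\<phi> s y * f s y\<bar> \<le> M * \<Psi> y" if "s \<in> {s1..s2}" for s y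
    using mult_mono[OF ub(3)[OF that, of y] \<phi>b(1)[OF that, of y]] M by (simp add: abs_mult mult.commute)
  show "integrable ?P ?E"
    by (rule Bochner_Integration.integrable_bound[OF I1 mE(1)])
       (auto intro!: AE_I2 simp: indicator_def \<phi>f \<Psi>0 M)
  have LE: "(\<lambda>n. LINT p|?P. ?En n p) \<longlonglongrightarrow> (LINT p|?P. ?E p)"
  proof (rule integral_dominated_convergence[OF mE I1])
    show "AE p in ?P. (\<lambda>n. ?En n p) \<longlonglongrightarrow> ?E p"
    proof (rule AE_I2)
      fix p :: "real \<times> 'a"
      have "(\<lambda>n. ?En n p) \<longlonglongrightarrow> indicator {s1..s2} (fst p) * (\<phi> (fst p) (snd p) * f (fst p) (snd p) * 1)"
        by (intro tendsto_mult tendsto_const cutoff_tendsto_1)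
      then show "(\<lambda>n. ?En n p) \<longlonglongrightarrow> ?E p" by simp
    qed
    fix n
    have "\<bar>\<phi> s y * f s y * cutoff n y\<bar> \<le> M * \<Psi> y * 1" if "s \<in> {s1..s2}" for s y
      using mult_mono[OF \<phi>f[OF that, of y] cutoff_bounds(2)[of n y]] M \<Psi>0[of y] cutoff_bounds(1)[of n y]
      by (simp add: abs_mult)
    then show "AE p in ?P. norm (?En n p) \<le> M * (indicator {s1..s2} (fst p) * \<Psi> (snd p))"
      by (intro AE_I2) (auto simp: indicator_def)
  qed
  have Bb: "\<bar>B n s y\<bar> \<le> 8 * M * real DIM('a) * \<Psi> y / real (Suc n)" if sI: "s \<in> {s1..s2}" for n s y
  proof -
    have "\<bar>cutoff_deriv n i y * (\<phi> s y * u1 i s y - u s y * \<phi>1 i s y)\<bar> \<le> (4 / real (Suc n)) * (\<Psi> y * M + M * \<Psi> y)"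
      if i: "i \<in> Basis" for i
    proof -
      have "\<bar>\<phi> s y * u1 i s y - u s y * \<phi>1 i s y\<bar> \<le> \<bar>\<phi> s y\<bar> * \<bar>u1 i s y\<bar> + \<bar>u s y\<bar> * \<bar>\<phi>1 i s y\<bar>"
        unfolding abs_mult[symmetric] by (rule abs_triangle_ineq4)
      also have "\<dots> \<le> \<Psi> y * M + M * \<Psi> y"
        using ub \<phi>b sI i M \<Psi>0 by (intro add_mono mult_mono) auto
      finally show ?thesis
        unfolding abs_mult using cutoff_deriv_bound[of i n y] i M \<Psi>0
        by (intro mult_mono) (auto simp del: of_nat_Suc)
    qed
    then have "\<bar>B n s y\<bar> \<le> (\<Sum>i\<in>(Basis::'a set). (4 / real (Suc n)) * (\<Psi> y * M + M * \<Psi> y))"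
      unfolding B_def by (intro order.trans[OF sum_abs] sum_mono) auto
    then show ?thesis by (simp add: mult_ac del: of_nat_Suc)
  qed
  have LB: "(\<lambda>n. LINT p|?P. indicator {s1..s2} (fst p) * B n (fst p) (snd p)) \<longlonglongrightarrow> (LINT p|?P. 0)"
  proof (rule integral_dominated_convergence[OF _ _ I2])
    show "(\<lambda>p. indicator {s1..s2} (fst p) * B n (fst p) (snd p)) \<in> borel_measurable ?P" for n
      unfolding B_def by (intro meas continuous_intros cu c\<chi>)
    show "AE p in ?P. (\<lambda>n. indicator {s1..s2} (fst p) * B n (fst p) (snd p)) \<longlonglongrightarrow> 0"
    proof (rule AE_I2)
      fix p :: "real \<times> 'a"
      show "(\<lambda>n. indicator {s1..s2} (fst p) * B n (fst p) (snd p)) \<longlonglongrightarrow> 0"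
      proof (cases "fst p \<in> {s1..s2}")
        case True
        have "(\<lambda>n. 8 * M * real DIM('a) * \<Psi> (snd p) / real (Suc n)) \<longlonglongrightarrow> 0"
          by real_asymp
        then have "(\<lambda>n. B n (fst p) (snd p)) \<longlonglongrightarrow> 0"
          by (rule Lim_null_comparison[rotated]) (use Bb[OF True] in auto)
        then show ?thesis using True by simp
      qed auto
    qed
    show "AE p in ?P. norm (indicator {s1..s2} (fst p) * B n (fst p) (snd p)) \<le>
        8 * M * real DIM('a) * (indicator {s1..s2} (fst p) * \<Psi> (snd p))" for n
    proof (rule AE_I2)
      fix p :: "real \<times> 'a"
      have "8 * M * real DIM('a) * \<Psi> (snd p) / real (Suc n) \<le> 8 * M * real DIM('a) * \<Psi> (snd p) / 1"
        using M \<Psi>0 by (intro divide_left_mono) auto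
      then show "norm (indicator {s1..s2} (fst p) * B n (fst p) (snd p)) \<le>
        8 * M * real DIM('a) * (indicator {s1..s2} (fst p) * \<Psi> (snd p))"
        using Bb[of "fst p" n "snd p"] by (auto simp: indicator_def)
    qed
  qed auto
  have LU: "(\<lambda>n. LINT y|lborel. \<phi> s y * u s y * cutoff n y) \<longlonglongrightarrow> (LINT y|lborel. \<phi> s y * u s y)"
    if sI: "s \<in> {s1..s2}" for s
  proof (rule integral_dominated_convergence[where w = "\<lambda>y. M * \<Psi> y"])
    note [measurable] = slice[OF cu(1) sI] slice[OF cu(5) sI]
    show "(\<lambda>y. \<phi> s y * u s y) \<in> borel_measurable lborel" "(\<lambda>y. \<phi> s y * u s y * cutoff n y) \<in> borel_measurable lborel" for n
      by measurable
    show "integrable lborel (\<lambda>y. M * \<Psi> y)" using \<Psi> by simp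
    show "AE y in lborel. (\<lambda>n. \<phi> s y * u s y * cutoff n y) \<longlonglongrightarrow> \<phi> s y * u s y"
    proof (rule AE_I2)
      fix y
      have "(\<lambda>n. \<phi> s y * u s y * cutoff n y) \<longlonglongrightarrow> \<phi> s y * u s y * 1"
        by (intro tendsto_mult tendsto_const cutoff_tendsto_1)
      then show "(\<lambda>n. \<phi> s y * u s y * cutoff n y) \<longlonglongrightarrow> \<phi> s y * u s y" by simp
    qed
    have "\<bar>\<phi> s y * u s y * cutoff n y\<bar> \<le> \<Psi> y * M * 1" for y n
      unfolding abs_mult using ub(1)[OF sI] \<phi>b(1)[OF sI] cutoff_bounds[of n y] M \<Psi>0
      by (intro mult_mono) (auto simp: abs_le_iff)
    then show "AE y in lborel. norm (\<phi> s y * u s y * cutoff n y) \<le> M * \<Psi> y" for n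
      by (intro AE_I2) (simp add: mult.commute)
  qed
  have eq: "(LINT y|lborel. \<phi> s2 y * u s2 y * cutoff n y) - (LINT y|lborel. \<phi> s1 y * u s1 y * cutoff n y) =
     - (LINT p|?P. ?En n p) - (LINT p|?P. indicator {s1..s2} (fst p) * B n (fst p) (snd p))" for n
    unfolding B_def by (rule green_identity_cutoff[OF s \<phi> u \<phi>eq ueq])
  have "(\<lambda>n. (LINT y|lborel. \<phi> s2 y * u s2 y * cutoff n y) - (LINT y|lborel. \<phi> s1 y * u s1 y * cutoff n y)) \<longlonglongrightarrow>
     - (LINT p|?P. ?E p) - (LINT p|?P. 0)"
    unfolding eq by (rule tendsto_diff[OF tendsto_minus[OF LE] LB])
  moreover have "(\<lambda>n. (LINT y|lborel. \<phi> s2 y * u s2 y * cutoff n y) - (LINT y|lborel. \<phi> s1 y * u s1 y * cutoff n y)) \<longlonglongrightarrow>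
     (LINT y|lborel. \<phi> s2 y * u s2 y) - (LINT y|lborel. \<phi> s1 y * u s1 y)"
    using s by (intro tendsto_diff LU) auto
  ultimately show "(LINT y|lborel. \<phi> s2 y * u s2 y) - (LINT y|lborel. \<phi> s1 y * u s1 y) = - (LINT p|?P. ?E p)"
    using LIMSEQ_unique by fastforce
qed

section \<open>Bounded solutions and their sign\<close>

text \<open>The Riesz representative of the derivative is \<open>adjoint f' 1\<close>; its existence
  makes the description in \<open>gradient\<close> meaningful at every point of
  differentiability.\<close>

lemma differentiable_GDERIV_gradient:
  fixes f :: "'a::euclidean_space \<Rightarrow> real"
  assumes "f differentiable at x"
  shows "GDERIV f x :> gradient f x"
proof -
  obtain f' where f': "(f has_derivative f') (at x)"
    using assms by (auto simp: differentiable_def)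
  then have "linear f'" by (rule has_derivative_linear)
  then have "f' = (\<lambda>h. h \<bullet> adjoint f' 1)"
    by (simp add: adjoint_works fun_eq_iff)
  with f' have "GDERIV f x :> adjoint f' 1"
    unfolding gderiv_def by simp
  then show ?thesis
    using gradient_eqI by metis
qed

lemma has_derivative_along_line:
  fixes f :: "'a::real_normed_vector \<Rightarrow> real"
  assumes "(f has_derivative f') (at y)"
  shows "((\<lambda>h. f (y + h *\<^sub>R e)) has_real_derivative f' e) (at 0)"
proof -
  have 1: "((\<lambda>h::real. y + h *\<^sub>R e) has_derivative (\<lambda>h. h *\<^sub>R e)) (at 0)"
    by (auto intro!: derivative_eq_intros)
  have "((\<lambda>h. f (y + h *\<^sub>R e)) has_derivative (\<lambda>h. f' (h *\<^sub>R e))) (at 0)"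
    by (rule has_derivative_compose[OF 1]) (use assms in simp)
  moreover have "f' (h *\<^sub>R e) = f' e * h" for h
    using linear_scale[OF has_derivative_linear[OF assms]] by (simp add: mult.commute)
  ultimately show ?thesis
    by (simp add: has_field_derivative_def fun_eq_iff)
qed

text \<open>If \<open>d\<close> were negative, \<open>g'\<close> would be negative just to the right
  of 0, and the mean value theorem would give a value below the minimum.\<close>

lemma second_derivative_nonneg_at_min:
  fixes g g' :: "real \<Rightarrow> real"
  assumes g: "\<And>h. (g has_real_derivative g' h) (at h)" and g': "(g' has_real_derivative d) (at 0)"
    and min: "\<And>h. g 0 \<le> g h"
  shows "g' 0 = 0" "d \<ge> 0"
proof -
  show 0: "g' 0 = 0"
    by (rule DERIV_local_min[OF g zero_less_one]) (use min in auto)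
  show "d \<ge> 0"
  proof (rule ccontr)
    assume "\<not> d \<ge> 0"
    then obtain e where e: "e > 0" "\<And>h. h > 0 \<Longrightarrow> h < e \<Longrightarrow> g' h < 0"
      using DERIV_neg_dec_right[OF g'] 0 by auto
    obtain z where "z > 0" "z < e / 2" "g (e / 2) - g 0 = (e / 2 - 0) * g' z"
      using MVT2[of 0 "e / 2" g g'] g e by auto
    with e have "g (e / 2) < g 0"
      using mult_pos_neg[of "e / 2" "g' z"] by auto
    with min[of "e / 2"] show False by simp
  qed
qed

text \<open>A smooth substitute for the norm: it grows at infinity, while its first and second
  coordinate derivatives are at most 1. Adding a small multiple forces a minimum to be
  attained.\<close>

definition bracket :: "'a::euclidean_space \<Rightarrow> real" where
  "bracket y = sqrt (1 + (norm y)\<^sup>2)"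

lemma bracket_ge: "bracket y \<ge> 1" "bracket y \<ge> norm y" "bracket y > 0"
proof -
  show "bracket y \<ge> 1" by (simp add: bracket_def)
  then show "bracket y > 0" by simp
  show "bracket y \<ge> norm y"
    unfolding bracket_def by (rule real_le_rsqrt) simp
qed

lemma bracket_deriv:
  fixes y i :: "'a::euclidean_space"
  assumes i: "i \<in> Basis"
  shows "((\<lambda>h. bracket (y + h *\<^sub>R i)) has_real_derivative (y \<bullet> i) / bracket y) (at 0)"
    and "((\<lambda>h. ((y + h *\<^sub>R i) \<bullet> i) / bracket (y + h *\<^sub>R i)) has_real_derivative
       1 / bracket y - (y \<bullet> i)\<^sup>2 / bracket y ^ 3) (at 0)"
proof -
  have eq: "bracket (y + h *\<^sub>R i) = sqrt (1 + (y \<bullet> y + 2 * h * (y \<bullet> i) + h\<^sup>2))" for h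
    unfolding bracket_def power2_norm_eq_inner using i
    by (simp add: inner_add_left inner_add_right inner_commute[of i y] power2_eq_square algebra_simps)
  have b: "bracket y = sqrt (1 + y \<bullet> y)"
    by (simp add: bracket_def power2_norm_eq_inner)
  have pos: "1 + y \<bullet> y > 0" using inner_ge_zero[of y] by linarith
  have 1: "((\<lambda>h. 1 + (y \<bullet> y + 2 * h * (y \<bullet> i) + h\<^sup>2)) has_real_derivative 2 * (y \<bullet> i)) (at 0)"
    by (auto intro!: derivative_eq_intros)
  have "((\<lambda>h. sqrt (1 + (y \<bullet> y + 2 * h * (y \<bullet> i) + h\<^sup>2))) has_real_derivative
      inverse (sqrt (1 + y \<bullet> y)) / 2 * (2 * (y \<bullet> i))) (at 0)"
    by (rule DERIV_chain2[OF _ 1]) (use DERIV_real_sqrt[OF pos] in simp)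
  then show D: "((\<lambda>h. bracket (y + h *\<^sub>R i)) has_real_derivative (y \<bullet> i) / bracket y) (at 0)"
    unfolding eq b by (simp add: field_simps)
  have 2: "((\<lambda>h. (y + h *\<^sub>R i) \<bullet> i) has_real_derivative 1) (at 0)"
    using i by (auto intro!: derivative_eq_intros simp: inner_add_left)
  have bp: "bracket y > 0" by (rule bracket_ge)
  have "((\<lambda>h. ((y + h *\<^sub>R i) \<bullet> i) / bracket (y + h *\<^sub>R i)) has_real_derivative
       (1 * bracket (y + 0 *\<^sub>R i) - ((y + 0 *\<^sub>R i) \<bullet> i) * ((y \<bullet> i) / bracket y)) /
         (bracket (y + 0 *\<^sub>R i) * bracket (y + 0 *\<^sub>R i))) (at 0)"
    by (rule DERIV_divide[OF 2 D]) (use bp in simp)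
  moreover have "(1 * bracket (y + 0 *\<^sub>R i) - ((y + 0 *\<^sub>R i) \<bullet> i) * ((y \<bullet> i) / bracket y)) /
         (bracket (y + 0 *\<^sub>R i) * bracket (y + 0 *\<^sub>R i)) = 1 / bracket y - (y \<bullet> i)\<^sup>2 / bracket y ^ 3"
    using bp by (simp add: field_simps power2_eq_square power3_eq_cube)
  ultimately show "((\<lambda>h. ((y + h *\<^sub>R i) \<bullet> i) / bracket (y + h *\<^sub>R i)) has_real_derivative
       1 / bracket y - (y \<bullet> i)\<^sup>2 / bracket y ^ 3) (at 0)"
    by simp
qed

text \<open>The pointwise content of the hypotheses. Essential bounds become bounds everywhere by
  continuity, and one \<open>M\<close> serves both \<open>u\<close> and its gradient.\<close>

locale viscous_HJ =
  fixes q M :: real and u :: "real \<Rightarrow> 'a::euclidean_space \<Rightarrow> real"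
  assumes q_gt_1: "q > 1"
    and continuous_u: "continuous_on ({0..} \<times> UNIV) (\<lambda>(t, x). u t x)"
    and C21_u: "C21 u"
    and pde: "\<And>t x. t > 0 \<Longrightarrow> deriv (\<lambda>s. u s x) t - laplacian (u t) x + norm (gradient (u t) x) powr q = 0"
    and u_bound: "\<And>t x. t > 0 \<Longrightarrow> \<bar>u t x\<bar> \<le> M"
    and gradient_bound: "\<And>t x. t > 0 \<Longrightarrow> norm (gradient (u t) x) \<le> M"
    and initial_nonneg: "\<And>x. 0 \<le> u 0 x"
    and initial_integrable: "integrable lborel (u 0)"
begin

lemma M_nonneg: "0 \<le> M"
  using u_bound[of 1] by (auto intro: order.trans[OF abs_ge_zero])

definition ut :: "real \<Rightarrow> 'a \<Rightarrow> real" where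
  "ut s y = deriv (\<lambda>s. u s y) s"

definition u1 :: "'a \<Rightarrow> real \<Rightarrow> 'a \<Rightarrow> real" where
  "u1 i s y = gradient (u s) y \<bullet> i"

definition u2 :: "'a \<Rightarrow> real \<Rightarrow> 'a \<Rightarrow> real" where
  "u2 i s y = frechet_derivative (gradient (u s)) (at y) i \<bullet> i"

text \<open>The absorption term, extended by 0 to non-positive times. There the gradient is
  uncontrolled, and the extension makes \<open>F\<close> measurable on all of space-time.\<close>

definition F :: "real \<Rightarrow> 'a \<Rightarrow> real" where
  "F s y = (if 0 < s then norm (gradient (u s) y) powr q else 0)"

lemma ut_eq: "s > 0 \<Longrightarrow> ut s y = (\<Sum>i\<in>Basis. u2 i s y) - F s y"
  using pde[of s y] by (simp add: ut_def u2_def F_def laplacian_def)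

lemma F_nonneg [simp]: "0 \<le> F s y"
  by (simp add: F_def)

lemma u_differentiable:
  assumes "t > 0"
  shows "u t differentiable at x" "gradient (u t) differentiable at x"
  using C21_u assms unfolding C21_def by auto

lemma u1_DERIV:
  assumes "s > 0"
  shows "((\<lambda>h. u s (y + h *\<^sub>R e)) has_real_derivative u1 e s y) (at 0)"
  using has_derivative_along_line[OF differentiable_GDERIV_gradient[OF u_differentiable(1)[OF assms], unfolded gderiv_def]]
  by (simp add: u1_def inner_commute)

lemma C21_line_u:
  assumes I: "I \<subseteq> {0<..}"
  shows "C21_line I u ut u1 u2"
proof -
  have sub: "I \<times> UNIV \<subseteq> {0<..} \<times> (UNIV :: 'a set)" using I by auto
  have c: "continuous_on ({0<..} \<times> UNIV) (\<lambda>(t, x). u t x)"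
     "continuous_on ({0<..} \<times> UNIV) (\<lambda>(t, x). deriv (\<lambda>s. u s x) t)"
     "continuous_on ({0<..} \<times> UNIV) (\<lambda>(t, x). gradient (u t) x)"
     "\<And>i. i\<in>Basis \<Longrightarrow> continuous_on ({0<..} \<times> UNIV) (\<lambda>(t, x). frechet_derivative (gradient (u t)) (at x) i)"
    using C21_u unfolding C21_def by auto
  have d: "(\<lambda>s. u s x) differentiable at t" if "t > 0" for t x
    using C21_u that unfolding C21_def by auto
  have "((\<lambda>s. u s y) has_real_derivative ut s y) (at s)" if "s > 0" for s y
    using d[OF that] unfolding ut_def
    by (metis DERIV_deriv_iff_real_differentiable)

  moreover have "((\<lambda>h. u1 i s (y + h *\<^sub>R i)) has_real_derivative u2 i s y) (at 0)" if "s > 0" for s y and i :: 'a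
  proof -
    have "((\<lambda>y. u1 i s y) has_derivative (\<lambda>h. frechet_derivative (gradient (u s)) (at y) h \<bullet> i)) (at y)"
      unfolding u1_def
      by (intro has_derivative_inner_left frechet_derivative_works[THEN iffD1] u_differentiable(2) that)
    from has_derivative_along_line[OF this] show ?thesis
      by (simp add: u2_def)
  qed
  ultimately show ?thesis
    unfolding C21_line_def using I c(1-3)[THEN continuous_on_subset, OF sub]
      continuous_on_subset[OF c(4) sub]
    by (auto simp: ut_def u1_def[abs_def] u2_def case_prod_beta' u1_DERIV[unfolded u1_def] intro!: continuous_intros)
qed

lemma u_continuous_at:
  assumes "continuous_on S f" "\<And>x. x \<in> S \<Longrightarrow> f x \<ge> 0" "continuous_on S g"
  shows "continuous_on S (\<lambda>x. u (f x) (g x))"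
  using continuous_on_compose2[OF continuous_u continuous_on_Pair[OF assms(1,3)]] assms(2)
  by (auto simp: image_subset_iff)

text \<open>Maximum principle on an unbounded domain. If the perturbed function \<open>w\<close>
  were negative somewhere, it would have a negative global minimum in space at some positive time.
  There \<open>\<nabla>u\<close> has size at most \<open>e\<close> and the Laplacian of
  \<open>u\<close> is at least \<open>- e N\<close>, so \<open>w\<close> increases in time and was
  smaller just before.\<close>

lemma u_nonneg:
  assumes "t \<ge> 0"
  shows "0 \<le> u t x"
proof -
  \<comment> \<open>At the minimum \<open>ut\<close> is at least \<open>- e * (DIM + 1)\<close>; one
    more unit makes the time derivative of \<open>w\<close> strictly positive.\<close>
  define K where "K = real DIM('a) + 2"
  have claim: "0 \<le> u t x + e * (bracket x + K * t)" if e: "0 < e" "e \<le> 1" for e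
  proof (rule ccontr)
    assume neg: "\<not> 0 \<le> u t x + e * (bracket x + K * t)"
    define w where "w s y = u s y + e * (bracket y + K * s)" for s y
    \<comment> \<open>Beyond radius \<open>M / e\<close> the penalty \<open>e * bracket y\<close>
      outweighs \<open>u \<ge> - M\<close>; the other entry keeps the assumed negative point
      \<open>x\<close> inside the ball.\<close>
    define R where "R = max (M / e) (norm x)"
    have R: "norm x \<le> R" by (simp add: R_def)
    have far: "0 \<le> w s y" if "norm y > R" "s \<ge> 0" for s y
    proof -
      have "M / e \<le> bracket y" using that(1) bracket_ge(2)[of y] by (simp add: R_def)
      then have "M \<le> e * bracket y" using e by (simp add: field_simps)
      moreover have "- M \<le> u s y"
        using u_bound[of s y] initial_nonneg[of y] that(2) M_nonneg by (cases "s = 0") (auto simp: abs_le_iff)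
      moreover have "0 \<le> e * (K * s)" using e that(2) by (simp add: K_def)
      ultimately show ?thesis by (simp add: w_def distrib_left)
    qed
    have "continuous_on ({0..t} \<times> cball 0 R) (\<lambda>p. w (fst p) (snd p))"
      unfolding w_def bracket_def by (intro continuous_intros u_continuous_at) auto
    moreover have "compact ({0..t} \<times> cball (0::'a) R)" "({0..t} \<times> cball (0::'a) R) \<noteq> {}"
      using assms order.trans[OF norm_ge_zero R] by (auto intro!: compact_Times)
    ultimately obtain p where p: "p \<in> {0..t} \<times> cball 0 R" "\<And>p'. p' \<in> {0..t} \<times> cball 0 R \<Longrightarrow> w (fst p) (snd p) \<le> w (fst p') (snd p')"
      using continuous_attains_inf by meson
    obtain s y where sy: "p = (s, y)" by (cases p)
    have s: "0 \<le> s" "s \<le> t" and y: "norm y \<le> R" using p(1) sy by auto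
    have min: "w s y \<le> w s' y'" if "0 \<le> s'" "s' \<le> t" "norm y' \<le> R" for s' y'
      using p(2)[of "(s', y')"] that sy by auto
    have wneg: "w s y < 0"
      using min[of t x] neg assms R by (auto simp: w_def)
    have "0 \<le> w 0 y"
      using initial_nonneg[of y] bracket_ge(3)[of y] e by (simp add: w_def)
    with wneg s have s0: "s > 0" by (cases "s = 0") auto
    have minx: "w s y \<le> w s y'" for y'
      using min[of s y'] far[of y' s] wneg s by (cases "norm y' \<le> R") auto
    note C = C21_line_u[of "{0<..}", simplified]
    have sp: "u1 i s y = - e * ((y \<bullet> i) / bracket y) \<and> u2 i s y \<ge> - e" if i: "i \<in> Basis" for i
    proof -
      define g where "g h = w s (y + h *\<^sub>R i)" for h
      define g1 where "g1 y = u1 i s y + e * ((y \<bullet> i) / bracket y)" for y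
      have "((\<lambda>h. w s (y + h *\<^sub>R i)) has_real_derivative g1 y) (at 0)" for y
      proof -
        have 1: "((\<lambda>h. u s (y + h *\<^sub>R i)) has_real_derivative u1 i s y) (at 0)"
          using C s0 i by (auto simp: C21_line_def)
        show ?thesis unfolding w_def g1_def
          by (rule derivative_eq_intros 1 bracket_deriv(1)[OF i] refl)+ simp
      qed
      then have "(g has_real_derivative g1 (y + h *\<^sub>R i)) (at h)" for h
        unfolding g_def by (rule DERIV_along_line_shift)
      moreover have "((\<lambda>h. g1 (y + h *\<^sub>R i)) has_real_derivative
          u2 i s y + e * (1 / bracket y - (y \<bullet> i)\<^sup>2 / bracket y ^ 3)) (at 0)"
      proof -
        have 1: "((\<lambda>h. u1 i s (y + h *\<^sub>R i)) has_real_derivative u2 i s y) (at 0)"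
          using C s0 i by (auto simp: C21_line_def)
        show ?thesis unfolding g1_def
          by (rule derivative_eq_intros 1 bracket_deriv(2)[OF i] refl)+ simp
      qed
      ultimately have "g1 (y + 0 *\<^sub>R i) = 0" "u2 i s y + e * (1 / bracket y - (y \<bullet> i)\<^sup>2 / bracket y ^ 3) \<ge> 0"
        by (rule second_derivative_nonneg_at_min; simp add: g_def minx)+
      moreover have "e * (1 / bracket y - (y \<bullet> i)\<^sup>2 / bracket y ^ 3) \<le> e * 1"
      proof -
        have "1 / bracket y \<le> 1" "0 \<le> (y \<bullet> i)\<^sup>2 / bracket y ^ 3"
          using bracket_ge[of y] by auto
        then show ?thesis using e by (intro mult_left_mono) auto
      qed
      ultimately show ?thesis by (auto simp: g1_def)
    qed
    have "gradient (u s) y = - (e / bracket y) *\<^sub>R y"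
      by (rule euclidean_eqI) (use sp in \<open>auto simp: u1_def\<close>)
    then have "norm (gradient (u s) y) = e * (norm y / bracket y)"
      using e bracket_ge(3)[of y] by simp
    also have "\<dots> \<le> e * 1"
      using e bracket_ge[of y] by (intro mult_left_mono) auto
    finally have "F s y \<le> e powr q"
      using s0 q_gt_1 by (auto simp: F_def intro!: powr_mono2)
    \<comment> \<open>Here \<open>e \<le> 1\<close> and \<open>q > 1\<close> enter: the nonlinear
      term at the minimum is no larger than the linear perturbation.\<close>
    also have "\<dots> \<le> e powr 1"
      using e q_gt_1 by (intro powr_mono') auto
    finally have Fe: "F s y \<le> e" using e by simp
    have "(\<Sum>i\<in>(Basis::'a set). - e) \<le> (\<Sum>i\<in>Basis. u2 i s y)"
      by (intro sum_mono) (use sp in auto)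
    then have ut_ge: "ut s y \<ge> - e * (real DIM('a) + 1)"
      using ut_eq[OF s0, of y] Fe by (simp add: algebra_simps)
    have 1: "((\<lambda>s. u s y) has_real_derivative ut s y) (at s)"
      using C s0 by (auto simp: C21_line_def)
    have D: "((\<lambda>s. w s y) has_real_derivative ut s y + e * K) (at s)"
      unfolding w_def by (rule derivative_eq_intros 1 refl)+ simp
    have "ut s y + e * K > 0"
      using ut_ge e by (simp add: K_def algebra_simps)
    from DERIV_pos_inc_left[OF D this] obtain d where d: "d > 0" "\<And>h. h > 0 \<Longrightarrow> h < d \<Longrightarrow> w (s - h) y < w s y"
      by auto
    define h where "h = min (d / 2) s"
    have "h > 0" "h < d" "h \<le> s" using d s0 by (auto simp: h_def)
    with d(2)[of h] min[of "s - h" y] s y show False by auto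
  qed
  have "((\<lambda>e. u t x + e * (bracket x + K * t)) \<longlongrightarrow> u t x + 0 * (bracket x + K * t)) (at_right 0)"
    by (intro tendsto_intros)
  moreover have "\<forall>\<^sub>F e in at_right 0. 0 \<le> u t x + e * (bracket x + K * t)"
    unfolding eventually_at_right_field using claim by (intro exI[of _ 1]) auto
  ultimately have "0 \<le> u t x + 0 * (bracket x + K * t)"
    by (rule tendsto_lowerbound) simp
  then show ?thesis by simp
qed

end

section \<open>Duhamel's formula\<close>

text \<open>The derivative of \<^term>\<open>heat_kernel t\<close> at \<open>z\<close> in the direction \<open>e\<close>.\<close>

definition heat_dir :: "'a::euclidean_space \<Rightarrow> real \<Rightarrow> 'a \<Rightarrow> real" where
  "heat_dir e t z = - ((z \<bullet> e) / (2 * t)) * heat_kernel t z"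

lemma heat_dir_measurable [measurable]:
  assumes [measurable]: "f \<in> borel_measurable M" "g \<in> borel_measurable M"
  shows "(\<lambda>x. heat_dir e (f x) (g x :: 'a::euclidean_space)) \<in> borel_measurable M"
  unfolding heat_dir_def by measurable

lemma continuous_on_heat_dir [continuous_intros]:
  fixes g :: "'b::topological_space \<Rightarrow> 'a::euclidean_space"
  assumes "continuous_on S f" "continuous_on S g" "\<And>x. x \<in> S \<Longrightarrow> f x > 0"
  shows "continuous_on S (\<lambda>x. heat_dir e (f x) (g x))"
  unfolding heat_dir_def
  by (intro continuous_intros assms) (use assms(3) in fastforce)+

lemma heat_dir_bound:
  fixes z :: "'a::euclidean_space"
  assumes t: "t > 0" and e: "norm e \<le> 1"
  shows "\<bar>heat_dir e t z\<bar> \<le> 2 powr (real DIM('a) / 2) * t powr (-1/2) * heat_kernel (2 * t) z"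
proof -
  have "\<bar>z \<bullet> e\<bar> \<le> norm z * norm e" by (rule Cauchy_Schwarz_ineq2)
  also have "\<dots> \<le> norm z" using e by (simp add: mult_left_le)
  finally have "\<bar>heat_dir e t z\<bar> \<le> norm z / (2 * t) * heat_kernel t z"
    using t by (auto simp: heat_dir_def abs_mult intro!: mult_right_mono divide_right_mono)
  also note heat_kernel_norm_bound[OF t]
  finally show ?thesis .
qed

section \<open>Time-reversed kernels as solutions of the backward heat equation\<close>

lemma heat_kernel_DERIV_shift:
  fixes x y i :: "'a::euclidean_space"
  assumes "\<sigma> > 0"
  shows "((\<lambda>h. heat_kernel \<sigma> (x - (y + h *\<^sub>R i))) has_real_derivative
    (((x - y) \<bullet> i) / (2 * \<sigma>)) * heat_kernel \<sigma> (x - y)) (at 0)"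
proof -
  have eq: "x - (y + h *\<^sub>R i) = (x - y) + h *\<^sub>R (- i)" for h by simp
  show ?thesis
    unfolding eq using heat_kernel_deriv_line[OF assms, of "x - y" "- i"] by simp
qed

lemma DERIV_inner_shift:
  fixes x y i v :: "'a::real_inner"
  shows "((\<lambda>h. (x - (y + h *\<^sub>R i)) \<bullet> v) has_real_derivative - (i \<bullet> v)) (at 0)"
proof -
  have "(x - (y + h *\<^sub>R i)) \<bullet> v = (x - y) \<bullet> v - h * (i \<bullet> v)" for h
    by (simp add: inner_diff_left inner_add_left)
  then show ?thesis
    by (auto intro!: derivative_eq_intros)
qed

lemma heat_kernel_DERIV_time_shift:
  fixes z :: "'a::euclidean_space"
  assumes "s < t"
  shows "((\<lambda>s. heat_kernel (t - s) z) has_real_derivative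
    - (((norm z)\<^sup>2 / (4 * (t - s)\<^sup>2) - real DIM('a) / (2 * (t - s))) * heat_kernel (t - s) z)) (at s)"
proof -
  have "((\<lambda>s. t - s) has_real_derivative - 1) (at s)"
    by (auto intro!: derivative_eq_intros)
  from DERIV_chain2[OF heat_kernel_deriv_time this, of z] assms show ?thesis by simp
qed

lemma sum_Basis_inner_sq:
  fixes z :: "'a::euclidean_space"
  shows "(\<Sum>i\<in>Basis. (z \<bullet> i)\<^sup>2) = (norm z)\<^sup>2"
  unfolding power2_norm_eq_inner euclidean_inner[of z z] by (simp add: power2_eq_square)

text \<open>Seen as a function of the source point \<open>(s, y)\<close>, the kernel runs backwards
  in time, hence the sign in the second claim; summing the squared coordinates recovers the norm in
  the time derivative.\<close>

lemma C21_line_heat_kernel: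
  fixes x :: "'a::euclidean_space"
  assumes I: "I \<subseteq> {..<t}"
  defines "\<phi>t \<equiv> \<lambda>s y. - (((norm (x - y))\<^sup>2 / (4 * (t - s)\<^sup>2) - real DIM('a) / (2 * (t - s))) * heat_kernel (t - s) (x - y))"
    and "\<phi>1 \<equiv> \<lambda>i s y. (((x - y) \<bullet> i) / (2 * (t - s))) * heat_kernel (t - s) (x - y)"
    and "\<phi>2 \<equiv> \<lambda>i s y. (((x - y) \<bullet> i)\<^sup>2 / (4 * (t - s)\<^sup>2) - 1 / (2 * (t - s))) * heat_kernel (t - s) (x - y)"
  shows "C21_line I (\<lambda>s y. heat_kernel (t - s) (x - y)) \<phi>t \<phi>1 \<phi>2"
    and "\<phi>t s y = - (\<Sum>i\<in>Basis. \<phi>2 i s y)"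
proof -
  have s: "s < t" if "s \<in> I" for s using that I by auto
  have "((\<lambda>h. \<phi>1 i s (y + h *\<^sub>R i)) has_real_derivative \<phi>2 i s y) (at 0)" if sI: "s \<in> I" and i: "i \<in> Basis" for s y i
  proof -
    have \<sigma>: "t - s > 0" using s[OF sI] by simp
    have 1: "((\<lambda>h. ((x - (y + h *\<^sub>R i)) \<bullet> i) / (2 * (t - s))) has_real_derivative - 1 / (2 * (t - s))) (at 0)"
      using DERIV_cdivide[OF DERIV_inner_shift[of x y i i], of "2 * (t - s)"] i by simp
    show ?thesis
      unfolding \<phi>1_def
      by (rule DERIV_cong[OF DERIV_mult[OF 1 heat_kernel_DERIV_shift[OF \<sigma>]]])
        (use \<sigma> in \<open>simp add: \<phi>2_def divide_simps, simp add: algebra_simps power2_eq_square\<close>)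
  qed
  moreover have "((\<lambda>h. heat_kernel (t - s) (x - (y + h *\<^sub>R i))) has_real_derivative \<phi>1 i s y) (at 0)" if "s \<in> I" for s y i
    unfolding \<phi>1_def using s[OF that] by (intro heat_kernel_DERIV_shift) simp
  moreover have "((\<lambda>s. heat_kernel (t - s) (x - y)) has_real_derivative \<phi>t s y) (at s)" if "s \<in> I" for s y
    unfolding \<phi>t_def using s[OF that] by (rule heat_kernel_DERIV_time_shift)
  moreover have "continuous_on (I \<times> UNIV) (\<lambda>(s, y). heat_kernel (t - s) (x - y))" "continuous_on (I \<times> UNIV) (\<lambda>(s, y). \<phi>t s y)"
    "continuous_on (I \<times> UNIV) (\<lambda>(s, y). \<phi>1 i s y)" "continuous_on (I \<times> UNIV) (\<lambda>(s, y). \<phi>2 i s y)" for i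
    unfolding case_prod_beta' \<phi>t_def \<phi>1_def \<phi>2_def
    by (intro continuous_intros; use s in force)+
  ultimately show "C21_line I (\<lambda>s y. heat_kernel (t - s) (x - y)) \<phi>t \<phi>1 \<phi>2"
    by (auto simp: C21_line_def)
  show "\<phi>t s y = - (\<Sum>i\<in>Basis. \<phi>2 i s y)"
    unfolding \<phi>t_def \<phi>2_def
    by (simp add: sum_distrib_right[symmetric] sum_subtractf sum_divide_distrib[symmetric] sum_Basis_inner_sq)
qed

lemma DERIV_inverse_time:
  fixes a s t :: real
  assumes "s < t"
  shows "((\<lambda>s. - (a / (2 * (t - s)))) has_real_derivative - (a / (2 * (t - s)\<^sup>2))) (at s)"
proof -
  have 1: "((\<lambda>s. t - s) has_real_derivative - 1) (at s)"
    by (auto intro!: derivative_eq_intros)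
  have "((\<lambda>s. - (a / 2) * inverse (t - s)) has_real_derivative
      - (a / 2) * (- (inverse (t - s) * - 1 * inverse (t - s)))) (at s)"
    by (intro DERIV_cmult DERIV_inverse' 1) (use assms in simp)
  then show ?thesis
    by (simp add: inverse_eq_divide power2_eq_square mult.assoc)
qed

text \<open>A spatial derivative of a backward heat solution is again one. Testing with it
  represents a directional derivative of \<open>u\<close>, so that no equation for
  \<open>\<nabla>u\<close>, and hence no third derivative of \<open>u\<close>, is required.\<close>

lemma C21_line_heat_dir:
  fixes x e :: "'a::euclidean_space"
  assumes I: "I \<subseteq> {..<t}"
  defines "\<phi>t \<equiv> \<lambda>s y. - (((x - y) \<bullet> e) / (2 * (t - s)\<^sup>2) * heat_kernel (t - s) (x - y)) +
       ((x - y) \<bullet> e) / (2 * (t - s)) * (((norm (x - y))\<^sup>2 / (4 * (t - s)\<^sup>2) - real DIM('a) / (2 * (t - s))) * heat_kernel (t - s) (x - y))"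
    and "\<phi>1 \<equiv> \<lambda>i s y. ((e \<bullet> i) / (2 * (t - s)) - ((x - y) \<bullet> e) * ((x - y) \<bullet> i) / (4 * (t - s)\<^sup>2)) * heat_kernel (t - s) (x - y)"
    and "\<phi>2 \<equiv> \<lambda>i s y. (2 * ((x - y) \<bullet> i) * (e \<bullet> i) / (4 * (t - s)\<^sup>2) + ((x - y) \<bullet> e) / (4 * (t - s)\<^sup>2) -
        ((x - y) \<bullet> e) * ((x - y) \<bullet> i)\<^sup>2 / (8 * (t - s) ^ 3)) * heat_kernel (t - s) (x - y)"
  shows "C21_line I (\<lambda>s y. heat_dir e (t - s) (x - y)) \<phi>t \<phi>1 \<phi>2"
    and "s \<in> I \<Longrightarrow> \<phi>t s y = - (\<Sum>i\<in>Basis. \<phi>2 i s y)"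
proof -
  have s: "s < t" if "s \<in> I" for s using that I by auto
  have "((\<lambda>h. \<phi>1 i s (y + h *\<^sub>R i)) has_real_derivative \<phi>2 i s y) (at 0)" if sI: "s \<in> I" and i: "i \<in> Basis" for s y i
  proof -
    have \<sigma>: "t - s > 0" using s[OF sI] by simp
    have 2: "((\<lambda>h. (x - (y + h *\<^sub>R i)) \<bullet> v) has_real_derivative - (v \<bullet> i)) (at 0)" for v
      using DERIV_inner_shift[of x y i v] by (simp add: inner_commute)
    have 1: "((\<lambda>h. (e \<bullet> i) / (2 * (t - s)) - ((x - (y + h *\<^sub>R i)) \<bullet> e) * ((x - (y + h *\<^sub>R i)) \<bullet> i) / (4 * (t - s)\<^sup>2))
        has_real_derivative ((e \<bullet> i) * ((x - y) \<bullet> i) + (x - y) \<bullet> e) / (4 * (t - s)\<^sup>2)) (at 0)"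
      by (rule DERIV_cong[OF DERIV_diff[OF DERIV_const DERIV_cdivide[OF DERIV_mult[OF 2[of e] 2[of i]]]]])
        (use i in \<open>simp add: minus_divide_left\<close>)
    show ?thesis
      unfolding \<phi>1_def
      by (rule DERIV_cong[OF DERIV_mult[OF 1 heat_kernel_DERIV_shift[OF \<sigma>]]])
        (use \<sigma> in \<open>simp add: \<phi>2_def divide_simps power2_eq_square power3_eq_cube, simp add: algebra_simps\<close>)
  qed
  moreover have "((\<lambda>h. heat_dir e (t - s) (x - (y + h *\<^sub>R i))) has_real_derivative \<phi>1 i s y) (at 0)" if "s \<in> I" for s y i
  proof -
    have \<sigma>: "t - s > 0" using s[OF that] by simp
    have 1: "((\<lambda>h. - (((x - (y + h *\<^sub>R i)) \<bullet> e) / (2 * (t - s)))) has_real_derivative (e \<bullet> i) / (2 * (t - s))) (at 0)"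
      using DERIV_minus[OF DERIV_cdivide[OF DERIV_inner_shift[of x y i e], of "2 * (t - s)"]]
      by (simp add: inner_commute)
    show ?thesis
      unfolding heat_dir_def
      by (rule DERIV_cong[OF DERIV_mult[OF 1 heat_kernel_DERIV_shift[OF \<sigma>]]])
        (use \<sigma> in \<open>simp add: \<phi>1_def divide_simps power2_eq_square, simp add: algebra_simps\<close>)
  qed
  moreover have "((\<lambda>s. heat_dir e (t - s) (x - y)) has_real_derivative \<phi>t s y) (at s)" if "s \<in> I" for s y
  proof -
    have \<sigma>: "t - s > 0" using s[OF that] by simp
    have 1: "((\<lambda>s. - (((x - y) \<bullet> e) / (2 * (t - s)))) has_real_derivative - (((x - y) \<bullet> e) / (2 * (t - s)\<^sup>2))) (at s)"
      using s[OF that] by (rule DERIV_inverse_time)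
    show ?thesis
      unfolding heat_dir_def
      by (rule DERIV_cong[OF DERIV_mult[OF 1 heat_kernel_DERIV_time_shift[OF s[OF that]]]])
        (simp add: \<phi>t_def algebra_simps)
  qed
  moreover have "continuous_on (I \<times> UNIV) (\<lambda>(s, y). heat_dir e (t - s) (x - y))" "continuous_on (I \<times> UNIV) (\<lambda>(s, y). \<phi>t s y)"
    "continuous_on (I \<times> UNIV) (\<lambda>(s, y). \<phi>1 i s y)" "continuous_on (I \<times> UNIV) (\<lambda>(s, y). \<phi>2 i s y)" for i
    unfolding case_prod_beta' \<phi>t_def \<phi>1_def \<phi>2_def
    by (intro continuous_intros; use s in force)+
  ultimately show "C21_line I (\<lambda>s y. heat_dir e (t - s) (x - y)) \<phi>t \<phi>1 \<phi>2"
    by (auto simp: C21_line_def)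
  show "\<phi>t s y = - (\<Sum>i\<in>Basis. \<phi>2 i s y)" if sI: "s \<in> I"
  proof -
    have \<sigma>: "t - s > 0" using s[OF sI] by simp
    define z \<sigma> where "z = x - y" "\<sigma> = t - s"
    have "(\<Sum>i\<in>Basis. \<phi>2 i s y) = (2 * (\<Sum>i\<in>Basis. (e \<bullet> i) * (z \<bullet> i)) / (4 * \<sigma>\<^sup>2) + real DIM('a) * (z \<bullet> e) / (4 * \<sigma>\<^sup>2) -
        (z \<bullet> e) * (\<Sum>i\<in>Basis. (z \<bullet> i)\<^sup>2) / (8 * \<sigma> ^ 3)) * heat_kernel \<sigma> z"
      unfolding \<phi>2_def z_\<sigma>_def[symmetric]
      by (simp add: sum_distrib_right[symmetric] sum_subtractf sum.distrib sum_divide_distrib[symmetric] sum_distrib_left[symmetric] mult.assoc)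
    also have "(\<Sum>i\<in>Basis. (e \<bullet> i) * (z \<bullet> i)) = z \<bullet> e"
      using euclidean_inner[of e z] by (simp add: inner_commute)
    finally have eq: "(\<Sum>i\<in>Basis. \<phi>2 i s y) = (2 * (z \<bullet> e) / (4 * \<sigma>\<^sup>2) + real DIM('a) * (z \<bullet> e) / (4 * \<sigma>\<^sup>2) -
        (z \<bullet> e) * (norm z)\<^sup>2 / (8 * \<sigma> ^ 3)) * heat_kernel \<sigma> z"
      by (simp only: sum_Basis_inner_sq)
    show ?thesis
      unfolding eq unfolding \<phi>t_def z_\<sigma>_def[symmetric] using \<sigma> unfolding z_\<sigma>_def[symmetric]
      by (simp add: divide_simps power2_eq_square power3_eq_cube) (simp add: algebra_simps)
  qed
qed

text \<open>The two terms contribute \<open>1/2\<close> and \<open>8/4 = 2\<close>, after the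
  quadratic factor is absorbed by doubling the time; the sum \<open>5/2\<close> is rounded up to
  3.\<close>

lemma heat_dir_deriv_bound:
  fixes z e i :: "'a::euclidean_space"
  assumes t: "t > 0" and e: "norm e \<le> 1" and i: "norm i \<le> 1"
  shows "\<bar>((e \<bullet> i) / (2 * t) - (z \<bullet> e) * (z \<bullet> i) / (4 * t\<^sup>2)) * heat_kernel t z\<bar> \<le>
     3 * 2 powr (real DIM('a) / 2) / t * heat_kernel (2 * t) z"
proof -
  have cs: "\<bar>v \<bullet> w\<bar> \<le> norm v" if "norm w \<le> 1" for v w :: 'a
    using Cauchy_Schwarz_ineq2[of v w] mult_left_le[OF that norm_ge_zero, of v] by linarith
  have "\<bar>e \<bullet> i\<bar> \<le> 1" using cs[OF i, of e] e by simp
  then have 1: "\<bar>(e \<bullet> i) / (2 * t)\<bar> \<le> 1 / (2 * t)"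
    using t by (simp add: divide_right_mono)
  have "\<bar>z \<bullet> e\<bar> * \<bar>z \<bullet> i\<bar> \<le> norm z * norm z"
    using cs[OF e] cs[OF i] by (intro mult_mono) auto
  then have 2: "\<bar>(z \<bullet> e) * (z \<bullet> i) / (4 * t\<^sup>2)\<bar> \<le> (norm z)\<^sup>2 / (4 * t\<^sup>2)"
    using t by (simp add: abs_mult power2_eq_square divide_right_mono)
  have "\<bar>((e \<bullet> i) / (2 * t) - (z \<bullet> e) * (z \<bullet> i) / (4 * t\<^sup>2)) * heat_kernel t z\<bar> \<le>
      (1 / (2 * t) + (norm z)\<^sup>2 / (4 * t\<^sup>2)) * heat_kernel t z"
    unfolding abs_mult using 1 2 abs_triangle_ineq4[of "(e \<bullet> i) / (2 * t)" "(z \<bullet> e) * (z \<bullet> i) / (4 * t\<^sup>2)"]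
    by (intro mult_mono) auto
  also have "\<dots> = 1 / (2 * t) * heat_kernel t z + (norm z)\<^sup>2 * heat_kernel t z / (4 * t\<^sup>2)"
    by (simp add: algebra_simps)
  also have "\<dots> \<le> 1 / (2 * t) * (2 powr (real DIM('a) / 2) * heat_kernel (2 * t) z) +
      (8 * t * 2 powr (real DIM('a) / 2) * heat_kernel (2 * t) z) / (4 * t\<^sup>2)"
    using t by (intro add_mono mult_left_mono divide_right_mono heat_kernel_le_double heat_kernel_norm_sq_bound) auto
  also have "\<dots> = (5/2) / t * (2 powr (real DIM('a) / 2) * heat_kernel (2 * t) z)"
    using t by (simp add: field_simps power2_eq_square)
  also have "\<dots> \<le> 3 / t * (2 powr (real DIM('a) / 2) * heat_kernel (2 * t) z)"
    using t by (intro mult_right_mono divide_right_mono) auto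
  finally show ?thesis by simp
qed

text \<open>The function also moves with \<open>s\<close>, so joint continuity at
  \<open>(t, x)\<close> is used. The deviation is at most \<open>e / 2\<close> plus a multiple of
  the squared distance, and the second moment of the kernel is of order
  \<open>t - s\<close>.\<close>

lemma heat_approx_identity:
  fixes v :: "real \<Rightarrow> 'a::euclidean_space \<Rightarrow> real"
  assumes t: "t > 0" and b: "\<And>s y. s > 0 \<Longrightarrow> \<bar>v s y\<bar> \<le> C"
    and cont: "continuous_on ({0<..} \<times> UNIV) (\<lambda>(s, y). v s y)"
  shows "((\<lambda>s. LINT y|lborel. heat_kernel (t - s) (x - y) * v s y) \<longlongrightarrow> v t x) (at_left t)"
proof (rule tendstoI)
  fix e :: real assume e: "e > 0"
  have C: "C \<ge> 0" using b[of 1] by (auto intro: order.trans[OF abs_ge_zero])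
  have "open ({0::real<..} \<times> (UNIV :: 'a set))" by (intro open_Times) auto
  with cont t have "isCont (\<lambda>(s, y). v s y) (t, x)"
    by (auto simp: continuous_on_eq_continuous_at)
  then obtain d where d: "d > 0" "\<And>p. dist p (t, x) < d \<Longrightarrow> dist (case p of (s, y) \<Rightarrow> v s y) (v t x) < e / 2"
    using e unfolding continuous_at_eps_delta by (metis half_gt_zero case_prod_conv)
  define c where "c = 2 powr (real DIM('a) / 2)"
  \<comment> \<open>Chosen so that \<open>k * (d / 2)^2 = 2 * C\<close>: at distance
    \<open>d / 2\<close> the quadratic term already covers the largest possible deviation.\<close>
  define k where "k = 8 * C / d\<^sup>2"
  have k: "k \<ge> 0" using C by (simp add: k_def)
  have key: "\<bar>(LINT y|lborel. heat_kernel (t - s) (x - y) * v s y) - v t x\<bar> \<le> e / 2 + k * (8 * (t - s) * c)"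
    if s: "s < t" "s > 0" "t - s < d / 2" for s
  proof -
    define \<sigma> where "\<sigma> = t - s"
    have \<sigma>: "\<sigma> > 0" using s by (simp add: \<sigma>_def)
    have pt: "\<bar>v s y - v t x\<bar> \<le> e / 2 + k * (norm (x - y))\<^sup>2" for y
    proof (cases "norm (x - y) < d / 2")
      case True
      have "dist (s, y) (t, x) \<le> dist s t + dist y x"
        unfolding dist_Pair_Pair by (rule sqrt_sum_squares_le_sum) auto
      also have "\<dots> < d" using True s by (simp add: dist_norm norm_minus_commute)
      finally have "\<bar>v s y - v t x\<bar> < e / 2" using d(2)[of "(s, y)"] by (simp add: dist_real_def)
      moreover have "0 \<le> k * (norm (x - y))\<^sup>2" using k by simp
      ultimately show ?thesis by linarith
    next
      case False
      then have "(d / 2)\<^sup>2 \<le> (norm (x - y))\<^sup>2" using d by (intro power_mono) auto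
      then have "k * (d / 2)\<^sup>2 \<le> k * (norm (x - y))\<^sup>2" using k by (rule mult_left_mono)
      moreover have "k * (d / 2)\<^sup>2 = 2 * C" using d by (simp add: k_def power2_eq_square)
      moreover have "\<bar>v s y - v t x\<bar> \<le> 2 * C"
        using b[of s y] b[of t x] s t by (intro order.trans[OF abs_triangle_ineq4]) auto
      ultimately show ?thesis using e by linarith
    qed
    have m: "v s \<in> borel_measurable borel"
    proof (rule borel_measurable_continuous_onI)
      have "continuous_on UNIV (\<lambda>y. (s, y))" by (intro continuous_intros)
      from continuous_on_compose2[OF cont this] s(2) show "continuous_on UNIV (v s)"
        by (simp add: image_subset_iff)
    qed
    note G = integrable_heat_kernel[OF \<sigma>, of x]
    have Gv: "integrable lborel (\<lambda>y. heat_kernel \<sigma> (x - y) * v s y)"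
      by (rule Bochner_Integration.integrable_bound[OF integrable_mult_right[OF G, of C]])
         (use m order.trans[OF b[OF s(2)] abs_ge_self] in \<open>auto intro!: AE_I2 mult_left_mono simp: abs_mult mult.commute[of C]\<close>)
    have "(LINT y|lborel. heat_kernel \<sigma> (x - y) * v s y) - v t x =
       (LINT y|lborel. heat_kernel \<sigma> (x - y) * (v s y - v t x))"
      using Gv G has_bochner_integral_integral_eq[OF has_bochner_integral_heat_kernel[OF \<sigma>, of x]]
      by (simp add: right_diff_distrib)
    also have "\<bar>\<dots>\<bar> \<le> (LINT y|lborel. \<bar>heat_kernel \<sigma> (x - y) * (v s y - v t x)\<bar>)"
      by (rule integral_abs_bound)
    also have "\<dots> \<le> (LINT y|lborel. e / 2 * heat_kernel \<sigma> (x - y) + k * (8 * \<sigma> * c) * heat_kernel (2 * \<sigma>) (x - y))"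
    proof (rule integral_mono)
      show "integrable lborel (\<lambda>y. \<bar>heat_kernel \<sigma> (x - y) * (v s y - v t x)\<bar>)"
        using Gv G by (simp add: right_diff_distrib)
      show "integrable lborel (\<lambda>y. e / 2 * heat_kernel \<sigma> (x - y) + k * (8 * \<sigma> * c) * heat_kernel (2 * \<sigma>) (x - y))"
        using G integrable_heat_kernel[of "2 * \<sigma>" x] \<sigma> by auto
      fix y
      have "\<bar>heat_kernel \<sigma> (x - y) * (v s y - v t x)\<bar> \<le> heat_kernel \<sigma> (x - y) * (e / 2 + k * (norm (x - y))\<^sup>2)"
        using pt by (simp add: abs_mult mult_left_mono)
      also have "\<dots> = e / 2 * heat_kernel \<sigma> (x - y) + k * ((norm (x - y))\<^sup>2 * heat_kernel \<sigma> (x - y))"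
        by (simp add: algebra_simps)
      also have "\<dots> \<le> e / 2 * heat_kernel \<sigma> (x - y) + k * (8 * \<sigma> * c * heat_kernel (2 * \<sigma>) (x - y))"
        unfolding c_def using k by (intro add_left_mono mult_left_mono heat_kernel_norm_sq_bound \<sigma>)
      finally show "\<bar>heat_kernel \<sigma> (x - y) * (v s y - v t x)\<bar> \<le> e / 2 * heat_kernel \<sigma> (x - y) + k * (8 * \<sigma> * c) * heat_kernel (2 * \<sigma>) (x - y)"
        by (simp add: mult_ac)
    qed
    also have "\<dots> = e / 2 + k * (8 * \<sigma> * c)"
      using G integrable_heat_kernel[of "2 * \<sigma>" x] \<sigma>
        has_bochner_integral_integral_eq[OF has_bochner_integral_heat_kernel[OF \<sigma>, of x]]
        has_bochner_integral_integral_eq[OF has_bochner_integral_heat_kernel[of "2 * \<sigma>" x]]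
      by simp
    finally show ?thesis by (simp add: \<sigma>_def)
  qed
  have "((\<lambda>s. e / 2 + k * (8 * (t - s) * c)) \<longlongrightarrow> e / 2 + k * (8 * (t - t) * c)) (at_left t)"
    by (intro tendsto_intros)
  from order_tendstoD(2)[OF this, of e] have "\<forall>\<^sub>F s in at_left t. e / 2 + k * (8 * (t - s) * c) < e"
    using e by simp
  moreover have "\<forall>\<^sub>F s in at_left t. s \<in> {max 0 (t - d / 2)<..<t}"
    using t d by (intro eventually_at_left_real) auto
  ultimately show "\<forall>\<^sub>F s in at_left t. dist (LINT y|lborel. heat_kernel (t - s) (x - y) * v s y) (v t x) < e"
  proof eventually_elim
    case (elim s)
    then show ?case using key[of s] by (auto simp: dist_real_def)
  qed
qed

context viscous_HJ
begin

section \<open>Measurability of the solution, and Green's identity tested with the kernels\<close>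

lemma gradient_continuous_on: "continuous_on ({0<..} \<times> UNIV) (\<lambda>(t, x). gradient (u t) x)"
  using C21_u by (simp add: C21_def)

lemma gradient_slice_continuous: "s > 0 \<Longrightarrow> continuous_on S (gradient (u s))"
proof -
  assume s: "s > 0"
  have "continuous_on S (\<lambda>y. (s, y))" by (intro continuous_intros)
  from continuous_on_compose2[OF gradient_continuous_on this] s show ?thesis
    by (simp add: image_subset_iff)
qed

lemma gradient_measurable [measurable]: "s > 0 \<Longrightarrow> gradient (u s) \<in> borel_measurable borel"
  by (intro borel_measurable_continuous_onI gradient_slice_continuous)

lemma u_slice_measurable [measurable]: "s \<ge> 0 \<Longrightarrow> u s \<in> borel_measurable borel"
  by (intro borel_measurable_continuous_onI u_continuous_at continuous_intros)

lemma F_measurable_pair: "(\<lambda>p. F (fst p) (snd p)) \<in> borel_measurable (borel \<Otimes>\<^sub>M borel)"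
proof -
  have "continuous_on ({0<..} \<times> UNIV) (\<lambda>p. norm (gradient (u (fst p)) (snd p)) powr q)"
    using gradient_continuous_on q_gt_1
    by (intro continuous_on_powr' continuous_intros) (auto simp: case_prod_beta')
  then have "(\<lambda>p. indicator ({0<..} \<times> UNIV) p *\<^sub>R (norm (gradient (u (fst p)) (snd p)) powr q)) \<in> borel_measurable borel"
    by (intro borel_measurable_continuous_on_indicator) (auto intro!: borel_open open_Times)
  also have "(\<lambda>p. indicator ({0<..} \<times> UNIV) p *\<^sub>R (norm (gradient (u (fst p)) (snd p)) powr q)) = (\<lambda>p. F (fst p) (snd p))"
    by (auto simp: F_def indicator_def fun_eq_iff)
  finally show ?thesis by (simp add: borel_prod)
qed

lemma F_measurable [measurable (raw)]:
  assumes "f \<in> borel_measurable N" "g \<in> borel_measurable N"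
  shows "(\<lambda>x. F (f x) (g x)) \<in> borel_measurable N"
  using measurable_compose[OF measurable_Pair[OF assms] F_measurable_pair] by simp

lemma F_bound: "F s y \<le> M powr q"
  using gradient_bound[of s y] q_gt_1 by (auto simp: F_def intro!: powr_mono2)

lemma u_le_M: "s \<ge> 0 \<Longrightarrow> u s y \<le> M"
proof -
  assume "s \<ge> 0"
  show ?thesis
  proof (cases "s = 0")
    case True
    have "((\<lambda>s. u s y) \<longlongrightarrow> u 0 y) (at_right 0)"
    proof -
      have "continuous_on {0..} (\<lambda>s. u s y)" by (intro u_continuous_at continuous_intros) auto
      then have "((\<lambda>s. u s y) \<longlongrightarrow> u 0 y) (at 0 within {0..})"
        by (simp add: continuous_on_def)
      then show ?thesis by (rule tendsto_within_subset) auto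
    qed
    moreover have "\<forall>\<^sub>F s in at_right 0. u s y \<le> M"
      unfolding eventually_at_right_field using u_bound by (intro exI[of _ 1]) (auto simp: abs_le_iff)
    ultimately have "u 0 y \<le> M"
      by (rule tendsto_upperbound) simp
    then show ?thesis using True by simp
  next
    case False
    then show ?thesis using \<open>s \<ge> 0\<close> u_bound[of s y] by (simp add: abs_le_iff)
  qed
qed

lemma green_u:
  assumes s: "0 < s1" "s1 \<le> s2"
    and \<phi>: "C21_line {s1..s2} \<phi> \<phi>t \<phi>1 \<phi>2"
    and \<phi>eq: "\<And>s y. s \<in> {s1..s2} \<Longrightarrow> \<phi>t s y = - (\<Sum>i\<in>Basis. \<phi>2 i s y)"
    and \<phi>b: "\<And>s y. s \<in> {s1..s2} \<Longrightarrow> \<bar>\<phi> s y\<bar> \<le> \<Psi> y" "\<And>s y i. s \<in> {s1..s2} \<Longrightarrow> i \<in> Basis \<Longrightarrow> \<bar>\<phi>1 i s y\<bar> \<le> \<Psi> y"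
    and \<Psi>: "integrable lborel \<Psi>"
  shows "integrable (lborel \<Otimes>\<^sub>M lborel) (\<lambda>p. indicator {s1..s2} (fst p) * (\<phi> (fst p) (snd p) * F (fst p) (snd p)))"
    and "(LINT y|lborel. \<phi> s2 y * u s2 y) - (LINT y|lborel. \<phi> s1 y * u s1 y) =
     - (LINT p|(lborel \<Otimes>\<^sub>M lborel). indicator {s1..s2} (fst p) * (\<phi> (fst p) (snd p) * F (fst p) (snd p)))"
proof -
  have sub: "{s1..s2} \<subseteq> {0<..}" using s by auto
  have b: "\<bar>u s y\<bar> \<le> max M (M powr q)" "i \<in> Basis \<Longrightarrow> \<bar>u1 i s y\<bar> \<le> max M (M powr q)" "\<bar>F s y\<bar> \<le> max M (M powr q)"
    if "s \<in> {s1..s2}" for s y and i :: 'a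
  proof -
    have s0: "s > 0" using that sub by auto
    show "\<bar>u s y\<bar> \<le> max M (M powr q)" using u_bound[OF s0, of y] by simp
    show "\<bar>F s y\<bar> \<le> max M (M powr q)" using F_bound[of s y] by simp
    assume "i \<in> Basis"
    then have "\<bar>u1 i s y\<bar> \<le> norm (gradient (u s) y)" unfolding u1_def by (rule Basis_le_norm)
    then show "\<bar>u1 i s y\<bar> \<le> max M (M powr q)" using gradient_bound[OF s0, of y] by simp
  qed
  have eq: "ut s y = (\<Sum>i\<in>Basis. u2 i s y) - F s y" if "s \<in> {s1..s2}" for s y
    using ut_eq that sub by auto
  note * = green_identity[OF s(2) \<phi> C21_line_u[OF sub] \<phi>eq eq b \<phi>b \<Psi>]
  show "integrable (lborel \<Otimes>\<^sub>M lborel) (\<lambda>p. indicator {s1..s2} (fst p) * (\<phi> (fst p) (snd p) * F (fst p) (snd p)))"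
    by (rule *(1))
  show "(LINT y|lborel. \<phi> s2 y * u s2 y) - (LINT y|lborel. \<phi> s1 y * u s1 y) =
     - (LINT p|(lborel \<Otimes>\<^sub>M lborel). indicator {s1..s2} (fst p) * (\<phi> (fst p) (snd p) * F (fst p) (snd p)))"
    by (rule *(2))
qed

text \<open>The interval ends before the singular time \<open>t\<close>. With \<open>a\<close> and
  \<open>b\<close> the shortest and longest distance to \<open>t\<close>, all kernels involved lie
  below a multiple of the single Gaussian at time \<open>2 * b\<close>.\<close>

lemma green_heat_kernel:
  assumes s: "0 < s1" "s1 \<le> s2" "s2 < t"
  shows "integrable (lborel \<Otimes>\<^sub>M lborel) (\<lambda>p. indicator {s1..s2} (fst p) * (heat_kernel (t - fst p) (x - snd p) * F (fst p) (snd p)))"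
    (is ?I)
    and "(LINT y|lborel. heat_kernel (t - s2) (x - y) * u s2 y) - (LINT y|lborel. heat_kernel (t - s1) (x - y) * u s1 y) =
     - (LINT p|(lborel \<Otimes>\<^sub>M lborel). indicator {s1..s2} (fst p) * (heat_kernel (t - fst p) (x - snd p) * F (fst p) (snd p)))"
    (is ?E)
proof -
  define a b where "a = t - s2" "b = t - s1"
  have ab: "0 < a" "a \<le> b" using s by (auto simp: a_b_def)
  define c where "c = 2 powr (real DIM('a) / 2) * (b / a) powr (real DIM('a) / 2)"
  \<comment> \<open>The summand 1 dominates the kernel, the other one its first derivatives.\<close>
  define \<Psi> where "\<Psi> y = (1 + a powr (-1/2)) * c * heat_kernel (2 * b) (x - y)" for y
  have I: "{s1..s2} \<subseteq> {..<t}" using s by auto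
  have \<Psi>: "integrable lborel \<Psi>"
    unfolding \<Psi>_def using ab by (intro integrable_mult_right integrable_heat_kernel) auto
  have dbl: "2 powr (real DIM('a) / 2) * heat_kernel (2 * (t - s)) z \<le> c * heat_kernel (2 * b) z" if "s \<in> {s1..s2}" for s and z :: 'a
  proof -
    have "heat_kernel (2 * (t - s)) z \<le> ((2 * b) / (2 * a)) powr (real DIM('a) / 2) * heat_kernel (2 * b) z"
      using that ab by (intro heat_kernel_time_mono) (auto simp: a_b_def)
    then show ?thesis by (simp add: c_def mult.assoc)
  qed
  have c0: "0 \<le> c * heat_kernel (2 * b) z" for z :: 'a
    by (simp add: c_def)
  have 1: "\<bar>heat_kernel (t - s) (x - y)\<bar> \<le> \<Psi> y" if "s \<in> {s1..s2}" for s y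
  proof -
    have "\<bar>heat_kernel (t - s) (x - y)\<bar> \<le> 1 * (c * heat_kernel (2 * b) (x - y))"
      using heat_kernel_le_double[of "t - s" "x - y"] dbl[OF that, of "x - y"] that s by simp
    also have "\<dots> \<le> (1 + a powr (-1/2)) * (c * heat_kernel (2 * b) (x - y))"
      by (intro mult_right_mono c0) simp
    finally show ?thesis by (simp add: \<Psi>_def mult.assoc)
  qed
  have 2: "\<bar>((x - y) \<bullet> i) / (2 * (t - s)) * heat_kernel (t - s) (x - y)\<bar> \<le> \<Psi> y" if sI: "s \<in> {s1..s2}" and i: "i \<in> Basis" for s y i
  proof -
    have \<sigma>: "t - s > 0" "a \<le> t - s" using sI s by (auto simp: a_b_def)
    have "\<bar>((x - y) \<bullet> i) / (2 * (t - s)) * heat_kernel (t - s) (x - y)\<bar> \<le>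
        2 powr (real DIM('a) / 2) * (t - s) powr (-1/2) * heat_kernel (2 * (t - s)) (x - y)"
      using heat_dir_bound[OF \<sigma>(1), of i "x - y"] i by (simp add: heat_dir_def abs_mult)
    also have "\<dots> = (t - s) powr (-1/2) * (2 powr (real DIM('a) / 2) * heat_kernel (2 * (t - s)) (x - y))"
      by simp
    also have "\<dots> \<le> (1 + a powr (-1/2)) * (c * heat_kernel (2 * b) (x - y))"
    proof (rule mult_mono)
      have "(t - s) powr (-1/2) \<le> a powr (-1/2)"
        using \<sigma> ab by (intro powr_mono2') auto
      then show "(t - s) powr (-1/2) \<le> 1 + a powr (-1/2)" by simp
    qed (use dbl[OF sI] in auto)
    finally show ?thesis by (simp add: \<Psi>_def mult.assoc)
  qed
  note * = green_u[OF s(1,2) C21_line_heat_kernel(1)[OF I] C21_line_heat_kernel(2)[OF I] 1 2 \<Psi>]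
  show ?I by (rule *(1))
  show ?E by (rule *(2))
qed

lemma green_heat_dir:
  assumes s: "0 < s1" "s1 \<le> s2" "s2 < t" and e: "norm e \<le> 1"
  shows "integrable (lborel \<Otimes>\<^sub>M lborel) (\<lambda>p. indicator {s1..s2} (fst p) * (heat_dir e (t - fst p) (x - snd p) * F (fst p) (snd p)))"
    (is ?I)
    and "(LINT y|lborel. heat_dir e (t - s2) (x - y) * u s2 y) - (LINT y|lborel. heat_dir e (t - s1) (x - y) * u s1 y) =
     - (LINT p|(lborel \<Otimes>\<^sub>M lborel). indicator {s1..s2} (fst p) * (heat_dir e (t - fst p) (x - snd p) * F (fst p) (snd p)))"
    (is ?E)
proof -
  define a b where "a = t - s2" "b = t - s1"
  have ab: "0 < a" "a \<le> b" using s by (auto simp: a_b_def)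
  define c where "c = 2 powr (real DIM('a) / 2) * (b / a) powr (real DIM('a) / 2)"
  \<comment> \<open>\<open>a powr (-1/2)\<close> dominates \<open>heat_dir\<close>, and
    \<open>3 / a\<close> its first derivatives by \<open>heat_dir_deriv_bound\<close>.\<close>
  define \<Psi> where "\<Psi> y = (a powr (-1/2) + 3 / a) * c * heat_kernel (2 * b) (x - y)" for y
  have I: "{s1..s2} \<subseteq> {..<t}" using s by auto
  have \<Psi>: "integrable lborel \<Psi>"
    unfolding \<Psi>_def using ab by (intro integrable_mult_right integrable_heat_kernel) auto
  have dbl: "2 powr (real DIM('a) / 2) * heat_kernel (2 * (t - s)) z \<le> c * heat_kernel (2 * b) z" if "s \<in> {s1..s2}" for s and z :: 'a
  proof -
    have "heat_kernel (2 * (t - s)) z \<le> ((2 * b) / (2 * a)) powr (real DIM('a) / 2) * heat_kernel (2 * b) z"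
      using that ab by (intro heat_kernel_time_mono) (auto simp: a_b_def)
    then show ?thesis by (simp add: c_def mult.assoc)
  qed
  have 1: "\<bar>heat_dir e (t - s) (x - y)\<bar> \<le> \<Psi> y" if sI: "s \<in> {s1..s2}" for s y
  proof -
    have \<sigma>: "t - s > 0" "a \<le> t - s" using sI s by (auto simp: a_b_def)
    have "\<bar>heat_dir e (t - s) (x - y)\<bar> \<le> (t - s) powr (-1/2) * (2 powr (real DIM('a) / 2) * heat_kernel (2 * (t - s)) (x - y))"
      using heat_dir_bound[OF \<sigma>(1) e, of "x - y"] by (simp add: mult_ac)
    also have "\<dots> \<le> (a powr (-1/2) + 3 / a) * (c * heat_kernel (2 * b) (x - y))"
    proof (rule mult_mono)
      have "(t - s) powr (-1/2) \<le> a powr (-1/2)"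
        using \<sigma> ab by (intro powr_mono2') auto
      then show "(t - s) powr (-1/2) \<le> a powr (-1/2) + 3 / a" using ab by (simp add: add_increasing2)
    qed (use dbl[OF sI] ab in auto)
    finally show ?thesis by (simp add: \<Psi>_def mult.assoc)
  qed
  have 2: "\<bar>((e \<bullet> i) / (2 * (t - s)) - ((x - y) \<bullet> e) * ((x - y) \<bullet> i) / (4 * (t - s)\<^sup>2)) * heat_kernel (t - s) (x - y)\<bar> \<le> \<Psi> y"
    if sI: "s \<in> {s1..s2}" and i: "i \<in> Basis" for s y i
  proof -
    have \<sigma>: "t - s > 0" "a \<le> t - s" using sI s by (auto simp: a_b_def)
    have "\<bar>((e \<bullet> i) / (2 * (t - s)) - ((x - y) \<bullet> e) * ((x - y) \<bullet> i) / (4 * (t - s)\<^sup>2)) * heat_kernel (t - s) (x - y)\<bar> \<le>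
        3 / (t - s) * (2 powr (real DIM('a) / 2) * heat_kernel (2 * (t - s)) (x - y))"
      using heat_dir_deriv_bound[OF \<sigma>(1) e, of i "x - y"] i by simp
    also have "\<dots> \<le> (a powr (-1/2) + 3 / a) * (c * heat_kernel (2 * b) (x - y))"
    proof (rule mult_mono)
      have "3 / (t - s) \<le> 3 / a"
        using \<sigma> ab by (intro divide_left_mono) auto
      then show "3 / (t - s) \<le> a powr (-1/2) + 3 / a" by (simp add: add_increasing)
    qed (use dbl[OF sI] ab in auto)
    finally show ?thesis by (simp add: \<Psi>_def mult.assoc)
  qed
  note * = green_u[OF s(1,2) C21_line_heat_dir(1)[OF I] C21_line_heat_dir(2)[OF I] 1 2 \<Psi>]
  show ?I by (rule *(1))
  show ?E by (rule *(2))
qed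




text \<open>
  \<open>absorbed 0 1\<close> is the source term of Duhamel's formula for \<^term>\<open>u\<close>, and \<open>absorbed (1/2) 2\<close> bounds,
  up to a constant, the one of the formula for the gradient.
\<close>

definition absorbed :: "real \<Rightarrow> real \<Rightarrow> real \<Rightarrow> real \<Rightarrow> 'a \<Rightarrow> ennreal" where
  "absorbed \<kappa> k \<tau> t x = (\<integral>\<^sup>+s. indicator {\<tau>..<t} s * ennreal ((t - s) powr (- \<kappa>)) *
     (\<integral>\<^sup>+y. ennreal (heat_kernel (k * (t - s)) (x - y) * F s y) \<partial>lborel) \<partial>lborel)"

lemma absorbed_measurable [measurable]: "absorbed \<kappa> k \<tau> t \<in> borel_measurable borel"
  unfolding absorbed_def by measurable

lemma u_heat_limit:
  assumes t: "t > 0"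
  shows "((\<lambda>s. LINT y|lborel. heat_kernel (t - s) (x - y) * u s y) \<longlongrightarrow> u t x) (at_left t)"
  using heat_approx_identity[OF t, of u M x] u_bound continuous_on_subset[OF continuous_u, of "{0<..} \<times> UNIV"]
  by fastforce

lemma integrable_heat_kernel_mult:
  fixes f :: "'a \<Rightarrow> real"
  assumes "\<sigma> > 0" "f \<in> borel_measurable borel" "\<And>y. \<bar>f y\<bar> \<le> C"
  shows "integrable lborel (\<lambda>y. heat_kernel \<sigma> (x - y) * f y)"
proof (rule Bochner_Integration.integrable_bound)
  show "integrable lborel (\<lambda>y. C * heat_kernel \<sigma> (x - y))"
    using assms by (intro integrable_mult_right integrable_heat_kernel)
  show "AE y in lborel. norm (heat_kernel \<sigma> (x - y) * f y) \<le> norm (C * heat_kernel \<sigma> (x - y))"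
  proof (rule AE_I2)
    fix y
    have "\<bar>f y\<bar> \<le> \<bar>C\<bar>" using assms(3)[of y] by linarith
    then show "norm (heat_kernel \<sigma> (x - y) * f y) \<le> norm (C * heat_kernel \<sigma> (x - y))"
      by (simp add: abs_mult mult_right_mono mult.commute)
  qed
qed (use assms in measurable)

lemma nn_integral_heat_u:
  assumes "\<sigma> > 0" "s \<ge> 0"
  shows "(\<integral>\<^sup>+y. ennreal (heat_kernel \<sigma> (x - y) * u s y) \<partial>lborel) = ennreal (LINT y|lborel. heat_kernel \<sigma> (x - y) * u s y)"
  using integrable_heat_kernel_mult[OF assms(1) u_slice_measurable[OF assms(2)], of M x] u_nonneg[OF assms(2)] u_le_M[OF assms(2)]
  by (intro nn_integral_eq_integral) auto

text \<open>All terms are non-negative, so Green's identity can be moved to \<open>ennreal\<close>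
  by placing the absorbed part on the left. Limits in the end points of the interval then need only
  monotone convergence for the source.\<close>

lemma nn_integral_green:
  assumes s: "0 < s1" "s1 \<le> s2" "s2 < t"
  shows "ennreal (LINT y|lborel. heat_kernel (t - s2) (x - y) * u s2 y) +
    (\<integral>\<^sup>+s. indicator {s1..s2} s * (\<integral>\<^sup>+y. ennreal (heat_kernel (t - s) (x - y) * F s y) \<partial>lborel) \<partial>lborel)
    = (\<integral>\<^sup>+y. ennreal (heat_kernel (t - s1) (x - y) * u s1 y) \<partial>lborel)"
proof -
  let ?P = "lborel \<Otimes>\<^sub>M lborel :: (real \<times> 'a) measure"
  let ?f = "\<lambda>p. indicator {s1..s2} (fst p) * (heat_kernel (t - fst p) (x - snd p) * F (fst p) (snd p))"
  have "(\<integral>\<^sup>+s. indicator {s1..s2} s * (\<integral>\<^sup>+y. ennreal (heat_kernel (t - s) (x - y) * F s y) \<partial>lborel) \<partial>lborel) =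
    (\<integral>\<^sup>+s. (\<integral>\<^sup>+y. ennreal (?f (s, y)) \<partial>lborel) \<partial>lborel)"
    by (intro nn_integral_cong) (auto simp: indicator_def)
  also have "\<dots> = (\<integral>\<^sup>+p. ennreal (?f p) \<partial>?P)"
    by (rule lborel.nn_integral_fst) measurable
  also have "\<dots> = ennreal (LINT p|?P. ?f p)"
    using green_heat_kernel(1)[OF s] by (rule nn_integral_eq_integral) auto
  finally have 1: "(\<integral>\<^sup>+s. indicator {s1..s2} s * (\<integral>\<^sup>+y. ennreal (heat_kernel (t - s) (x - y) * F s y) \<partial>lborel) \<partial>lborel) =
     ennreal (LINT p|?P. ?f p)" .
  have 2: "0 \<le> (LINT p|?P. ?f p)" by (intro integral_nonneg_AE AE_I2) auto
  have 3: "0 \<le> (LINT y|lborel. heat_kernel (t - s2) (x - y) * u s2 y)"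
    using u_nonneg[of s2] s by (intro integral_nonneg_AE AE_I2) auto
  have 4: "(LINT y|lborel. heat_kernel (t - s2) (x - y) * u s2 y) + (LINT p|?P. ?f p) =
      (LINT y|lborel. heat_kernel (t - s1) (x - y) * u s1 y)"
    using green_heat_kernel(2)[OF s, of x] by linarith
  have "t - s1 > 0" "s1 \<ge> 0" using s by auto
  then show ?thesis
    unfolding 1 nn_integral_heat_u[OF \<open>t - s1 > 0\<close> \<open>s1 \<ge> 0\<close>] ennreal_plus[OF 3 2, symmetric] 4 by simp
qed

text \<open>Let the right end point increase to \<open>t\<close>: the source converges
  monotonically, and the boundary term converges because the kernel is an approximate
  identity.\<close>

lemma duhamel_pos:
  assumes \<tau>: "0 < \<tau>" "\<tau> < t"
  shows "ennreal (u t x) + absorbed 0 1 \<tau> t x = (\<integral>\<^sup>+y. ennreal (heat_kernel (t - \<tau>) (x - y) * u \<tau> y) \<partial>lborel)"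
proof -
  define s where "s n = t - (t - \<tau>) / real (Suc n)" for n
  have s: "\<tau> \<le> s n" "s n < t" for n
  proof -
    have "(t - \<tau>) / real (Suc n) \<le> (t - \<tau>) / 1"
      using \<tau> by (intro divide_left_mono) auto
    then show "\<tau> \<le> s n" by (simp add: s_def)
    show "s n < t" using \<tau> by (simp add: s_def)
  qed
  have slim: "s \<longlonglongrightarrow> t" unfolding s_def by real_asymp
  have sinc: "incseq s" unfolding s_def incseq_def
    using \<tau> by (auto intro!: divide_left_mono)
  let ?g = "\<lambda>s. (\<integral>\<^sup>+y. ennreal (heat_kernel (t - s) (x - y) * F s y) \<partial>lborel)"
  have "(\<lambda>n. (\<integral>\<^sup>+r. indicator {\<tau>..s n} r * ?g r \<partial>lborel)) \<longlonglongrightarrow> (\<integral>\<^sup>+r. indicator {\<tau>..<t} r * ?g r \<partial>lborel)"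
  proof (rule nn_integral_LIMSEQ)
    show "incseq (\<lambda>n r. indicator {\<tau>..s n} r * ?g r)"
      using incseqD[OF sinc] by (force simp: incseq_def le_fun_def indicator_def intro: order.trans)
    show "(\<lambda>r. indicator {\<tau>..s n} r * ?g r) \<in> borel_measurable lborel" for n
      by measurable
    fix r
    have "\<forall>\<^sub>F n in sequentially. indicator {\<tau>..s n} r * ?g r = indicator {\<tau>..<t} r * ?g r"
    proof (cases "r < t")
      case True
      then have "\<forall>\<^sub>F n in sequentially. s n > r"
        using slim by (rule order_tendstoD(1)[rotated])
      then show ?thesis by eventually_elim (use True in \<open>auto simp: indicator_def\<close>)
    next
      case False
      then have "\<not> r \<le> s n" for n using s(2)[of n] by simp
      then show ?thesis using False by (auto simp: indicator_def)
    qed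
    then show "(\<lambda>n. indicator {\<tau>..s n} r * ?g r) \<longlonglongrightarrow> indicator {\<tau>..<t} r * ?g r"
      by (rule tendsto_eventually)
  qed
  moreover have "(\<integral>\<^sup>+r. indicator {\<tau>..<t} r * ?g r \<partial>lborel) = absorbed 0 1 \<tau> t x"
    unfolding absorbed_def by (intro nn_integral_cong) (auto simp: indicator_def)
  ultimately have 1: "(\<lambda>n. (\<integral>\<^sup>+r. indicator {\<tau>..s n} r * ?g r \<partial>lborel)) \<longlonglongrightarrow> absorbed 0 1 \<tau> t x"
    by simp
  have "filterlim s (at_left t) sequentially"
    using slim s(2) by (intro filterlim_at_withinI) (auto simp: less_imp_neq intro!: always_eventually)
  from filterlim_compose[OF u_heat_limit this, of x] \<tau>
  have "(\<lambda>n. LINT y|lborel. heat_kernel (t - s n) (x - y) * u (s n) y) \<longlonglongrightarrow> u t x" by simp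
  then have "(\<lambda>n. ennreal (LINT y|lborel. heat_kernel (t - s n) (x - y) * u (s n) y)) \<longlonglongrightarrow> ennreal (u t x)"
    by (rule tendsto_ennrealI)
  from tendsto_add[OF this 1]
  have "(\<lambda>n. (\<integral>\<^sup>+y. ennreal (heat_kernel (t - \<tau>) (x - y) * u \<tau> y) \<partial>lborel)) \<longlonglongrightarrow> ennreal (u t x) + absorbed 0 1 \<tau> t x"
    unfolding nn_integral_green[OF \<tau>(1) s] .
  then show ?thesis
    using LIMSEQ_unique tendsto_const by blast
qed

text \<open>Down to the initial time only continuity of \<open>u\<close> at 0 is available. The
  source again converges monotonically, while the data term is dominated by a multiple of the kernel
  at time \<open>t\<close>.\<close>

lemma duhamel:
  assumes \<tau>: "0 \<le> \<tau>" "\<tau> < t"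
  shows "ennreal (u t x) + absorbed 0 1 \<tau> t x = (\<integral>\<^sup>+y. ennreal (heat_kernel (t - \<tau>) (x - y) * u \<tau> y) \<partial>lborel)"
proof (cases "\<tau> = 0")
  case False
  then show ?thesis using \<tau> by (intro duhamel_pos) auto
next
  case True
  have t: "t > 0" using \<tau> True by simp
  \<comment> \<open>The shift by 2 gives \<open>s n \<le> t / 2\<close>, so every
    \<open>t - s n\<close> stays in \<open>[t/2, t]\<close> and the kernels have a common
    majorant.\<close>
  define s where "s n = t / real (n + 2)" for n
  have s: "0 < s n" "s n \<le> t / 2" "s n < t" for n
  proof -
    show "0 < s n" using t by (simp add: s_def)
    show "s n \<le> t / 2" unfolding s_def using t by (intro divide_left_mono) auto
    then show "s n < t" using t by simp
  qed
  have slim: "s \<longlonglongrightarrow> 0" unfolding s_def by real_asymp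
  have sdec: "s m \<le> s n" if "n \<le> m" for m n unfolding s_def
    using that t by (auto intro!: divide_left_mono)
  let ?g = "\<lambda>s. (\<integral>\<^sup>+y. ennreal (heat_kernel (t - s) (x - y) * F s y) \<partial>lborel)"
  \<comment> \<open>At \<open>r = 0\<close> the indicators of \<open>{s n..<t}\<close> never become
    1; the default value of \<open>F\<close> there makes the limit correct at this point
    too.\<close>
  have g0: "?g 0 = 0" by (simp add: F_def)
  have ab: "absorbed 0 1 \<sigma> t x = (\<integral>\<^sup>+r. indicator {\<sigma>..<t} r * ?g r \<partial>lborel)" for \<sigma>
    unfolding absorbed_def by (intro nn_integral_cong) (auto simp: indicator_def)
  have 1: "(\<lambda>n. absorbed 0 1 (s n) t x) \<longlonglongrightarrow> absorbed 0 1 0 t x"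
    unfolding ab
  proof (rule nn_integral_LIMSEQ)
    show "incseq (\<lambda>n r. indicator {s n..<t} r * ?g r)"
      using sdec by (force simp: incseq_def le_fun_def indicator_def intro: order.trans)
    show "(\<lambda>r. indicator {s n..<t} r * ?g r) \<in> borel_measurable lborel" for n
      by measurable
    fix r
    have "\<forall>\<^sub>F n in sequentially. indicator {s n..<t} r * ?g r = indicator {0..<t} r * ?g r"
    proof (cases "r > 0")
      case True
      then have "\<forall>\<^sub>F n in sequentially. s n < r"
        using slim by (rule order_tendstoD(2)[rotated])
      then show ?thesis by eventually_elim (use True in \<open>auto simp: indicator_def\<close>)
    next
      case False
      then have "\<not> s n \<le> r" for n using s(1)[of n] by simp
      then show ?thesis using False g0 by (auto simp: indicator_def)
    qed
    then show "(\<lambda>n. indicator {s n..<t} r * ?g r) \<longlonglongrightarrow> indicator {0..<t} r * ?g r"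
      by (rule tendsto_eventually)
  qed
  define w where "w y = 2 powr (real DIM('a) / 2) * M * heat_kernel t (x - y)" for y
  have 2: "(\<lambda>n. \<integral>\<^sup>+y. ennreal (heat_kernel (t - s n) (x - y) * u (s n) y) \<partial>lborel) \<longlonglongrightarrow>
     (\<integral>\<^sup>+y. ennreal (heat_kernel t (x - y) * u 0 y) \<partial>lborel)"
  proof (rule nn_integral_dominated_convergence[where w = "\<lambda>y. ennreal (w y)"])
    show "(\<lambda>y. ennreal (heat_kernel (t - s n) (x - y) * u (s n) y)) \<in> borel_measurable lborel" for n
    proof -
      have [measurable]: "u (s n) \<in> borel_measurable borel" using s(1)[of n] by (intro u_slice_measurable) simp
      show ?thesis by measurable
    qed
    have [measurable]: "u 0 \<in> borel_measurable borel" by (intro u_slice_measurable) simp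
    show "(\<lambda>y. ennreal (heat_kernel t (x - y) * u 0 y)) \<in> borel_measurable lborel" by measurable
    show "(\<lambda>y. ennreal (w y)) \<in> borel_measurable lborel" unfolding w_def by measurable
    have "integrable lborel w" unfolding w_def using t by (intro integrable_mult_right integrable_heat_kernel)
    then show "(\<integral>\<^sup>+y. ennreal (w y) \<partial>lborel) < \<infinity>"
      using M_nonneg by (subst nn_integral_eq_integral) (auto simp: w_def)
    show "AE y in lborel. ennreal (heat_kernel (t - s n) (x - y) * u (s n) y) \<le> ennreal (w y)" for n
    proof (intro AE_I2 ennreal_leI)
      fix y
      have "heat_kernel (t - s n) (x - y) \<le> (t / (t / 2)) powr (real DIM('a) / 2) * heat_kernel t (x - y)"
        using s[of n] t by (intro heat_kernel_time_mono) auto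
      then have "heat_kernel (t - s n) (x - y) * u (s n) y \<le> (2 powr (real DIM('a) / 2) * heat_kernel t (x - y)) * M"
        using u_nonneg[of "s n" y] u_le_M[of "s n" y] s[of n] t by (intro mult_mono) auto
      then show "heat_kernel (t - s n) (x - y) * u (s n) y \<le> w y" by (simp add: w_def mult_ac)
    qed
    show "AE y in lborel. (\<lambda>n. ennreal (heat_kernel (t - s n) (x - y) * u (s n) y)) \<longlonglongrightarrow> ennreal (heat_kernel t (x - y) * u 0 y)"
    proof (intro AE_I2 tendsto_ennrealI tendsto_mult)
      fix y
      have "continuous_on {..<t} (\<lambda>r. heat_kernel (t - r) (x - y))" by (intro continuous_intros) auto
      then have "((\<lambda>r. heat_kernel (t - r) (x - y)) \<longlongrightarrow> heat_kernel (t - 0) (x - y)) (at 0 within {..<t})"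
        using t unfolding continuous_on_def by blast
      moreover have "filterlim s (at 0 within {..<t}) sequentially"
        using slim s by (intro filterlim_at_withinI) (auto simp: less_imp_neq[symmetric] intro!: always_eventually)
      ultimately show "(\<lambda>n. heat_kernel (t - s n) (x - y)) \<longlonglongrightarrow> heat_kernel t (x - y)"
        using filterlim_compose by fastforce
      have "continuous_on {0..} (\<lambda>r. u r y)" by (intro u_continuous_at continuous_intros) auto
      then have "((\<lambda>r. u r y) \<longlongrightarrow> u 0 y) (at 0 within {0..})"
        unfolding continuous_on_def by simp
      moreover have "filterlim s (at 0 within {0..}) sequentially"
        using slim s by (intro filterlim_at_withinI) (auto simp: less_imp_neq[symmetric] less_imp_le intro!: always_eventually)
      ultimately show "(\<lambda>n. u (s n) y) \<longlonglongrightarrow> u 0 y"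
        using filterlim_compose by fastforce
    qed
  qed
  have "(\<lambda>n. ennreal (u t x) + absorbed 0 1 (s n) t x) \<longlonglongrightarrow> ennreal (u t x) + absorbed 0 1 0 t x"
    by (intro tendsto_add tendsto_const 1)
  moreover have "(\<lambda>n. ennreal (u t x) + absorbed 0 1 (s n) t x) \<longlonglongrightarrow> (\<integral>\<^sup>+y. ennreal (heat_kernel t (x - y) * u 0 y) \<partial>lborel)"
    using 2 unfolding duhamel_pos[OF s(1) s(3)] .
  ultimately show ?thesis
    using True LIMSEQ_unique by fastforce
qed

text \<open>The heat flow of the bounded \<open>u T\<close> is finite, hence so is the absorbed
  part, and the sum in Duhamel's formula may be turned into a difference of reals.\<close>

lemma duhamel_abs:
  assumes T: "0 \<le> T" "T < t"
  shows "absorbed 0 1 T t x = ennreal \<bar>u t x - (LINT y|lborel. heat_kernel (t - T) (x - y) * u T y)\<bar>"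
    (is "_ = ennreal \<bar>_ - ?A\<bar>")
proof -
  have A0: "0 \<le> ?A" using u_nonneg[OF T(1)] by (intro integral_nonneg_AE) auto
  have u0: "0 \<le> u t x" using T by (intro u_nonneg) simp
  have eq: "ennreal (u t x) + absorbed 0 1 T t x = ennreal ?A"
    unfolding duhamel[OF T] using T by (intro nn_integral_heat_u) auto
  then have fin: "absorbed 0 1 T t x < top" by (metis ennreal_add_eq_top ennreal_less_top less_top)
  then obtain a where a: "absorbed 0 1 T t x = ennreal a" "a \<ge> 0" by (cases "absorbed 0 1 T t x") auto
  then show ?thesis using eq u0 A0 by (simp flip: ennreal_plus)
qed

lemma integrable_heat_dir_u:
  assumes s: "s > 0" and \<sigma>: "\<sigma> > 0" and e: "norm e \<le> 1"
  shows "integrable lborel (\<lambda>y. heat_dir e \<sigma> (x - y) * u s y)"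
proof (rule Bochner_Integration.integrable_bound)
  have [measurable]: "u s \<in> borel_measurable borel" using s by (intro u_slice_measurable) simp
  show "integrable lborel (\<lambda>y. M * (2 powr (real DIM('a) / 2) * \<sigma> powr (-1/2) * heat_kernel (2 * \<sigma>) (x - y)))"
    using \<sigma> by (intro integrable_mult_right integrable_heat_kernel) simp
  show "(\<lambda>y. heat_dir e \<sigma> (x - y) * u s y) \<in> borel_measurable lborel" by measurable
  show "AE y in lborel. norm (heat_dir e \<sigma> (x - y) * u s y) \<le> norm (M * (2 powr (real DIM('a) / 2) * \<sigma> powr (-1/2) * heat_kernel (2 * \<sigma>) (x - y)))"
  proof (rule AE_I2)
    fix y
    have "\<bar>heat_dir e \<sigma> (x - y)\<bar> * \<bar>u s y\<bar> \<le> (2 powr (real DIM('a) / 2) * \<sigma> powr (-1/2) * heat_kernel (2 * \<sigma>) (x - y)) * M"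
      by (intro mult_mono heat_dir_bound \<sigma> e u_bound[OF s]) auto
    then show "norm (heat_dir e \<sigma> (x - y) * u s y) \<le> norm (M * (2 powr (real DIM('a) / 2) * \<sigma> powr (-1/2) * heat_kernel (2 * \<sigma>) (x - y)))"
      using M_nonneg by (simp add: abs_mult mult_ac)
  qed
qed

text \<open>Integration by parts moves the derivative from the kernel to \<open>u\<close>. The
  directional kernel is no approximate identity, whereas the right side converges to
  \<open>\<nabla>u \<bullet> e\<close> as \<open>\<sigma>\<close> tends to 0.\<close>

lemma integral_heat_dir_u:
  assumes s: "s > 0" and \<sigma>: "\<sigma> > 0" and e: "norm e \<le> 1"
  shows "(LINT y|lborel. heat_dir e \<sigma> (x - y) * u s y) = (LINT y|lborel. heat_kernel \<sigma> (x - y) * u1 e s y)"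
proof -
  have [measurable]: "u s \<in> borel_measurable borel" using s by (intro u_slice_measurable) simp
  have cu1: "continuous_on UNIV (u1 e s)"
    unfolding u1_def using s by (intro continuous_intros gradient_slice_continuous)
  have [measurable]: "u1 e s \<in> borel_measurable borel" by (rule borel_measurable_continuous_onI[OF cu1])
  have ub: "\<bar>u s y\<bar> \<le> M" for y using u_bound[OF s] .
  have u1b: "\<bar>u1 e s y\<bar> \<le> M" for y
  proof -
    have "\<bar>u1 e s y\<bar> \<le> norm (gradient (u s) y) * norm e" unfolding u1_def by (rule Cauchy_Schwarz_ineq2)
    also have "\<dots> \<le> M * 1" using gradient_bound[OF s] e M_nonneg by (intro mult_mono) auto
    finally show ?thesis by simp
  qed
  let ?F' = "\<lambda>y. - (heat_dir e \<sigma> (x - y) * u s y) + heat_kernel \<sigma> (x - y) * u1 e s y"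
  note i1 = integrable_heat_dir_u[OF assms, of x]
  have i2: "integrable lborel (\<lambda>y. heat_kernel \<sigma> (x - y) * u1 e s y)"
    using \<sigma> u1b by (intro integrable_heat_kernel_mult) auto
  have "(LINT y|lborel. ?F' y) = 0"
  proof (rule integral_directional_derivative_eq_0[where F = "\<lambda>y. heat_kernel \<sigma> (x - y) * u s y" and e = e])
    show "integrable lborel (\<lambda>y. heat_kernel \<sigma> (x - y) * u s y)"
      using \<sigma> ub by (intro integrable_heat_kernel_mult) auto
    show "integrable lborel ?F'" using i1 i2 by simp
    show "continuous_on UNIV ?F'"
      using \<sigma> s by (intro continuous_intros cu1 u_continuous_at) auto
    show "((\<lambda>h. heat_kernel \<sigma> (x - (y + h *\<^sub>R e)) * u s (y + h *\<^sub>R e)) has_real_derivative ?F' y) (at 0)" for y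
      by (rule DERIV_cong[OF DERIV_mult[OF heat_kernel_DERIV_shift[OF \<sigma>] u1_DERIV[OF s]]])
        (simp add: heat_dir_def)
  qed
  then show ?thesis using i1 i2 by simp
qed

text \<open>Green's identity with \<open>heat_dir\<close> on \<open>[\<tau>, s]\<close> is estimated
  by a quantity independent of \<open>s\<close>, and the left side passes to the limit as
  \<open>s\<close> increases to \<open>t\<close>. Only an inequality is kept, since the directional
  kernel has no sign.\<close>

lemma duhamel_gradient:
  assumes \<tau>: "0 < \<tau>" "\<tau> < t" and e: "norm e \<le> 1"
  shows "ennreal \<bar>gradient (u t) x \<bullet> e - (LINT y|lborel. heat_dir e (t - \<tau>) (x - y) * u \<tau> y)\<bar>
    \<le> ennreal (2 powr (real DIM('a) / 2)) * absorbed (1/2) 2 \<tau> t x"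
proof -
  let ?P = "lborel \<Otimes>\<^sub>M lborel :: (real \<times> 'a) measure"
  define c where "c = 2 powr (real DIM('a) / 2)"
  let ?\<Phi> = "\<lambda>s. LINT y|lborel. heat_kernel (t - s) (x - y) * u1 e s y"
  have bound: "ennreal \<bar>?\<Phi> s - (LINT y|lborel. heat_dir e (t - \<tau>) (x - y) * u \<tau> y)\<bar> \<le> ennreal c * absorbed (1/2) 2 \<tau> t x"
    if s: "\<tau> \<le> s" "s < t" for s
  proof -
    let ?f = "\<lambda>p. indicator {\<tau>..s} (fst p) * (heat_dir e (t - fst p) (x - snd p) * F (fst p) (snd p))"
    have "?\<Phi> s = (LINT y|lborel. heat_dir e (t - s) (x - y) * u s y)"
      using \<tau> s e by (intro integral_heat_dir_u[symmetric]) auto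
    then have "\<bar>?\<Phi> s - (LINT y|lborel. heat_dir e (t - \<tau>) (x - y) * u \<tau> y)\<bar> = \<bar>LINT p|?P. ?f p\<bar>"
      using green_heat_dir(2)[OF \<tau>(1) s e, of x] by simp
    also have "ennreal \<dots> \<le> (\<integral>\<^sup>+p. ennreal (norm (?f p)) \<partial>?P)"
      using integral_norm_bound_ennreal[OF green_heat_dir(1)[OF \<tau>(1) s e, of x]] by simp
    also have "\<dots> = (\<integral>\<^sup>+s'. (\<integral>\<^sup>+y. ennreal (norm (?f (s', y))) \<partial>lborel) \<partial>lborel)"
      by (rule lborel.nn_integral_fst[symmetric]) measurable
    also have "\<dots> \<le> (\<integral>\<^sup>+s'. ennreal c * (indicator {\<tau>..<t} s' * ennreal ((t - s') powr (- (1/2))) *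
       (\<integral>\<^sup>+y. ennreal (heat_kernel (2 * (t - s')) (x - y) * F s' y) \<partial>lborel)) \<partial>lborel)"
    proof (rule nn_integral_mono)
      fix s' :: real
      show "(\<integral>\<^sup>+y. ennreal (norm (?f (s', y))) \<partial>lborel) \<le> ennreal c * (indicator {\<tau>..<t} s' * ennreal ((t - s') powr (- (1/2))) *
       (\<integral>\<^sup>+y. ennreal (heat_kernel (2 * (t - s')) (x - y) * F s' y) \<partial>lborel))"
      proof (cases "s' \<in> {\<tau>..s}")
        case True
        have "(\<integral>\<^sup>+y. ennreal (norm (?f (s', y))) \<partial>lborel) \<le>
          (\<integral>\<^sup>+y. ennreal (c * (t - s') powr (- (1/2))) * ennreal (heat_kernel (2 * (t - s')) (x - y) * F s' y) \<partial>lborel)"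
        proof (rule nn_integral_mono)
          fix y
          have "\<bar>heat_dir e (t - s') (x - y)\<bar> * F s' y \<le> (c * (t - s') powr (-1/2) * heat_kernel (2 * (t - s')) (x - y)) * F s' y"
            unfolding c_def using True s e by (intro mult_right_mono heat_dir_bound) auto
          then show "ennreal (norm (?f (s', y))) \<le> ennreal (c * (t - s') powr (- (1/2))) * ennreal (heat_kernel (2 * (t - s')) (x - y) * F s' y)"
            using True by (auto simp: abs_mult c_def mult.assoc simp flip: ennreal_mult intro!: ennreal_leI)
        qed
        also have "\<dots> = ennreal (c * (t - s') powr (- (1/2))) * (\<integral>\<^sup>+y. ennreal (heat_kernel (2 * (t - s')) (x - y) * F s' y) \<partial>lborel)"
          by (rule nn_integral_cmult) measurable
        finally show ?thesis using True s by (simp add: ennreal_mult c_def mult.assoc)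
      next
        case False
        then have "indicator {\<tau>..s} s' = (0::real)" by (simp add: indicator_def)
        then show ?thesis by simp
      qed
    qed
    also have "\<dots> = ennreal c * absorbed (1/2) 2 \<tau> t x"
      unfolding absorbed_def by (rule nn_integral_cmult) measurable
    finally show ?thesis .
  qed
  have t: "t > 0" using \<tau> by simp
  have "(?\<Phi> \<longlongrightarrow> u1 e t x) (at_left t)"
  proof (rule heat_approx_identity[OF t, where C = M])
    show "\<bar>u1 e s y\<bar> \<le> M" if "s > 0" for s y
    proof -
      have "\<bar>u1 e s y\<bar> \<le> norm (gradient (u s) y) * norm e" unfolding u1_def by (rule Cauchy_Schwarz_ineq2)
      also have "\<dots> \<le> M * 1" using gradient_bound[OF that] e M_nonneg by (intro mult_mono) auto
      finally show ?thesis by simp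
    qed
    show "continuous_on ({0<..} \<times> UNIV) (\<lambda>(s, y). u1 e s y)"
      using gradient_continuous_on unfolding u1_def case_prod_beta' by (intro continuous_intros)
  qed
  then have "((\<lambda>s. ennreal \<bar>?\<Phi> s - (LINT y|lborel. heat_dir e (t - \<tau>) (x - y) * u \<tau> y)\<bar>) \<longlongrightarrow>
      ennreal \<bar>u1 e t x - (LINT y|lborel. heat_dir e (t - \<tau>) (x - y) * u \<tau> y)\<bar>) (at_left t)"
    by (intro tendsto_ennrealI tendsto_intros)
  moreover have "\<forall>\<^sub>F s in at_left t. ennreal \<bar>?\<Phi> s - (LINT y|lborel. heat_dir e (t - \<tau>) (x - y) * u \<tau> y)\<bar> \<le> ennreal c * absorbed (1/2) 2 \<tau> t x"
    using eventually_at_left_real[OF \<tau>(2)] by eventually_elim (use bound in auto)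
  ultimately show ?thesis
    unfolding u1_def c_def by (rule tendsto_upperbound) simp
qed

end

section \<open>Mass balance\<close>

lemma nn_integral_heat_flow:
  fixes f :: "'a::euclidean_space \<Rightarrow> ennreal"
  assumes [measurable]: "f \<in> borel_measurable borel" and \<sigma>: "\<sigma> > 0"
  shows "(\<integral>\<^sup>+x. (\<integral>\<^sup>+y. ennreal (heat_kernel \<sigma> (x - y)) * f y \<partial>lborel) \<partial>lborel) = (\<integral>\<^sup>+y. f y \<partial>lborel)"
proof -
  have "(\<integral>\<^sup>+x. (\<integral>\<^sup>+y. ennreal (heat_kernel \<sigma> (x - y)) * f y \<partial>lborel) \<partial>lborel) =
     (\<integral>\<^sup>+y. (\<integral>\<^sup>+x. ennreal (heat_kernel \<sigma> (x - y)) * f y \<partial>lborel) \<partial>lborel)"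
    by (rule lborel_pair.Fubini') measurable
  also have "\<dots> = (\<integral>\<^sup>+y. f y \<partial>lborel)"
    using \<sigma> by (intro nn_integral_cong) (simp add: nn_integral_multc nn_integral_heat_kernel')
  finally show ?thesis .
qed

context viscous_HJ
begin

definition source :: "real \<Rightarrow> ennreal" where
  "source s = (\<integral>\<^sup>+y. ennreal (F s y) \<partial>lborel)"

lemma source_measurable [measurable]: "source \<in> borel_measurable borel"
  unfolding source_def by measurable

lemma source_nonpos: "s \<le> 0 \<Longrightarrow> source s = 0"
  by (simp add: source_def F_def)

text \<open>The mass that absorption removes after time \<open>T\<close>.\<close>

definition tail :: "real \<Rightarrow> ennreal" where
  "tail T = (\<integral>\<^sup>+s. indicator {T..} s * source s \<partial>lborel)"

text \<open>The kernel has unit mass in \<open>x\<close>, so by Tonelli it disappears and only the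
  time weight remains.\<close>

lemma absorbed_L1:
  assumes k: "k > 0"
  shows "(\<integral>\<^sup>+x. absorbed \<kappa> k \<tau> t x \<partial>lborel) = (\<integral>\<^sup>+s. indicator {\<tau>..<t} s * ennreal ((t - s) powr (- \<kappa>)) * source s \<partial>lborel)"
proof -
  have "(\<integral>\<^sup>+x. absorbed \<kappa> k \<tau> t x \<partial>lborel) =
     (\<integral>\<^sup>+s. (\<integral>\<^sup>+x. indicator {\<tau>..<t} s * ennreal ((t - s) powr (- \<kappa>)) *
       (\<integral>\<^sup>+y. ennreal (heat_kernel (k * (t - s)) (x - y) * F s y) \<partial>lborel) \<partial>lborel) \<partial>lborel)"
    unfolding absorbed_def by (rule lborel_pair.Fubini') measurable
  also have "\<dots> = (\<integral>\<^sup>+s. indicator {\<tau>..<t} s * ennreal ((t - s) powr (- \<kappa>)) * source s \<partial>lborel)"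
  proof (rule nn_integral_cong)
    fix s
    show "(\<integral>\<^sup>+x. indicator {\<tau>..<t} s * ennreal ((t - s) powr (- \<kappa>)) *
       (\<integral>\<^sup>+y. ennreal (heat_kernel (k * (t - s)) (x - y) * F s y) \<partial>lborel) \<partial>lborel) =
       indicator {\<tau>..<t} s * ennreal ((t - s) powr (- \<kappa>)) * source s"
    proof (cases "s < t")
      case True
      then have "(\<integral>\<^sup>+x. (\<integral>\<^sup>+y. ennreal (heat_kernel (k * (t - s)) (x - y) * F s y) \<partial>lborel) \<partial>lborel) = source s"
        using nn_integral_heat_flow[of "\<lambda>y. ennreal (F s y)" "k * (t - s)"] k
        by (simp add: source_def ennreal_mult)
      then show ?thesis by (subst nn_integral_cmult) (auto simp del: ennreal_mult)
    qed simp
  qed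
  finally show ?thesis .
qed

text \<open>Duhamel's formula integrated over space: the heat flow preserves mass, and the absorbed
  part integrates to the source. Everything is in \<open>ennreal\<close>, so finiteness can be
  concluded from this identity.\<close>

lemma mass_balance:
  assumes \<tau>: "0 \<le> \<tau>" "\<tau> < t"
  shows "(\<integral>\<^sup>+x. ennreal (u t x) \<partial>lborel) + (\<integral>\<^sup>+s. indicator {\<tau>..<t} s * source s \<partial>lborel) = (\<integral>\<^sup>+x. ennreal (u \<tau> x) \<partial>lborel)"
proof -
  have [measurable]: "u t \<in> borel_measurable borel" "u \<tau> \<in> borel_measurable borel" using \<tau> by auto
  have "(\<integral>\<^sup>+x. ennreal (u \<tau> x) \<partial>lborel) = (\<integral>\<^sup>+x. (\<integral>\<^sup>+y. ennreal (heat_kernel (t - \<tau>) (x - y)) * ennreal (u \<tau> y) \<partial>lborel) \<partial>lborel)"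
    using \<tau> by (intro nn_integral_heat_flow[symmetric]) auto
  also have "\<dots> = (\<integral>\<^sup>+x. ennreal (u t x) + absorbed 0 1 \<tau> t x \<partial>lborel)"
    unfolding duhamel[OF \<tau>] using u_nonneg[OF \<tau>(1)] by (simp add: ennreal_mult)
  also have "\<dots> = (\<integral>\<^sup>+x. ennreal (u t x) \<partial>lborel) + (\<integral>\<^sup>+x. absorbed 0 1 \<tau> t x \<partial>lborel)"
    by (rule nn_integral_add) measurable
  also have "(\<integral>\<^sup>+x. absorbed 0 1 \<tau> t x \<partial>lborel) = (\<integral>\<^sup>+s. indicator {\<tau>..<t} s * source s \<partial>lborel)"
    unfolding absorbed_L1[OF zero_less_one] by (intro nn_integral_cong) (auto simp: indicator_def)
  finally show ?thesis by simp
qed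

definition mass :: "real \<Rightarrow> real" where
  "mass t = (LINT x|lborel. u t x)"

lemma mass_0: "(\<integral>\<^sup>+x. ennreal (u 0 x) \<partial>lborel) = ennreal (mass 0)"
  unfolding mass_def using initial_integrable initial_nonneg by (intro nn_integral_eq_integral) auto

lemma nn_integral_u_le:
  assumes "t \<ge> 0"
  shows "(\<integral>\<^sup>+x. ennreal (u t x) \<partial>lborel) \<le> ennreal (mass 0)"
proof (cases "t = 0")
  case False
  then have t: "0 < t" using assms by simp
  have "(\<integral>\<^sup>+x. ennreal (u t x) \<partial>lborel) \<le> (\<integral>\<^sup>+x. ennreal (u t x) \<partial>lborel) + (\<integral>\<^sup>+s. indicator {0..<t} s * source s \<partial>lborel)"
    by simp
  also have "\<dots> = ennreal (mass 0)"
    using mass_balance[OF order.refl t] mass_0 by simp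
  finally show ?thesis .
qed (simp add: mass_0)

lemma integrable_u:
  assumes "t \<ge> 0"
  shows "integrable lborel (u t)"
proof (rule integrableI_nonneg)
  show "u t \<in> borel_measurable lborel" using assms by simp
  show "(\<integral>\<^sup>+x. ennreal (u t x) \<partial>lborel) < \<infinity>"
    using nn_integral_u_le[OF assms] by (rule order.strict_trans1) simp
qed (use u_nonneg[OF assms] in auto)

lemma nn_integral_u: "t \<ge> 0 \<Longrightarrow> (\<integral>\<^sup>+x. ennreal (u t x) \<partial>lborel) = ennreal (mass t)"
  unfolding mass_def using integrable_u u_nonneg by (intro nn_integral_eq_integral) auto

lemma mass_nonneg: "t \<ge> 0 \<Longrightarrow> 0 \<le> mass t"
  unfolding mass_def using u_nonneg by (intro integral_nonneg_AE) auto

lemma tail_0_le: "tail 0 \<le> ennreal (mass 0)"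
proof (rule LIMSEQ_le_const2)
  show "(\<lambda>n. \<integral>\<^sup>+s. indicator {0..<real n} s * source s \<partial>lborel) \<longlonglongrightarrow> tail 0"
    unfolding tail_def
  proof (rule nn_integral_LIMSEQ)
    show "incseq (\<lambda>n s. indicator {0..<real n} s * source s)"
      by (auto simp: incseq_def le_fun_def indicator_def)
    fix s :: real
    obtain N where "s < real N" using reals_Archimedean2 by blast
    then have "\<forall>\<^sub>F n in sequentially. indicator {0..<real n} s * source s = indicator {0..} s * source s"
      by (intro eventually_sequentiallyI[of N]) (auto simp: indicator_def)
    then show "(\<lambda>n. indicator {0..<real n} s * source s) \<longlonglongrightarrow> indicator {0..} s * source s"
      by (rule tendsto_eventually)
  qed measurable
  show "\<exists>N. \<forall>n\<ge>N. (\<integral>\<^sup>+s. indicator {0..<real n} s * source s \<partial>lborel) \<le> ennreal (mass 0)"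
  proof (intro exI[of _ 1] allI impI)
    fix n :: nat assume n: "n \<ge> 1"
    have "(\<integral>\<^sup>+s. indicator {0..<real n} s * source s \<partial>lborel) \<le>
       (\<integral>\<^sup>+x. ennreal (u (real n) x) \<partial>lborel) + (\<integral>\<^sup>+s. indicator {0..<real n} s * source s \<partial>lborel)"
      by (simp add: add_increasing)
    then show "(\<integral>\<^sup>+s. indicator {0..<real n} s * source s \<partial>lborel) \<le> ennreal (mass 0)"
      using mass_balance[of 0 "real n"] mass_0 n by simp
  qed
qed

text \<open>Defined through the balance of mass, not as a limit, so that estimates by
  \<open>tail\<close> are available at once; \<open>mass_tendsto\<close> identifies it with the
  limit.\<close>

definition limit_mass :: real where
  "limit_mass = mass 0 - enn2real (tail 0)"

lemma mass_eq:
  assumes T: "T \<ge> 0"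
  shows "ennreal (mass T) = ennreal limit_mass + tail T" "limit_mass \<le> mass T"
proof -
  let ?g = "\<integral>\<^sup>+s. indicator {0..<T} s * source s \<partial>lborel"
  have "tail 0 = (\<integral>\<^sup>+s. indicator {0..<T} s * source s + indicator {T..} s * source s \<partial>lborel)"
    unfolding tail_def using T by (intro nn_integral_cong) (auto simp: indicator_def)
  also have "\<dots> = ?g + tail T"
    unfolding tail_def by (rule nn_integral_add) measurable
  finally have 1: "tail 0 = ?g + tail T" .
  have fin: "tail 0 < top" using tail_0_le by (rule order.strict_trans1) simp
  then have fg: "?g < top" "tail T < top" unfolding 1 by auto
  have 2: "ennreal (mass T) + ?g = ennreal (mass 0)"
  proof (cases "T = 0")
    case True
    have "?g = (\<integral>\<^sup>+(s::real). 0 \<partial>lborel)" using True by (intro nn_integral_cong) auto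
    then show ?thesis using True by simp
  next
    case False
    then show ?thesis using mass_balance[of 0 T] T nn_integral_u[OF T] mass_0 by simp
  qed
  obtain g where g: "?g = ennreal g" "g \<ge> 0" using fg by (cases ?g) auto
  obtain r where r: "tail T = ennreal r" "r \<ge> 0" using fg by (cases "tail T") auto
  have 3: "enn2real (tail 0) = g + r" unfolding 1 g(1) r(1) using g(2) r(2) by (simp flip: ennreal_plus)
  have 4: "mass T + g = mass 0"
    using 2 mass_nonneg[OF T] mass_nonneg[of 0] g by (simp flip: ennreal_plus)
  have "limit_mass = mass T - r" unfolding limit_mass_def 3 using 4 by simp
  moreover have "limit_mass \<ge> 0"
    using tail_0_le unfolding limit_mass_def 1 g(1) r(1) using g(2) r(2) mass_nonneg[of 0]
    by (simp flip: ennreal_plus)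
  ultimately show "ennreal (mass T) = ennreal limit_mass + tail T" "limit_mass \<le> mass T"
    unfolding r(1) using r(2) by (auto simp flip: ennreal_plus)
qed

lemma limit_mass_nonneg: "0 \<le> limit_mass"
proof -
  have "enn2real (tail 0) \<le> enn2real (ennreal (mass 0))"
    using tail_0_le by (intro enn2real_mono) auto
  then show ?thesis using mass_nonneg[of 0] by (simp add: limit_mass_def)
qed

lemma tail_eq: "T \<ge> 0 \<Longrightarrow> tail T = ennreal (mass T - limit_mass)"
proof -
  assume T: "T \<ge> 0"
  have "ennreal limit_mass + ennreal (mass T - limit_mass) = ennreal limit_mass + tail T"
    using mass_eq[OF T] limit_mass_nonneg by (simp flip: ennreal_plus)
  then show ?thesis by (simp add: ennreal_add_left_cancel)
qed

lemma tail_tendsto_0: "(tail \<longlongrightarrow> 0) at_top"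
proof (rule tendsto_at_topI_sequentially)
  fix X :: "nat \<Rightarrow> real" assume X: "filterlim X at_top sequentially"
  have "(\<lambda>n. \<integral>\<^sup>+s. indicator {X n..} s * source s \<partial>lborel) \<longlonglongrightarrow> (\<integral>\<^sup>+(s::real). 0 \<partial>lborel)"
  proof (rule nn_integral_dominated_convergence[where w = "\<lambda>s. indicator {0..} s * source s"])
    show "(\<integral>\<^sup>+s. indicator {0..} s * source s \<partial>lborel) < \<infinity>"
      using tail_0_le unfolding tail_def by (rule order.strict_trans1) simp
    show "AE s in lborel. indicator {X n..} s * source s \<le> indicator {0..} s * source s" for n
      by (intro AE_I2) (auto simp: indicator_def source_nonpos not_le)
    show "AE s in lborel. (\<lambda>n. indicator {X n..} s * source s) \<longlonglongrightarrow> 0"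
    proof (intro AE_I2 tendsto_eventually)
      fix s
      have "\<forall>\<^sub>F n in sequentially. X n > s" using X by (simp add: filterlim_at_top_dense)
      then show "\<forall>\<^sub>F n in sequentially. indicator {X n..} s * source s = 0"
        by eventually_elim (auto simp: indicator_def)
    qed
  qed measurable
  then show "(\<lambda>n. tail (X n)) \<longlonglongrightarrow> 0" by (simp add: tail_def)
qed

lemma mass_tendsto: "(mass \<longlongrightarrow> limit_mass) at_top"
proof -
  have "\<forall>\<^sub>F T in at_top. ennreal (mass T - limit_mass) = tail T"
    using eventually_ge_at_top[of 0] by eventually_elim (simp add: tail_eq)
  then have "((\<lambda>T. ennreal (mass T - limit_mass)) \<longlongrightarrow> ennreal 0) at_top"
    using tail_tendsto_0 by (simp add: tendsto_cong)
  then have "((\<lambda>T. mass T - limit_mass) \<longlongrightarrow> 0) at_top"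
  proof (rule tendsto_ennrealD)
    show "\<forall>\<^sub>F T in at_top. 0 \<le> mass T - limit_mass"
      using eventually_ge_at_top[of 0] by eventually_elim (simp add: mass_eq(2))
  qed simp
  then show ?thesis by (simp add: LIM_zero_iff)
qed

section \<open>Convergence in \<open>L\<^sup>1\<close>\<close>

definition L1_dist :: "real \<Rightarrow> ennreal" where
  "L1_dist t = (\<integral>\<^sup>+x. ennreal \<bar>u t x - limit_mass * heat_kernel t x\<bar> \<partial>lborel)"

text \<open>Dominated convergence in the source point \<open>y\<close>: for each \<open>y\<close>
  the two kernels merge in \<open>L^1\<close>, and their distance never exceeds 2, so
  \<open>2 * u T\<close> is a majorant.\<close>

lemma heat_flow_L1_tendsto:
  assumes T: "T \<ge> 0"
  shows "((\<lambda>t. \<integral>\<^sup>+y. ennreal (u T y) * (\<integral>\<^sup>+x. ennreal \<bar>heat_kernel (t - T) (x - y) - heat_kernel t x\<bar> \<partial>lborel) \<partial>lborel) \<longlongrightarrow> 0) at_top"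
proof (rule tendsto_at_topI_sequentially)
  have [measurable]: "u T \<in> borel_measurable borel" using T by simp
  let ?D = "\<lambda>t y. \<integral>\<^sup>+x. ennreal \<bar>heat_kernel (t - T) (x - y) - heat_kernel t x\<bar> \<partial>lborel"
  have D2: "?D t y \<le> 2" if "t > T" for t and y :: 'a
  proof -
    have t: "t - T > 0" "t > 0" using that T by auto
    have "?D t y \<le> (\<integral>\<^sup>+x. ennreal (heat_kernel (t - T) (x - y)) + ennreal (heat_kernel t x) \<partial>lborel)"
      by (intro nn_integral_mono) (auto simp flip: ennreal_plus intro!: ennreal_leI order.trans[OF abs_triangle_ineq4])
    also have "\<dots> = 2"
      using nn_integral_heat_kernel'[OF t(1), of y] nn_integral_heat_kernel_0[OF t(2), where 'a='a]
      by (subst nn_integral_add) auto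
    finally show ?thesis .
  qed
  fix X :: "nat \<Rightarrow> real" assume X: "filterlim X at_top sequentially"
  \<comment> \<open>The majorant is valid for times beyond \<open>T\<close> only; the sequence is
    changed at finitely many places.\<close>
  define X' where "X' n = max (X n) (T + 1)" for n
  have X': "filterlim X' at_top sequentially" "X' n > T" for n
    using filterlim_at_top_mono[OF X, of X'] by (auto simp: X'_def[abs_def])
  have "(\<lambda>n. \<integral>\<^sup>+y. ennreal (u T y) * ?D (X' n) y \<partial>lborel) \<longlonglongrightarrow> (\<integral>\<^sup>+(y::'a). 0 \<partial>lborel)"
  proof (rule nn_integral_dominated_convergence[where w = "\<lambda>y. ennreal (u T y) * 2"])
    show "(\<integral>\<^sup>+y. ennreal (u T y) * 2 \<partial>lborel) < \<infinity>"
      using nn_integral_u[OF T] by (simp add: nn_integral_multc ennreal_mult_less_top)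
    show "AE y in lborel. ennreal (u T y) * ?D (X' n) y \<le> ennreal (u T y) * 2" for n
      by (intro AE_I2 mult_left_mono D2 X') auto
    show "AE y in lborel. (\<lambda>n. ennreal (u T y) * ?D (X' n) y) \<longlonglongrightarrow> 0"
    proof (rule AE_I2)
      fix y :: 'a
      have "(\<lambda>n. ?D (X' n) y) \<longlonglongrightarrow> 0"
        by (rule filterlim_compose[OF heat_kernel_shift_L1_tendsto X'(1)])
      from ennreal_tendsto_cmult[OF _ this, of "ennreal (u T y)"]
      show "(\<lambda>n. ennreal (u T y) * ?D (X' n) y) \<longlonglongrightarrow> 0" by simp
    qed
  qed measurable
  moreover have "\<forall>\<^sub>F n in sequentially. X n > T + 1"
    using X by (simp add: filterlim_at_top_dense)
  then have "\<forall>\<^sub>F n in sequentially. (\<integral>\<^sup>+y. ennreal (u T y) * ?D (X' n) y \<partial>lborel) = (\<integral>\<^sup>+y. ennreal (u T y) * ?D (X n) y \<partial>lborel)"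
    by eventually_elim (simp add: X'_def)
  ultimately show "(\<lambda>n. \<integral>\<^sup>+y. ennreal (u T y) * ?D (X n) y \<partial>lborel) \<longlonglongrightarrow> 0"
    by (simp add: tendsto_cong)
qed

text \<open>Triangle inequality through the heat flow of \<open>u T\<close> and the kernel of mass
  \<open>mass T\<close>. The absorption after \<open>T\<close> and the replacement of
  \<open>mass T\<close> by \<open>limit_mass\<close> cost \<open>tail T\<close> each; the rest is
  the merging of kernels.\<close>

lemma L1_dist_le:
  assumes T: "0 \<le> T" "T < t"
  shows "L1_dist t \<le> (\<integral>\<^sup>+y. ennreal (u T y) * (\<integral>\<^sup>+x. ennreal \<bar>heat_kernel (t - T) (x - y) - heat_kernel t x\<bar> \<partial>lborel) \<partial>lborel)
    + 2 * tail T"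
proof -
  have [measurable]: "u T \<in> borel_measurable borel" using T by simp
  define A where "A x = (LINT y|lborel. heat_kernel (t - T) (x - y) * u T y)" for x
  have tT: "t - T > 0" "t > 0" using T by auto
  have A: "absorbed 0 1 T t x = ennreal \<bar>u t x - A x\<bar>" for x
    unfolding A_def by (rule duhamel_abs[OF T])
  have B: "ennreal \<bar>A x - mass T * heat_kernel t x\<bar> \<le> (\<integral>\<^sup>+y. ennreal (u T y) * ennreal \<bar>heat_kernel (t - T) (x - y) - heat_kernel t x\<bar> \<partial>lborel)" for x
  proof -
    have i1: "integrable lborel (\<lambda>y. heat_kernel (t - T) (x - y) * u T y)"
      using u_nonneg[OF T(1)] u_le_M[OF T(1)] by (intro integrable_heat_kernel_mult[OF tT(1), where C = M]) auto
    have i2: "integrable lborel (\<lambda>y. u T y * heat_kernel t x)" using integrable_u[OF T(1)] by simp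
    have "A x - mass T * heat_kernel t x = (LINT y|lborel. heat_kernel (t - T) (x - y) * u T y - u T y * heat_kernel t x)"
      using i1 i2 by (simp add: A_def mass_def)
    also have "ennreal \<bar>\<dots>\<bar> \<le> (\<integral>\<^sup>+y. ennreal (norm (heat_kernel (t - T) (x - y) * u T y - u T y * heat_kernel t x)) \<partial>lborel)"
      using integral_norm_bound_ennreal[OF Bochner_Integration.integrable_diff[OF i1 i2]] by simp
    also have "\<dots> = (\<integral>\<^sup>+y. ennreal (u T y) * ennreal \<bar>heat_kernel (t - T) (x - y) - heat_kernel t x\<bar> \<partial>lborel)"
    proof (rule nn_integral_cong)
      fix y
      have "heat_kernel (t - T) (x - y) * u T y - u T y * heat_kernel t x = u T y * (heat_kernel (t - T) (x - y) - heat_kernel t x)"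
        by (simp add: algebra_simps)
      then show "ennreal (norm (heat_kernel (t - T) (x - y) * u T y - u T y * heat_kernel t x)) = ennreal (u T y) * ennreal \<bar>heat_kernel (t - T) (x - y) - heat_kernel t x\<bar>"
        using u_nonneg[OF T(1), of y] by (simp add: abs_mult ennreal_mult)
    qed
    finally show ?thesis .
  qed
  have "L1_dist t \<le> (\<integral>\<^sup>+x. (\<integral>\<^sup>+y. ennreal (u T y) * ennreal \<bar>heat_kernel (t - T) (x - y) - heat_kernel t x\<bar> \<partial>lborel)
      + (tail T * ennreal (heat_kernel t x) + absorbed 0 1 T t x) \<partial>lborel)"
    unfolding L1_dist_def
  proof (rule nn_integral_mono)
    fix x
    have "\<bar>u t x - limit_mass * heat_kernel t x\<bar> \<le> \<bar>A x - mass T * heat_kernel t x\<bar> + ((mass T - limit_mass) * heat_kernel t x + \<bar>u t x - A x\<bar>)"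
    proof -
      have "0 \<le> (mass T - limit_mass) * heat_kernel t x" using mass_eq(2)[OF T(1)] by simp
      then show ?thesis by (simp add: left_diff_distrib)
    qed
    then have "ennreal \<bar>u t x - limit_mass * heat_kernel t x\<bar> \<le> ennreal (\<bar>A x - mass T * heat_kernel t x\<bar> + ((mass T - limit_mass) * heat_kernel t x + \<bar>u t x - A x\<bar>))"
      by (rule ennreal_leI)
    also have "\<dots> = ennreal \<bar>A x - mass T * heat_kernel t x\<bar> + (tail T * ennreal (heat_kernel t x) + absorbed 0 1 T t x)"
      unfolding A tail_eq[OF T(1)] using mass_eq(2)[OF T(1)]
      by (simp add: ennreal_plus ennreal_mult)
    also have "\<dots> \<le> (\<integral>\<^sup>+y. ennreal (u T y) * ennreal \<bar>heat_kernel (t - T) (x - y) - heat_kernel t x\<bar> \<partial>lborel)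
      + (tail T * ennreal (heat_kernel t x) + absorbed 0 1 T t x)"
      by (intro add_right_mono B)
    finally show "ennreal \<bar>u t x - limit_mass * heat_kernel t x\<bar> \<le> (\<integral>\<^sup>+y. ennreal (u T y) * ennreal \<bar>heat_kernel (t - T) (x - y) - heat_kernel t x\<bar> \<partial>lborel)
      + (tail T * ennreal (heat_kernel t x) + absorbed 0 1 T t x)" .
  qed
  also have "\<dots> = (\<integral>\<^sup>+x. (\<integral>\<^sup>+y. ennreal (u T y) * ennreal \<bar>heat_kernel (t - T) (x - y) - heat_kernel t x\<bar> \<partial>lborel) \<partial>lborel)
     + (tail T + (\<integral>\<^sup>+x. absorbed 0 1 T t x \<partial>lborel))"
    using nn_integral_heat_kernel_0[OF tT(2), where 'a='a]
    by (simp add: nn_integral_add nn_integral_cmult)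
  also have "(\<integral>\<^sup>+x. absorbed 0 1 T t x \<partial>lborel) \<le> tail T"
    unfolding absorbed_L1[OF zero_less_one] tail_def
    by (intro nn_integral_mono) (auto simp: indicator_def)
  also have "(\<integral>\<^sup>+x. (\<integral>\<^sup>+y. ennreal (u T y) * ennreal \<bar>heat_kernel (t - T) (x - y) - heat_kernel t x\<bar> \<partial>lborel) \<partial>lborel) =
    (\<integral>\<^sup>+y. (\<integral>\<^sup>+x. ennreal (u T y) * ennreal \<bar>heat_kernel (t - T) (x - y) - heat_kernel t x\<bar> \<partial>lborel) \<partial>lborel)"
    by (rule lborel_pair.Fubini') measurable
  also have "\<dots> = (\<integral>\<^sup>+y. ennreal (u T y) * (\<integral>\<^sup>+x. ennreal \<bar>heat_kernel (t - T) (x - y) - heat_kernel t x\<bar> \<partial>lborel) \<partial>lborel)"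
    by (intro nn_integral_cong nn_integral_cmult) measurable
  finally show ?thesis by (simp add: mult_2 add_left_mono)
qed

lemma L1_dist_tendsto_0: "(L1_dist \<longlongrightarrow> 0) at_top"
proof (rule tendsto_0_ennrealI)
  fix e :: real assume e: "e > 0"
  have "\<forall>\<^sub>F T in at_top. tail T < ennreal (e / 4)"
    using order_tendstoD(2)[OF tail_tendsto_0, of "ennreal (e / 4)"] e by simp
  then have "\<forall>\<^sub>F T in at_top. tail T < ennreal (e / 4) \<and> T \<ge> 0"
    using eventually_ge_at_top[of 0] by eventually_elim simp
  then obtain T where T: "tail T < ennreal (e / 4)" "T \<ge> 0"
    using eventually_happens'[OF trivial_limit_at_top_linorder] by blast
  let ?W = "\<lambda>t. \<integral>\<^sup>+y. ennreal (u T y) * (\<integral>\<^sup>+x. ennreal \<bar>heat_kernel (t - T) (x - y) - heat_kernel t x\<bar> \<partial>lborel) \<partial>lborel"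
  have "\<forall>\<^sub>F t in at_top. ?W t < ennreal (e / 2)"
    using order_tendstoD(2)[OF heat_flow_L1_tendsto[OF T(2)], of "ennreal (e / 2)"] e by simp
  then show "\<forall>\<^sub>F t in at_top. L1_dist t \<le> ennreal e"
    using eventually_gt_at_top[of T]
  proof eventually_elim
    case (elim t)
    have "L1_dist t \<le> ?W t + 2 * tail T" using T elim by (intro L1_dist_le) auto
    also have "\<dots> \<le> ennreal (e / 2) + 2 * ennreal (e / 4)"
      using elim T by (intro add_mono mult_left_mono) auto
    also have "\<dots> = ennreal e" using e by (simp add: mult_2 flip: ennreal_plus)
    finally show ?case .
  qed
qed

end

section \<open>Smoothing and decay of the gradient\<close>

lemma nn_integral_inverse_sqrt:
  assumes "L \<ge> (0::real)"
  shows "(\<integral>\<^sup>+r. indicator {0..L} r * ennreal (r powr (-1/2)) \<partial>lborel) = ennreal (2 * sqrt L)"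
proof -
  have "((\<lambda>r. r powr (-1/2)) has_integral (L powr (-1/2 + 1) / (-1/2 + 1))) {0..L}"
    using assms by (intro has_integral_powr_from_0) auto
  then have "((\<lambda>r. if r \<in> {0..L} then r powr (-1/2) else 0) has_integral (2 * sqrt L)) UNIV"
    using assms by (subst has_integral_restrict_UNIV) (simp add: powr_half_sqrt mult.commute)
  then have "(\<integral>\<^sup>+r. ennreal (if r \<in> {0..L} then r powr (-1/2) else 0) \<partial>lborel) = ennreal (2 * sqrt L)"
    by (intro nn_integral_has_integral_lborel) auto
  moreover have "(\<integral>\<^sup>+r. ennreal (if r \<in> {0..L} then r powr (-1/2) else 0) \<partial>lborel) =
     (\<integral>\<^sup>+r. indicator {0..L} r * ennreal (r powr (-1/2)) \<partial>lborel)"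
    by (intro nn_integral_cong) (auto simp: indicator_def)
  ultimately show ?thesis by simp
qed

lemma nn_integral_inverse_sqrt_right:
  assumes "\<tau> \<le> (s::real)"
  shows "(\<integral>\<^sup>+r. indicator {\<tau>..<s} r * ennreal ((s - r) powr (-1/2)) \<partial>lborel) = ennreal (2 * sqrt (s - \<tau>))"
proof -
  have "(\<integral>\<^sup>+r. indicator {\<tau>..<s} r * ennreal ((s - r) powr (-1/2)) \<partial>lborel) =
     (\<integral>\<^sup>+r. indicator {0..s - \<tau>} (s - r) * ennreal ((s - r) powr (-1/2)) \<partial>lborel)"
    by (intro nn_integral_cong) (auto simp: indicator_def)
  also have "\<dots> = (\<integral>\<^sup>+r. indicator {0..s - \<tau>} r * ennreal (r powr (-1/2)) \<partial>lborel)"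
    by (rule nn_integral_lborel_reflect) measurable
  finally show ?thesis using assms nn_integral_inverse_sqrt[of "s - \<tau>"] by simp
qed

lemma nn_integral_inverse_sqrt_left:
  assumes "\<tau> \<le> (s::real)"
  shows "(\<integral>\<^sup>+r. indicator {\<tau>..<s} r * ennreal ((r - \<tau>) powr (-1/2)) \<partial>lborel) \<le> ennreal (2 * sqrt (s - \<tau>))"
proof -
  have "(\<integral>\<^sup>+r. indicator {\<tau>..<s} r * ennreal ((r - \<tau>) powr (-1/2)) \<partial>lborel) \<le>
     (\<integral>\<^sup>+r. indicator {0..s - \<tau>} (- \<tau> + r) * ennreal ((- \<tau> + r) powr (-1/2)) \<partial>lborel)"
    by (intro nn_integral_mono) (auto simp: indicator_def)
  also have "\<dots> = (\<integral>\<^sup>+r. indicator {0..s - \<tau>} r * ennreal (r powr (-1/2)) \<partial>lborel)"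
    by (rule nn_integral_lborel_translate) measurable
  finally show ?thesis using assms nn_integral_inverse_sqrt[of "s - \<tau>"] by simp
qed

text \<open>A crude bound for the Beta integral, whose value is \<open>\<pi>\<close>.\<close>

lemma nn_integral_beta_bound:
  assumes "\<tau> < (s::real)"
  shows "(\<integral>\<^sup>+r. indicator {\<tau>..<s} r * ennreal ((s - r) powr (-1/2) * (r - \<tau>) powr (-1/2)) \<partial>lborel) \<le> ennreal 6"
proof -
  define k where "k = ((s - \<tau>) / 2) powr (-1/2)"
  have k0: "k \<ge> 0" by (simp add: k_def)
  \<comment> \<open>One of the two distances is at least half the interval, and the corresponding
    factor is then at most \<open>k\<close>.\<close>
  have le: "(s - r) powr (-1/2) * (r - \<tau>) powr (-1/2) \<le> k * ((s - r) powr (-1/2) + (r - \<tau>) powr (-1/2))"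
    if "\<tau> \<le> r" "r < s" for r
  proof (cases "r - \<tau> \<ge> (s - \<tau>) / 2")
    case True
    then have "(r - \<tau>) powr (-1/2) \<le> k"
      unfolding k_def using assms by (intro powr_mono2') auto
    then have "(s - r) powr (-1/2) * (r - \<tau>) powr (-1/2) \<le> (s - r) powr (-1/2) * k"
      by (intro mult_left_mono) auto
    also have "\<dots> \<le> k * ((s - r) powr (-1/2) + (r - \<tau>) powr (-1/2))"
      using k0 by (simp add: distrib_left mult.commute)
    finally show ?thesis .
  next
    case False
    then have "(s - r) powr (-1/2) \<le> k"
      unfolding k_def using assms by (intro powr_mono2') (auto simp: field_simps)
    then have "(s - r) powr (-1/2) * (r - \<tau>) powr (-1/2) \<le> k * (r - \<tau>) powr (-1/2)"
      by (intro mult_right_mono) auto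
    also have "\<dots> \<le> k * ((s - r) powr (-1/2) + (r - \<tau>) powr (-1/2))"
      using k0 by (simp add: distrib_left)
    finally show ?thesis .
  qed
  have "(\<integral>\<^sup>+r. indicator {\<tau>..<s} r * ennreal ((s - r) powr (-1/2) * (r - \<tau>) powr (-1/2)) \<partial>lborel) \<le>
     (\<integral>\<^sup>+r. ennreal k * (indicator {\<tau>..<s} r * ennreal ((s - r) powr (-1/2)) + indicator {\<tau>..<s} r * ennreal ((r - \<tau>) powr (-1/2))) \<partial>lborel)"
    using le k0 by (intro nn_integral_mono) (auto simp: indicator_def simp flip: ennreal_mult ennreal_plus intro!: ennreal_leI)
  also have "\<dots> \<le> ennreal k * (ennreal (2 * sqrt (s - \<tau>)) + ennreal (2 * sqrt (s - \<tau>)))"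
    using nn_integral_inverse_sqrt_right[of \<tau> s] nn_integral_inverse_sqrt_left[of \<tau> s] assms
    by (simp add: nn_integral_cmult nn_integral_add mult_left_mono)
  also have "\<dots> = ennreal (k * (4 * sqrt (s - \<tau>)))"
    using assms k0 by (simp flip: ennreal_mult ennreal_plus)
  also have "k * (4 * sqrt (s - \<tau>)) = 4 * sqrt 2"
    using assms by (simp add: k_def powr_minus powr_half_sqrt real_sqrt_divide)
  also have "ennreal (4 * sqrt 2) \<le> ennreal 6"
  proof (rule ennreal_leI)
    have "sqrt 2 \<le> 3 / 2" by (rule real_le_lsqrt) (auto simp: power2_eq_square)
    then show "4 * sqrt 2 \<le> 6" by simp
  qed
  finally show ?thesis .
qed

text \<open>Holds for every function: a Bochner integral that does not exist is 0 by
  convention.\<close>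

lemma ennreal_abs_integral_le:
  fixes f :: "'b \<Rightarrow> real"
  shows "ennreal \<bar>LINT y|N. f y\<bar> \<le> (\<integral>\<^sup>+y. ennreal \<bar>f y\<bar> \<partial>N)"
proof (cases "integrable N f")
  case True
  then show ?thesis using integral_norm_bound_ennreal[OF True] by simp
qed (simp add: not_integrable_integral_eq)

lemma heat_dir_flow_bound:
  fixes g :: "'a::euclidean_space \<Rightarrow> real"
  assumes [measurable]: "g \<in> borel_measurable borel" and \<sigma>: "\<sigma> > 0" and e: "norm e \<le> 1"
  shows "ennreal \<bar>LINT y|lborel. heat_dir e \<sigma> (x - y) * g y\<bar> \<le>
    ennreal (2 powr (real DIM('a) / 2) * \<sigma> powr (-1/2)) * (\<integral>\<^sup>+y. ennreal (heat_kernel (2 * \<sigma>) (x - y)) * ennreal \<bar>g y\<bar> \<partial>lborel)"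
proof -
  have "ennreal \<bar>LINT y|lborel. heat_dir e \<sigma> (x - y) * g y\<bar> \<le> (\<integral>\<^sup>+y. ennreal \<bar>heat_dir e \<sigma> (x - y) * g y\<bar> \<partial>lborel)"
    by (rule ennreal_abs_integral_le)
  also have "\<dots> \<le> (\<integral>\<^sup>+y. ennreal (2 powr (real DIM('a) / 2) * \<sigma> powr (-1/2)) * (ennreal (heat_kernel (2 * \<sigma>) (x - y)) * ennreal \<bar>g y\<bar>) \<partial>lborel)"
  proof (rule nn_integral_mono)
    fix y
    have "\<bar>heat_dir e \<sigma> (x - y)\<bar> * \<bar>g y\<bar> \<le> (2 powr (real DIM('a) / 2) * \<sigma> powr (-1/2) * heat_kernel (2 * \<sigma>) (x - y)) * \<bar>g y\<bar>"
      by (intro mult_right_mono heat_dir_bound \<sigma> e) auto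
    then show "ennreal \<bar>heat_dir e \<sigma> (x - y) * g y\<bar> \<le> ennreal (2 powr (real DIM('a) / 2) * \<sigma> powr (-1/2)) * (ennreal (heat_kernel (2 * \<sigma>) (x - y)) * ennreal \<bar>g y\<bar>)"
      by (auto simp: abs_mult mult.assoc simp flip: ennreal_mult intro!: ennreal_leI)
  qed
  also have "\<dots> = ennreal (2 powr (real DIM('a) / 2) * \<sigma> powr (-1/2)) * (\<integral>\<^sup>+y. ennreal (heat_kernel (2 * \<sigma>) (x - y)) * ennreal \<bar>g y\<bar> \<partial>lborel)"
    by (rule nn_integral_cmult) measurable
  finally show ?thesis .
qed

lemma heat_flow_semigroup:
  fixes f :: "'a::euclidean_space \<Rightarrow> ennreal"
  assumes [measurable]: "f \<in> borel_measurable borel" and ab: "a > 0" "b > 0"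
  shows "(\<integral>\<^sup>+y. ennreal (heat_kernel a (x - y)) * (\<integral>\<^sup>+z. ennreal (heat_kernel b (y - z)) * f z \<partial>lborel) \<partial>lborel) =
    (\<integral>\<^sup>+z. ennreal (heat_kernel (a + b) (x - z)) * f z \<partial>lborel)"
proof -
  have "(\<integral>\<^sup>+y. ennreal (heat_kernel a (x - y)) * (\<integral>\<^sup>+z. ennreal (heat_kernel b (y - z)) * f z \<partial>lborel) \<partial>lborel) =
    (\<integral>\<^sup>+y. (\<integral>\<^sup>+z. ennreal (heat_kernel a (x - y) * heat_kernel b (y - z)) * f z \<partial>lborel) \<partial>lborel)"
    by (intro nn_integral_cong) (simp add: nn_integral_cmult[symmetric] ennreal_mult mult.assoc)
  also have "\<dots> = (\<integral>\<^sup>+z. (\<integral>\<^sup>+y. ennreal (heat_kernel a (x - y) * heat_kernel b (y - z)) * f z \<partial>lborel) \<partial>lborel)"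
    by (rule lborel_pair.Fubini') measurable
  also have "\<dots> = (\<integral>\<^sup>+z. ennreal (heat_kernel (a + b) (x - z)) * f z \<partial>lborel)"
    using heat_kernel_semigroup[OF ab, where 'a='a] by (intro nn_integral_cong) (simp add: nn_integral_multc)
  finally show ?thesis .
qed

lemma heat_flow_le:
  fixes f :: "'a::euclidean_space \<Rightarrow> ennreal"
  assumes [measurable]: "f \<in> borel_measurable borel" and \<sigma>: "\<sigma> > 0"
  shows "(\<integral>\<^sup>+y. ennreal (heat_kernel \<sigma> (x - y)) * f y \<partial>lborel) \<le> ennreal ((4 * pi * \<sigma>) powr (- real DIM('a) / 2)) * (\<integral>\<^sup>+y. f y \<partial>lborel)"
proof -
  have "(\<integral>\<^sup>+y. ennreal (heat_kernel \<sigma> (x - y)) * f y \<partial>lborel) \<le> (\<integral>\<^sup>+y. ennreal ((4 * pi * \<sigma>) powr (- real DIM('a) / 2)) * f y \<partial>lborel)"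
    by (intro nn_integral_mono mult_right_mono ennreal_leI heat_kernel_bound \<sigma>) auto
  then show ?thesis by (simp add: nn_integral_cmult)
qed

context viscous_HJ
begin

text \<open>On the interval \<open>F\<close> is at most \<open>m powr (q - 1)\<close> times the
  gradient, so Duhamel's formula becomes a linear integral inequality for
  \<open>|\<nabla>u|\<close>. Its kernel reproduces the flow \<open>H\<close> exactly, and iteration
  halves the error each time, starting from the crude bound \<open>m\<close>.\<close>

lemma local_smoothing:
  fixes \<tau> t m :: real
  defines "c \<equiv> 2 powr (real DIM('a) / 2)"
  assumes \<tau>: "0 < \<tau>" "\<tau> < t" and m: "m \<ge> 0"
    and grad: "\<And>s y. \<tau> \<le> s \<Longrightarrow> s \<le> t \<Longrightarrow> norm (gradient (u s) y) \<le> m"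
    and small: "12 * c * m powr (q - 1) * sqrt (t - \<tau>) \<le> 1"
  shows "ennreal (norm (gradient (u t) x)) \<le>
    ennreal (2 * c * (t - \<tau>) powr (-1/2)) * (\<integral>\<^sup>+y. ennreal (heat_kernel (2 * (t - \<tau>)) (x - y)) * ennreal (u \<tau> y) \<partial>lborel)"
proof -
  define H where "H s x = (\<integral>\<^sup>+y. ennreal (heat_kernel (2 * (s - \<tau>)) (x - y)) * ennreal (u \<tau> y) \<partial>lborel)" for s x
  define mq where "mq = m powr (q - 1)"
  have c: "c \<ge> 0" and mq: "mq \<ge> 0" by (auto simp: c_def mq_def)
  have [measurable]: "u \<tau> \<in> borel_measurable borel" using \<tau> by simp
  have H_meas [measurable]: "(\<lambda>y. H r y) \<in> borel_measurable borel" for r unfolding H_def by measurable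
  have u0: "0 \<le> u \<tau> y" for y using \<tau> by (intro u_nonneg) simp
  have step1: "ennreal (norm (gradient (u s) x)) \<le> ennreal (c * (s - \<tau>) powr (-1/2)) * H s x + ennreal c * absorbed (1/2) 2 \<tau> s x"
    if s: "\<tau> < s" for s x
  proof -
    \<comment> \<open>The unit vector along the gradient turns the directional estimate into one for
      the norm.\<close>
    define e where "e = sgn (gradient (u s) x)"
    have e: "norm e \<le> 1" by (simp add: e_def norm_sgn)
    let ?L = "LINT y|lborel. heat_dir e (s - \<tau>) (x - y) * u \<tau> y"
    have "gradient (u s) x \<bullet> e = norm (gradient (u s) x)"
      by (cases "gradient (u s) x = 0") (auto simp: e_def sgn_div_norm power2_norm_eq_inner[symmetric] power2_eq_square)
    then have "norm (gradient (u s) x) \<le> \<bar>?L\<bar> + \<bar>gradient (u s) x \<bullet> e - ?L\<bar>" by linarith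
    then have "ennreal (norm (gradient (u s) x)) \<le> ennreal \<bar>?L\<bar> + ennreal \<bar>gradient (u s) x \<bullet> e - ?L\<bar>"
      by (simp add: ennreal_leI flip: ennreal_plus)
    also have "\<dots> \<le> ennreal (c * (s - \<tau>) powr (-1/2)) * H s x + ennreal c * absorbed (1/2) 2 \<tau> s x"
    proof (rule add_mono)
      show "ennreal \<bar>?L\<bar> \<le> ennreal (c * (s - \<tau>) powr (-1/2)) * H s x"
        using heat_dir_flow_bound[of "u \<tau>" "s - \<tau>" e x] e s u0 by (simp add: c_def H_def)
      show "ennreal \<bar>gradient (u s) x \<bullet> e - ?L\<bar> \<le> ennreal c * absorbed (1/2) 2 \<tau> s x"
        unfolding c_def by (rule duhamel_gradient[OF \<tau>(1) s e])
    qed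
    finally show ?thesis .
  qed
  have F_le: "F r y \<le> mq * norm (gradient (u r) y)" if "\<tau> \<le> r" "r \<le> t" for r y
  proof -
    have "F r y = norm (gradient (u r) y) powr (q - 1) * norm (gradient (u r) y)"
      using that \<tau> by (cases "gradient (u r) y = 0") (auto simp: F_def powr_diff)
    also have "\<dots> \<le> mq * norm (gradient (u r) y)"
      unfolding mq_def using grad[OF that, of y] q_gt_1 by (intro mult_right_mono powr_mono2) auto
    finally show ?thesis .
  qed
  \<comment> \<open>The flow of \<open>H r\<close> over time \<open>2 * (s - r)\<close> is
    \<open>H s\<close> by the semigroup law, which is why \<open>H\<close> is defined with doubled
    time. What remains in \<open>r\<close> is the Beta integral for the flow part and an inverse
    square root for the constant part.\<close>
  have absorb: "absorbed (1/2) 2 \<tau> s x \<le> ennreal mq * (ennreal (2 * c * 6) * H s x + ennreal (S * (2 * sqrt (s - \<tau>))))"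
    if s: "\<tau> < s" "s \<le> t" and S: "S \<ge> 0"
      and hyp: "\<And>r y. \<tau> < r \<Longrightarrow> r \<le> t \<Longrightarrow> ennreal (norm (gradient (u r) y)) \<le> ennreal (2 * c * (r - \<tau>) powr (-1/2)) * H r y + ennreal S"
    for s x S
  proof -
    have inner: "(\<integral>\<^sup>+y. ennreal (heat_kernel (2 * (s - r)) (x - y) * F r y) \<partial>lborel) \<le>
        ennreal mq * (ennreal (2 * c * (r - \<tau>) powr (-1/2)) * H s x + ennreal S)" if r: "\<tau> < r" "r < s" for r
    proof -
      have "(\<integral>\<^sup>+y. ennreal (heat_kernel (2 * (s - r)) (x - y) * F r y) \<partial>lborel) \<le>
         (\<integral>\<^sup>+y. ennreal mq * (ennreal (2 * c * (r - \<tau>) powr (-1/2)) * (ennreal (heat_kernel (2 * (s - r)) (x - y)) * H r y) +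
           ennreal S * ennreal (heat_kernel (2 * (s - r)) (x - y))) \<partial>lborel)"
      proof (rule nn_integral_mono)
        fix y
        have "ennreal (F r y) \<le> ennreal mq * ennreal (norm (gradient (u r) y))"
          using F_le[of r y] r s mq by (auto simp flip: ennreal_mult intro!: ennreal_leI)
        also have "\<dots> \<le> ennreal mq * (ennreal (2 * c * (r - \<tau>) powr (-1/2)) * H r y + ennreal S)"
          using r s by (intro mult_left_mono hyp) auto
        finally have "ennreal (heat_kernel (2 * (s - r)) (x - y)) * ennreal (F r y) \<le>
           ennreal (heat_kernel (2 * (s - r)) (x - y)) * (ennreal mq * (ennreal (2 * c * (r - \<tau>) powr (-1/2)) * H r y + ennreal S))"
          by (rule mult_left_mono) simp
        then show "ennreal (heat_kernel (2 * (s - r)) (x - y) * F r y) \<le> ennreal mq * (ennreal (2 * c * (r - \<tau>) powr (-1/2)) * (ennreal (heat_kernel (2 * (s - r)) (x - y)) * H r y) +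
           ennreal S * ennreal (heat_kernel (2 * (s - r)) (x - y)))"
          by (simp add: ennreal_mult distrib_left mult_ac)
      qed
      also have "\<dots> = ennreal mq * (ennreal (2 * c * (r - \<tau>) powr (-1/2)) * (\<integral>\<^sup>+y. ennreal (heat_kernel (2 * (s - r)) (x - y)) * H r y \<partial>lborel) +
           ennreal S * (\<integral>\<^sup>+y. ennreal (heat_kernel (2 * (s - r)) (x - y)) \<partial>lborel))"
        by (simp add: nn_integral_cmult nn_integral_add)
      also have "(\<integral>\<^sup>+y. ennreal (heat_kernel (2 * (s - r)) (x - y)) * H r y \<partial>lborel) = H s x"
        unfolding H_def using r by (subst heat_flow_semigroup) (auto simp: algebra_simps)
      also have "(\<integral>\<^sup>+y. ennreal (heat_kernel (2 * (s - r)) (x - y)) \<partial>lborel) = 1"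
        using r by (intro nn_integral_heat_kernel) simp
      finally show ?thesis by simp
    qed
    have "absorbed (1/2) 2 \<tau> s x \<le> (\<integral>\<^sup>+r. ennreal mq * ((ennreal (2 * c) * H s x) * (indicator {\<tau>..<s} r * ennreal ((s - r) powr (-1/2) * (r - \<tau>) powr (-1/2))) +
        ennreal S * (indicator {\<tau>..<s} r * ennreal ((s - r) powr (-1/2)))) \<partial>lborel)"
      unfolding absorbed_def
    proof (rule nn_integral_mono_AE)
      \<comment> \<open>\<open>hyp\<close> says nothing at \<open>r = \<tau>\<close>, where moreover
        \<open>0 powr (-1/2)\<close> is 0; this one time is discarded.\<close>
      have "AE r in lborel. r \<noteq> \<tau>" by (rule AE_lborel_singleton)
      then show "AE r in lborel. indicator {\<tau>..<s} r * ennreal ((s - r) powr - (1 / 2)) * (\<integral>\<^sup>+ y. ennreal (heat_kernel (2 * (s - r)) (x - y) * F r y) \<partial>lborel)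
         \<le> ennreal mq * ((ennreal (2 * c) * H s x) * (indicator {\<tau>..<s} r * ennreal ((s - r) powr (-1/2) * (r - \<tau>) powr (-1/2))) +
        ennreal S * (indicator {\<tau>..<s} r * ennreal ((s - r) powr (-1/2))))"
      proof eventually_elim
        case (elim r)
        show ?case
        proof (cases "r \<in> {\<tau>..<s}")
          case True
          with elim have r: "\<tau> < r" "r < s" by auto
          have "ennreal ((s - r) powr - (1 / 2)) * (\<integral>\<^sup>+ y. ennreal (heat_kernel (2 * (s - r)) (x - y) * F r y) \<partial>lborel) \<le>
              ennreal ((s - r) powr - (1 / 2)) * (ennreal mq * (ennreal (2 * c * (r - \<tau>) powr (-1/2)) * H s x + ennreal S))"
            by (intro mult_left_mono inner r) simp
          then show ?thesis using True c by (simp add: ennreal_mult distrib_left mult_ac)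
        qed simp
      qed
    qed
    also have "\<dots> = ennreal mq * ((ennreal (2 * c) * H s x) * (\<integral>\<^sup>+r. indicator {\<tau>..<s} r * ennreal ((s - r) powr (-1/2) * (r - \<tau>) powr (-1/2)) \<partial>lborel) +
        ennreal S * (\<integral>\<^sup>+r. indicator {\<tau>..<s} r * ennreal ((s - r) powr (-1/2)) \<partial>lborel))"
      by (simp add: nn_integral_cmult nn_integral_add)
    also have "\<dots> \<le> ennreal mq * ((ennreal (2 * c) * H s x) * ennreal 6 + ennreal S * ennreal (2 * sqrt (s - \<tau>)))"
      using nn_integral_inverse_sqrt_right[of \<tau> s] nn_integral_beta_bound[OF s(1)] s
      by (intro mult_left_mono add_mono) auto
    also have "\<dots> = ennreal mq * (ennreal (2 * c * 6) * H s x + ennreal (S * (2 * sqrt (s - \<tau>))))"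
      using S s c by (simp add: ennreal_mult mult_ac)
    finally show ?thesis .
  qed
  have iter: "ennreal (norm (gradient (u s) y)) \<le> ennreal (2 * c * (s - \<tau>) powr (-1/2)) * H s y + ennreal (m / 2 ^ n)"
    if "\<tau> < s" "s \<le> t" for n s y
    using that
  proof (induction n arbitrary: s y)
    case 0
    then have "ennreal (norm (gradient (u s) y)) \<le> ennreal m" by (intro ennreal_leI grad) auto
    then show ?case by (simp add: add_increasing)
  next
    case (Suc n)
    define S where "S = m / 2 ^ n"
    have S: "S \<ge> 0" using m by (simp add: S_def)
    define L where "L = sqrt (s - \<tau>)"
    have L: "0 < L" "L \<le> sqrt (t - \<tau>)" using Suc.prems by (auto simp: L_def)
    have sm: "12 * c * mq * L \<le> 1"
    proof -
      have "12 * c * mq * L \<le> 12 * c * mq * sqrt (t - \<tau>)" using L c mq by (intro mult_left_mono) auto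
      then show ?thesis using small by (simp add: mq_def)
    qed
    have Lp: "(s - \<tau>) powr (-1/2) = 1 / L"
      using Suc.prems by (simp add: L_def powr_minus powr_half_sqrt inverse_eq_divide)
    have "ennreal (norm (gradient (u s) y)) \<le> ennreal (c * (1 / L)) * H s y + ennreal c * absorbed (1/2) 2 \<tau> s y"
      using step1[OF Suc.prems(1), of y] by (simp only: Lp)
    also have "\<dots> \<le> ennreal (c * (1 / L)) * H s y + ennreal c * (ennreal mq * (ennreal (2 * c * 6) * H s y + ennreal (S * (2 * L))))"
      unfolding L_def using Suc S by (intro add_left_mono mult_left_mono absorb) (auto simp: S_def)
    also have "\<dots> = (ennreal (c * (1 / L)) + ennreal (c * mq * (2 * c * 6))) * H s y + ennreal (c * mq * (S * (2 * L)))"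
      using c mq S L by (simp add: distrib_left distrib_right ennreal_mult mult.assoc add.assoc)
    also have "\<dots> = ennreal (c * (1 / L) + c * mq * (2 * c * 6)) * H s y + ennreal (c * mq * (S * (2 * L)))"
      using c mq L by (subst ennreal_plus) auto
    \<comment> \<open>\<open>small\<close> enters twice. The factor 12 is \<open>2 * 6\<close>, with
      6 from the Beta integral, so the new flow term is at most the linear one; the constant term is
      at most \<open>S / 6\<close>.\<close>
    also have "\<dots> \<le> ennreal (2 * c * (1 / L)) * H s y + ennreal (S / 2)"
    proof (intro add_mono mult_right_mono ennreal_leI)
      have "c * (12 * c * mq * L) \<le> c * 1" using sm c by (rule mult_left_mono)
      then have "c * mq * (2 * c * 6) \<le> c * (1 / L)"
        using L by (simp add: field_simps)
      then show "c * (1 / L) + c * mq * (2 * c * 6) \<le> 2 * c * (1 / L)" by simp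
      have "S * (12 * c * mq * L) \<le> S * 1" using sm S by (rule mult_left_mono)
      then show "c * mq * (S * (2 * L)) \<le> S / 2" using S by (simp add: mult_ac)
    qed simp
    also have "S / 2 = m / 2 ^ Suc n" by (simp add: S_def)
    finally show ?case by (simp only: Lp)
  qed
  have "(\<lambda>n. ennreal (2 * c * (t - \<tau>) powr (-1/2)) * H t x + ennreal (m / 2 ^ n)) \<longlonglongrightarrow>
      ennreal (2 * c * (t - \<tau>) powr (-1/2)) * H t x + ennreal 0"
    by (intro tendsto_add tendsto_const tendsto_ennrealI) real_asymp
  then have "ennreal (norm (gradient (u t) x)) \<le> ennreal (2 * c * (t - \<tau>) powr (-1/2)) * H t x + ennreal 0"
    by (rule LIMSEQ_le_const) (use iter[of t x] \<tau> in auto)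
  then show ?thesis by (simp add: H_def)
qed

section \<open>Time decay: from local smoothing to the rates of the heat equation\<close>

lemma u_decay:
  assumes "\<tau> > 0"
  shows "u \<tau> y \<le> (4 * pi * \<tau>) powr (- real DIM('a) / 2) * mass 0"
proof -
  have [measurable]: "u 0 \<in> borel_measurable borel" by simp
  have "ennreal (u \<tau> y) \<le> ennreal (u \<tau> y) + absorbed 0 1 0 \<tau> y" by simp
  also have "\<dots> = (\<integral>\<^sup>+z. ennreal (heat_kernel \<tau> (y - z)) * ennreal (u 0 z) \<partial>lborel)"
    using duhamel[OF order.refl assms, of y] initial_nonneg by (simp add: ennreal_mult)
  also have "\<dots> \<le> ennreal ((4 * pi * \<tau>) powr (- real DIM('a) / 2)) * ennreal (mass 0)"
    using heat_flow_le[of "\<lambda>z. ennreal (u 0 z)" \<tau> y] assms by (simp add: mass_0)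
  also have "\<dots> = ennreal ((4 * pi * \<tau>) powr (- real DIM('a) / 2) * mass 0)"
    using mass_nonneg[of 0] by (simp add: ennreal_mult)
  finally show ?thesis using mass_nonneg[of 0] by simp
qed

text \<open>Two readings of the same pointwise bound by a heat flow: insert the sup bound of
  \<open>u\<close> at time \<open>\<tau>\<close>, or integrate and use that the flow preserves
  mass.\<close>

lemma gradient_smoothing:
  fixes \<tau> t m :: real
  defines "c \<equiv> 2 powr (real DIM('a) / 2)"
  assumes \<tau>: "0 < \<tau>" "\<tau> < t" and m: "m \<ge> 0"
    and grad: "\<And>s y. \<tau> \<le> s \<Longrightarrow> s \<le> t \<Longrightarrow> norm (gradient (u s) y) \<le> m"
    and small: "12 * c * m powr (q - 1) * sqrt (t - \<tau>) \<le> 1"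
  shows "norm (gradient (u t) x) \<le> 2 * c * (t - \<tau>) powr (-1/2) * ((4 * pi * \<tau>) powr (- real DIM('a) / 2) * mass 0)"
    and "(\<integral>\<^sup>+x. ennreal (norm (gradient (u t) x)) \<partial>lborel) \<le> ennreal (2 * c * (t - \<tau>) powr (-1/2) * mass 0)"
proof -
  have [measurable]: "u \<tau> \<in> borel_measurable borel" using \<tau> by simp
  note S = local_smoothing[OF \<tau> m grad, folded c_def, OF _ _ small]
  define A where "A = 2 * c * (t - \<tau>) powr (-1/2)"
  define b where "b = (4 * pi * \<tau>) powr (- real DIM('a) / 2) * mass 0"
  have A: "A \<ge> 0" by (simp add: A_def c_def)
  have b: "b \<ge> 0" using mass_nonneg[of 0] by (simp add: b_def)
  have "ennreal (norm (gradient (u t) x)) \<le> ennreal A * (\<integral>\<^sup>+y. ennreal (heat_kernel (2 * (t - \<tau>)) (x - y)) * ennreal (u \<tau> y) \<partial>lborel)"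
    unfolding A_def by (rule S)
  also have "\<dots> \<le> ennreal A * (\<integral>\<^sup>+y. ennreal (heat_kernel (2 * (t - \<tau>)) (x - y)) * ennreal b \<partial>lborel)"
    unfolding b_def by (intro mult_left_mono nn_integral_mono ennreal_leI u_decay \<tau>) auto
  also have "\<dots> = ennreal (A * b)"
    using \<tau> A b by (simp add: nn_integral_multc nn_integral_heat_kernel ennreal_mult)
  finally show "norm (gradient (u t) x) \<le> A * b" using A b by simp
  have "(\<integral>\<^sup>+x. ennreal (norm (gradient (u t) x)) \<partial>lborel) \<le>
     (\<integral>\<^sup>+x. ennreal A * (\<integral>\<^sup>+y. ennreal (heat_kernel (2 * (t - \<tau>)) (x - y)) * ennreal (u \<tau> y) \<partial>lborel) \<partial>lborel)"
    unfolding A_def by (intro nn_integral_mono S)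
  also have "\<dots> = ennreal A * (\<integral>\<^sup>+y. ennreal (u \<tau> y) \<partial>lborel)"
    using \<tau> by (simp add: nn_integral_cmult nn_integral_heat_flow)
  also have "\<dots> \<le> ennreal A * ennreal (mass 0)"
    using \<tau> by (intro mult_left_mono nn_integral_u_le) auto
  finally show "(\<integral>\<^sup>+x. ennreal (norm (gradient (u t) x)) \<partial>lborel) \<le> ennreal (A * mass 0)"
    using A mass_nonneg[of 0] by (simp add: ennreal_mult)
qed


text \<open>With \<open>m\<close> of order \<open>t^(-\<alpha>)\<close> the smallness condition
  permits \<open>sqrt \<delta>\<close> of order \<open>t^(\<alpha>(q-1))\<close>, while
  \<open>\<delta> \<le> t / 2\<close> caps the exponent at \<open>1/2\<close>. The longest
  admissible interval gives the factor \<open>\<delta>^(-1/2) = O(t^(-\<beta>))\<close>, and the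
  decay of \<open>u\<close> adds \<open>N / 2\<close>.\<close>

lemma decay_step:
  assumes C: "\<And>t x. t \<ge> 1 \<Longrightarrow> norm (gradient (u t) x) \<le> C * t powr (- \<alpha>)" and \<alpha>: "\<alpha> \<ge> 0"
  defines "\<beta> \<equiv> min (\<alpha> * (q - 1)) (1/2)"
  shows "\<exists>C'\<ge>0. (\<forall>t\<ge>1. \<forall>x. norm (gradient (u t) x) \<le> C' * t powr (- (\<beta> + real DIM('a) / 2))) \<and>
     (\<forall>t\<ge>2. (\<integral>\<^sup>+x. ennreal (norm (gradient (u t) x)) \<partial>lborel) \<le> ennreal (C' * t powr (- \<beta>)))"
proof -
  define N where "N = real DIM('a)"
  define c where "c = 2 powr (real DIM('a) / 2)"
  \<comment> \<open>\<open>C1\<close> is positive whatever \<open>C\<close> is, hence so is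
    \<open>B\<close>, the constant left in the smallness condition once the powers of
    \<open>t\<close> are bounded. In \<open>k\<close> the entry \<open>1/2\<close> keeps
    \<open>\<tau> \<ge> t / 2\<close>, and \<open>1 / B^2\<close> gives
    \<open>B * sqrt k \<le> 1\<close>.\<close>
  define C1 where "C1 = max C 1"
  define B where "B = 12 * c * C1 powr (q - 1) * 2 powr (\<alpha> * (q - 1))"
  define k where "k = min (1/2) (1 / B\<^sup>2)"
  define D where "D = 2 * c * k powr (-1/2) * mass 0"
  have c: "c > 0" by (simp add: c_def)
  have C1: "C1 \<ge> 1" "C \<le> C1" by (auto simp: C1_def)
  have B: "B > 0" using c C1 by (simp add: B_def)
  have k: "0 < k" "k \<le> 1/2" "B * sqrt k \<le> 1"
  proof -
    show "0 < k" "k \<le> 1/2" using B by (auto simp: k_def)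
    have "sqrt k \<le> sqrt (1 / B\<^sup>2)" by (simp add: k_def)
    also have "\<dots> = 1 / B" using B by (simp add: real_sqrt_divide)
    finally show "B * sqrt k \<le> 1" using B by (simp add: field_simps)
  qed
  have \<beta>: "0 \<le> \<beta>" "\<beta> \<le> \<alpha> * (q - 1)" "2 * \<beta> \<le> 1" using \<alpha> q_gt_1 by (auto simp: \<beta>_def)
  have D: "D \<ge> 0" using c mass_nonneg[of 0] by (simp add: D_def)
  \<comment> \<open>From \<open>t \<ge> 2\<close> follows \<open>\<tau> \<ge> t / 2 \<ge> 1\<close>,
    so the assumed decay is available on all of \<open>[\<tau>, t]\<close>.\<close>
  have main: "norm (gradient (u t) x) \<le> D * t powr (- (\<beta> + N / 2)) \<and>
     (\<integral>\<^sup>+x. ennreal (norm (gradient (u t) x)) \<partial>lborel) \<le> ennreal (D * t powr (- \<beta>))" if t: "t \<ge> 2" for t x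
  proof -
    define \<delta> where "\<delta> = k * t powr (2 * \<beta>)"
    have "t powr (2 * \<beta>) \<le> t powr 1" using \<beta> t by (intro powr_mono) auto
    then have "\<delta> \<le> 1/2 * t" unfolding \<delta>_def using k t by (intro mult_mono) auto
    then have \<delta>: "0 < \<delta>" "\<delta> \<le> t / 2" using k t by (auto simp: \<delta>_def)
    define \<tau> where "\<tau> = t - \<delta>"
    have \<tau>: "t / 2 \<le> \<tau>" "0 < \<tau>" "\<tau> < t" using \<delta> t by (auto simp: \<tau>_def)
    define m where "m = C1 * (t / 2) powr (- \<alpha>)"
    have m: "m \<ge> 0" using C1 by (simp add: m_def)
    have g: "norm (gradient (u s) y) \<le> m" if "\<tau> \<le> s" "s \<le> t" for s y
    proof -
      have s: "t / 2 \<le> s" "1 \<le> s" using that \<tau> t by auto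
      have "norm (gradient (u s) y) \<le> C * s powr (- \<alpha>)" using C[OF s(2)] .
      also have "\<dots> \<le> C1 * s powr (- \<alpha>)" using C1 by (intro mult_right_mono) auto
      also have "\<dots> \<le> m" unfolding m_def using C1 s t \<alpha> by (intro mult_left_mono powr_mono2') auto
      finally show ?thesis .
    qed
    have sd: "sqrt (t - \<tau>) = sqrt k * t powr \<beta>"
      using k t by (simp add: \<tau>_def \<delta>_def real_sqrt_mult powr_half_sqrt[symmetric] powr_powr)
    have mq: "m powr (q - 1) = C1 powr (q - 1) * (2 powr (\<alpha> * (q - 1)) * t powr (- (\<alpha> * (q - 1))))"
      using C1 t by (simp add: m_def powr_mult powr_powr powr_divide powr_minus divide_simps)
    have "12 * c * m powr (q - 1) * sqrt (t - \<tau>) = (B * sqrt k) * (t powr (- (\<alpha> * (q - 1))) * t powr \<beta>)"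
      unfolding mq sd by (simp add: B_def)
    also have "\<dots> = (B * sqrt k) * t powr (\<beta> - \<alpha> * (q - 1))"
      by (simp add: powr_add[symmetric])
    also have "\<dots> \<le> 1 * 1"
    proof (rule mult_mono)
      have "t powr (\<beta> - \<alpha> * (q - 1)) \<le> t powr 0" using \<beta> t by (intro powr_mono) auto
      then show "t powr (\<beta> - \<alpha> * (q - 1)) \<le> 1" using t by simp
    qed (use k B in auto)
    finally have small: "12 * 2 powr (real DIM('a) / 2) * m powr (q - 1) * sqrt (t - \<tau>) \<le> 1" by (simp add: c_def)
    have ds: "(t - \<tau>) powr (-1/2) = k powr (-1/2) * t powr (- \<beta>)"
      using t by (simp add: \<tau>_def \<delta>_def powr_mult powr_powr)
    note S = gradient_smoothing[OF \<tau>(2,3) m g small, folded c_def]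
    have "norm (gradient (u t) x) \<le> 2 * c * (t - \<tau>) powr (-1/2) * ((4 * pi * \<tau>) powr (- N / 2) * mass 0)"
      using S(1) unfolding N_def by blast
    also have "\<dots> \<le> 2 * c * (t - \<tau>) powr (-1/2) * (t powr (- N / 2) * mass 0)"
    proof (intro mult_left_mono mult_right_mono)
      have "t \<le> 4 * \<tau>" using \<tau> by simp
      also have "\<dots> \<le> 4 * pi * \<tau>" using pi_ge_two \<tau> by simp
      finally show "(4 * pi * \<tau>) powr (- N / 2) \<le> t powr (- N / 2)"
        using t by (intro powr_mono2') (auto simp: N_def)
    qed (use mass_nonneg[of 0] c in auto)
    also have "\<dots> = D * t powr (- (\<beta> + N / 2))"
      unfolding ds by (simp add: D_def powr_add[symmetric])
    finally have 1: "norm (gradient (u t) x) \<le> D * t powr (- (\<beta> + N / 2))" .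
    have "(\<integral>\<^sup>+x. ennreal (norm (gradient (u t) x)) \<partial>lborel) \<le> ennreal (2 * c * (t - \<tau>) powr (-1/2) * mass 0)"
      using S(2) by blast
    also have "2 * c * (t - \<tau>) powr (-1/2) * mass 0 = D * t powr (- \<beta>)"
      unfolding ds by (simp add: D_def)
    finally show ?thesis using 1 by simp
  qed
  \<comment> \<open>The second summand covers \<open>1 \<le> t < 2\<close> through the global bound
    \<open>M\<close>, so that the conclusion has the form of the assumption and the step can be
    iterated.\<close>
  define C' where "C' = D + M * 2 powr (\<beta> + N / 2)"
  have C': "0 \<le> C'" "D \<le> C'" using D M_nonneg by (auto simp: C'_def)
  have "norm (gradient (u t) x) \<le> C' * t powr (- (\<beta> + N / 2))" if t: "t \<ge> 1" for t x
  proof (cases "t \<ge> 2")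
    case True
    have "D * t powr (- (\<beta> + N / 2)) \<le> C' * t powr (- (\<beta> + N / 2))" using C' by (intro mult_right_mono) auto
    then show ?thesis using main[OF True, of x] by linarith
  next
    case False
    have "2 powr (\<beta> + N / 2) * 2 powr (- (\<beta> + N / 2)) = (1::real)" by (simp add: powr_add[symmetric])
    then have "M \<le> M * 2 powr (\<beta> + N / 2) * 2 powr (- (\<beta> + N / 2))"
      by (simp only: mult.assoc)
    also have "\<dots> \<le> C' * t powr (- (\<beta> + N / 2))"
      using D M_nonneg False t \<beta> by (intro mult_mono powr_mono2') (auto simp: C'_def N_def)
    finally show ?thesis using gradient_bound[of t x] t by linarith
  qed
  moreover have "(\<integral>\<^sup>+x. ennreal (norm (gradient (u t) x)) \<partial>lborel) \<le> ennreal (C' * t powr (- \<beta>))" if "t \<ge> 2" for t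
  proof -
    have "(\<integral>\<^sup>+x. ennreal (norm (gradient (u t) x)) \<partial>lborel) \<le> ennreal (D * t powr (- \<beta>))"
      using main[OF that] by blast
    also have "\<dots> \<le> ennreal (C' * t powr (- \<beta>))"
      using C' by (intro ennreal_leI mult_right_mono) auto
    finally show ?thesis .
  qed
  ultimately show ?thesis using C' unfolding N_def by blast
qed

text \<open>A finite bootstrap from exponent 0 up to \<open>\<theta>\<close>, the exponent at which
  \<open>\<alpha>(q-1)\<close> reaches the cap \<open>1/2\<close>; one further step from
  \<open>\<theta>\<close> gives the heat rates.\<close>

lemma gradient_decay:
  assumes qc: "(real DIM('a) + 1) * (q - 1) > 1"
  shows "\<exists>C\<ge>0. (\<forall>t\<ge>1. \<forall>x. norm (gradient (u t) x) \<le> C * t powr (- (1/2 + real DIM('a) / 2))) \<and>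
     (\<forall>t\<ge>2. (\<integral>\<^sup>+x. ennreal (norm (gradient (u t) x)) \<partial>lborel) \<le> ennreal (C * t powr (- (1/2))))"
proof -
  define N where "N = real DIM('a)"
  define \<theta> where "\<theta> = 1 / (2 * (q - 1))"
  \<comment> \<open>The gain \<open>\<alpha>(q-1) + N/2 - \<alpha>\<close> of a step is affine in
    \<open>\<alpha>\<close>, hence on \<open>[0, \<theta>]\<close> at least the smaller of its end
    point values, which are these two. The second is positive exactly because of
    \<open>qc\<close>.\<close>
  define g where "g = min (N / 2) ((N + 1) / 2 - \<theta>)"
  define P where "P \<alpha> \<longleftrightarrow> (\<exists>C. \<forall>t\<ge>1. \<forall>x. norm (gradient (u t) x) \<le> C * t powr (- \<alpha>))" for \<alpha>
  have N: "N \<ge> 1" by (simp add: N_def)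
  have \<theta>: "\<theta> > 0" "\<theta> * (q - 1) = 1/2" using q_gt_1 by (auto simp: \<theta>_def)
  have "(N + 1) / 2 > \<theta>" using qc q_gt_1 by (simp add: \<theta>_def N_def field_simps)
  then have g: "g > 0" using N by (simp add: g_def)
  have mono: "P b" if a: "P a" and ab: "b \<le> a" for a b
  proof -
    obtain C where C: "\<And>t x. t \<ge> 1 \<Longrightarrow> norm (gradient (u t) x) \<le> C * t powr (- a)" using a unfolding P_def by blast
    have "norm (gradient (u t) x) \<le> max C 0 * t powr (- b)" if t: "t \<ge> 1" for t x
    proof -
      have "norm (gradient (u t) x) \<le> C * t powr (- a)" by (rule C[OF t])
      also have "\<dots> \<le> max C 0 * t powr (- b)" using ab t by (intro mult_mono powr_mono) auto
      finally show ?thesis .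
    qed
    then show ?thesis unfolding P_def by blast
  qed
  have step: "P (\<alpha> * (q - 1) + N / 2)" if P: "P \<alpha>" and \<alpha>: "0 \<le> \<alpha>" "\<alpha> \<le> \<theta>" for \<alpha>
  proof -
    have "\<alpha> * (q - 1) \<le> 1/2" using mult_right_mono[OF \<alpha>(2), of "q - 1"] \<theta> q_gt_1 by simp
    moreover obtain C where C: "\<And>t x. t \<ge> 1 \<Longrightarrow> norm (gradient (u t) x) \<le> C * t powr (- \<alpha>)" using P unfolding P_def by blast
    ultimately show ?thesis
      using decay_step[OF C \<alpha>(1)] unfolding P_def N_def by (metis min.absorb1)
  qed
  have "P (min (real n * g) \<theta>)" for n
  proof (induction n)
    case 0
    have "\<forall>t\<ge>1. \<forall>x. norm (gradient (u t) x) \<le> M * t powr (- 0)" using gradient_bound by auto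
    then show ?case using \<theta> unfolding P_def by auto
  next
    case (Suc n)
    define \<alpha> where "\<alpha> = min (real n * g) \<theta>"
    have \<alpha>: "0 \<le> \<alpha>" "\<alpha> \<le> \<theta>" using g \<theta> by (auto simp: \<alpha>_def)
    have "\<alpha> + g \<le> \<alpha> * (q - 1) + N / 2"
    proof (cases "q - 1 \<ge> 1")
      case True
      then have "\<alpha> * 1 \<le> \<alpha> * (q - 1)" using \<alpha> by (intro mult_left_mono) auto
      then show ?thesis by (simp add: g_def)
    next
      case False
      then have "\<theta> * (q - 1) - \<theta> \<le> \<alpha> * (q - 1) - \<alpha>"
        using mult_right_mono_neg[OF \<alpha>(2), of "q - 1 - 1"] by (simp add: algebra_simps)
      then have "1/2 - \<theta> \<le> \<alpha> * (q - 1) - \<alpha>" using \<theta>(2) by simp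
      moreover have "g \<le> (N + 1) / 2 - \<theta>" by (simp add: g_def)
      ultimately show ?thesis by (simp add: add_divide_distrib)
    qed
    moreover have "min (real (Suc n) * g) \<theta> \<le> \<alpha> + g" using g by (auto simp: \<alpha>_def distrib_right)
    ultimately show ?case
      using step[OF Suc.IH[folded \<alpha>_def] \<alpha>] mono by (meson order.trans)
  qed
  moreover obtain n where "\<theta> / g < real n" using reals_Archimedean2 by blast
  then have "\<theta> \<le> real n * g" using g by (simp add: field_simps)
  ultimately have "P \<theta>" by (metis min.absorb2)
  then obtain C where C: "\<And>t x. t \<ge> 1 \<Longrightarrow> norm (gradient (u t) x) \<le> C * t powr (- \<theta>)" unfolding P_def by blast
  show ?thesis using decay_step[OF C less_imp_le[OF \<theta>(1)]] unfolding \<theta>(2) by simp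
qed

text \<open>Write \<open>F\<close> as the gradient to the power \<open>q - 1\<close> times the
  gradient, and use the sup bound for the first factor and the sup or the \<open>L^1\<close> bound
  for the second. Positive \<open>\<nu>\<close> is the margin over \<open>q_c\<close>: it is the
  gain over the rate \<open>1/s\<close> at which the source would still matter.\<close>

lemma source_decay:
  assumes qc: "(real DIM('a) + 1) * (q - 1) > 1"
  defines "\<nu> \<equiv> ((real DIM('a) + 1) * (q - 1) - 1) / 2"
  shows "\<exists>K\<ge>0. (\<forall>s\<ge>1. \<forall>y. F s y \<le> K * s powr (- (\<nu> + 1 + real DIM('a) / 2))) \<and>
     (\<forall>s\<ge>2. source s \<le> ennreal (K * s powr (- (\<nu> + 1))))"
proof -
  define N where "N = real DIM('a)"
  obtain C where C: "C \<ge> 0" "\<And>t x. t \<ge> 1 \<Longrightarrow> norm (gradient (u t) x) \<le> C * t powr (- (1/2 + N / 2))"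
     "\<And>t. t \<ge> 2 \<Longrightarrow> (\<integral>\<^sup>+x. ennreal (norm (gradient (u t) x)) \<partial>lborel) \<le> ennreal (C * t powr (- (1/2)))"
    using gradient_decay[OF qc] unfolding N_def by blast
  have e1: "- (1/2 + N / 2) * (q - 1) + - (1/2 + N / 2) = - (\<nu> + 1 + N / 2)"
    and e2: "- (1/2 + N / 2) * (q - 1) + - (1/2) = - (\<nu> + 1)"
    by (simp_all add: \<nu>_def N_def field_simps)
  define K where "K = C powr (q - 1) * C"
  have K: "K \<ge> 0" using C(1) by (simp add: K_def)
  have Feq: "F s y = norm (gradient (u s) y) powr (q - 1) * norm (gradient (u s) y)" if "s > 0" for s y
    using that by (cases "gradient (u s) y = 0") (auto simp: F_def powr_diff)
  have q1: "norm (gradient (u s) y) powr (q - 1) \<le> C powr (q - 1) * s powr (- (1/2 + N / 2) * (q - 1))" if s: "s \<ge> 1" for s y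
  proof -
    have "norm (gradient (u s) y) powr (q - 1) \<le> (C * s powr (- (1/2 + N / 2))) powr (q - 1)"
      using C(2)[OF s] q_gt_1 by (intro powr_mono2) auto
    also have "\<dots> = C powr (q - 1) * s powr (- (1/2 + N / 2) * (q - 1))"
      unfolding powr_mult powr_powr ..
    finally show ?thesis .
  qed
  have 1: "F s y \<le> K * s powr (- (\<nu> + 1 + N / 2))" if s: "s \<ge> 1" for s y
  proof -
    have "F s y \<le> (C powr (q - 1) * s powr (- (1/2 + N / 2) * (q - 1))) * (C * s powr (- (1/2 + N / 2)))"
      using s Feq[of s y] q1[OF s, of y] C(2)[OF s, of y] by (auto intro!: mult_mono)
    also have "\<dots> = K * (s powr (- (1/2 + N / 2) * (q - 1)) * s powr (- (1/2 + N / 2)))"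
      by (simp add: K_def mult_ac)
    finally show ?thesis unfolding powr_add[symmetric] e1 .
  qed
  have 2: "source s \<le> ennreal (K * s powr (- (\<nu> + 1)))" if s: "s \<ge> 2" for s
  proof -
    have [measurable]: "gradient (u s) \<in> borel_measurable borel" using s by simp
    define A where "A = C powr (q - 1) * s powr (- (1/2 + N / 2) * (q - 1))"
    have A: "A \<ge> 0" by (simp add: A_def)
    have "source s \<le> (\<integral>\<^sup>+y. ennreal A * ennreal (norm (gradient (u s) y)) \<partial>lborel)"
      unfolding source_def
    proof (rule nn_integral_mono)
      fix y
      have "F s y \<le> A * norm (gradient (u s) y)"
        unfolding A_def using s Feq[of s y] q1[of s y] by (auto intro!: mult_right_mono)
      then show "ennreal (F s y) \<le> ennreal A * ennreal (norm (gradient (u s) y))"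
        using A by (auto simp flip: ennreal_mult intro!: ennreal_leI)
    qed
    also have "\<dots> = ennreal A * (\<integral>\<^sup>+y. ennreal (norm (gradient (u s) y)) \<partial>lborel)"
      by (rule nn_integral_cmult) measurable
    also have "\<dots> \<le> ennreal A * ennreal (C * s powr (- (1/2)))"
      by (intro mult_left_mono C(3) s) simp
    also have "\<dots> = ennreal (K * (s powr (- (1/2 + N / 2) * (q - 1)) * s powr (- (1/2))))"
      using A C(1) by (simp add: A_def K_def mult_ac flip: ennreal_mult)
    finally show ?thesis unfolding powr_add[symmetric] e2 .
  qed
  show ?thesis using K 1 2 unfolding N_def by blast
qed

end

section \<open>Asymptotic profile\<close>

lemma gradient_heat_kernel_inner: "t > 0 \<Longrightarrow> gradient (heat_kernel t) x \<bullet> e = heat_dir e t x"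
  by (simp add: gradient_heat_kernel heat_dir_def)

lemma integrable_heat_dir:
  fixes e x :: "'a::euclidean_space"
  assumes \<sigma>: "\<sigma> > 0" and e: "norm e \<le> 1"
  shows "integrable lborel (\<lambda>y. heat_dir e \<sigma> (x + y))"
proof (rule Bochner_Integration.integrable_bound)
  show "integrable lborel (\<lambda>y. 2 powr (real DIM('a) / 2) * \<sigma> powr (-1/2) * heat_kernel (2 * \<sigma>) (- x - y))"
    using \<sigma> by (intro integrable_mult_right integrable_heat_kernel) simp
  show "AE y in lborel. norm (heat_dir e \<sigma> (x + y)) \<le> norm (2 powr (real DIM('a) / 2) * \<sigma> powr (-1/2) * heat_kernel (2 * \<sigma>) (- x - y))"
  proof (rule AE_I2)
    fix y
    have "heat_kernel (2 * \<sigma>) (- x - y) = heat_kernel (2 * \<sigma>) (x + y)"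
      using heat_kernel_minus[of "2 * \<sigma>" "x + y"] by simp
    then show "norm (heat_dir e \<sigma> (x + y)) \<le> norm (2 powr (real DIM('a) / 2) * \<sigma> powr (-1/2) * heat_kernel (2 * \<sigma>) (- x - y))"
      using heat_dir_bound[OF \<sigma> e, of "x + y"] by (simp add: abs_mult)
  qed
qed measurable

lemma integral_heat_dir:
  fixes e x :: "'a::euclidean_space"
  assumes \<sigma>: "\<sigma> > 0" and e: "norm e \<le> 1"
  shows "(LINT y|lborel. heat_dir e \<sigma> (x + y)) = 0"
proof (rule integral_directional_derivative_eq_0[where F = "\<lambda>y. heat_kernel \<sigma> (x + y)" and e = e])
  show "integrable lborel (\<lambda>y. heat_kernel \<sigma> (x + y))"
  proof -
    have "heat_kernel \<sigma> (- x - y) = heat_kernel \<sigma> (x + y)" for y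
      using heat_kernel_minus[of \<sigma> "x + y"] by simp
    then show ?thesis using integrable_heat_kernel[OF \<sigma>, of "- x"] by (simp only:)
  qed
  show "((\<lambda>h. heat_kernel \<sigma> (x + (y + h *\<^sub>R e))) has_real_derivative heat_dir e \<sigma> (x + y)) (at 0)" for y
    using heat_kernel_deriv_line[OF \<sigma>, of "x + y" e] by (simp add: heat_dir_def add.assoc)
  show "continuous_on UNIV (\<lambda>y. heat_dir e \<sigma> (x + y))"
    using \<sigma> by (intro continuous_intros) auto
qed (rule integrable_heat_dir[OF assms])

text \<open>The semigroup law for a derivative of the kernel, without differentiating under the
  integral: the product is an explicit Gaussian about \<open>x / 2\<close> times a linear function,
  whose value at the centre gives the result and whose odd part integrates to zero.\<close>

lemma integral_heat_dir_heat_kernel: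
  fixes e x :: "'a::euclidean_space"
  assumes \<sigma>: "\<sigma> > 0" and e: "norm e \<le> 1"
  shows "has_bochner_integral lborel (\<lambda>y. heat_dir e \<sigma> (x - y) * heat_kernel \<sigma> y) (heat_dir e (2 * \<sigma>) x)"
proof -
  define x2 where "x2 = (1/2) *\<^sub>R x"
  have eq: "heat_dir e \<sigma> (x - y) * heat_kernel \<sigma> y =
     heat_kernel (2 * \<sigma>) x * (- ((x \<bullet> e) / (4 * \<sigma>)) * heat_kernel (\<sigma> / 2) (x2 - y) - (1/2) * heat_dir e (\<sigma> / 2) (- x2 + y))" for y
  proof -
    have 1: "heat_kernel \<sigma> (x - y) * heat_kernel \<sigma> y = heat_kernel (2 * \<sigma>) x * heat_kernel (\<sigma> / 2) (y - x2)"
    proof -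
      have a: "\<sigma> * \<sigma> / (\<sigma> + \<sigma>) = \<sigma> / 2" "\<sigma> / (\<sigma> + \<sigma>) = 1 / 2" "\<sigma> + \<sigma> = 2 * \<sigma>"
        using \<sigma> by auto
      show ?thesis
        using heat_kernel_mult[OF \<sigma> \<sigma>, of x y] unfolding a(1,2) unfolding a(3) x2_def .
    qed
    have 2: "heat_kernel (\<sigma> / 2) (x2 - y) = heat_kernel (\<sigma> / 2) (y - x2)" by (rule heat_kernel_commute)
    have 3: "(x - y) \<bullet> e = (x \<bullet> e) / 2 - (y - x2) \<bullet> e" by (simp add: x2_def inner_diff_left)
    have "heat_dir e \<sigma> (x - y) * heat_kernel \<sigma> y = - (((x - y) \<bullet> e) / (2 * \<sigma>)) * (heat_kernel \<sigma> (x - y) * heat_kernel \<sigma> y)"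
      by (simp add: heat_dir_def)
    also have "\<dots> = heat_kernel (2 * \<sigma>) x * (- ((x \<bullet> e) / (4 * \<sigma>)) * heat_kernel (\<sigma> / 2) (x2 - y) - (1/2) * heat_dir e (\<sigma> / 2) (y - x2))"
      unfolding 1 2 3 heat_dir_def using \<sigma> by (simp add: field_simps)
    finally show ?thesis by simp
  qed
  have s2: "\<sigma> / 2 > 0" using \<sigma> by simp
  have hd: "has_bochner_integral lborel (\<lambda>y. heat_dir e (\<sigma> / 2) (- x2 + y)) 0"
    using integrable_heat_dir[OF s2 e, of "- x2"] integral_heat_dir[OF s2 e, of "- x2"] by (simp add: has_bochner_integral_iff)
  have "has_bochner_integral lborel (\<lambda>y. heat_dir e \<sigma> (x - y) * heat_kernel \<sigma> y)
     (heat_kernel (2 * \<sigma>) x * (- ((x \<bullet> e) / (4 * \<sigma>)) * 1 - (1/2) * 0))"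
    unfolding eq
    by (intro has_bochner_integral_mult_right has_bochner_integral_diff has_bochner_integral_heat_kernel hd s2)
  then show ?thesis by (simp add: heat_dir_def mult.commute)
qed

context viscous_HJ
begin

lemma absorbed_sup:
  assumes k: "k > 0" and F: "\<And>s y. \<tau> \<le> s \<Longrightarrow> s < t \<Longrightarrow> F s y \<le> \<Phi>"
  shows "absorbed \<kappa> k \<tau> t x \<le> ennreal \<Phi> * (\<integral>\<^sup>+s. indicator {\<tau>..<t} s * ennreal ((t - s) powr (- \<kappa>)) \<partial>lborel)"
proof -
  have "absorbed \<kappa> k \<tau> t x \<le> (\<integral>\<^sup>+s. ennreal \<Phi> * (indicator {\<tau>..<t} s * ennreal ((t - s) powr (- \<kappa>))) \<partial>lborel)"
    unfolding absorbed_def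
  proof (rule nn_integral_mono)
    fix s
    show "indicator {\<tau>..<t} s * ennreal ((t - s) powr (- \<kappa>)) * (\<integral>\<^sup>+y. ennreal (heat_kernel (k * (t - s)) (x - y) * F s y) \<partial>lborel)
      \<le> ennreal \<Phi> * (indicator {\<tau>..<t} s * ennreal ((t - s) powr (- \<kappa>)))"
    proof (cases "s \<in> {\<tau>..<t}")
      case True
      have "(\<integral>\<^sup>+y. ennreal (heat_kernel (k * (t - s)) (x - y) * F s y) \<partial>lborel) \<le>
         (\<integral>\<^sup>+y. ennreal (heat_kernel (k * (t - s)) (x - y)) * ennreal \<Phi> \<partial>lborel)"
        unfolding ennreal_mult[OF heat_kernel_nonneg F_nonneg]
        using F True by (intro nn_integral_mono mult_left_mono ennreal_leI) auto
      also have "\<dots> = ennreal \<Phi>"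
        using True k by (simp add: nn_integral_multc nn_integral_heat_kernel)
      finally have "ennreal ((t - s) powr (- \<kappa>)) * (\<integral>\<^sup>+y. ennreal (heat_kernel (k * (t - s)) (x - y) * F s y) \<partial>lborel) \<le>
          ennreal ((t - s) powr (- \<kappa>)) * ennreal \<Phi>"
        by (rule mult_left_mono) simp
      then show ?thesis using True by (simp add: mult.commute[of "ennreal \<Phi>"])
    qed simp
  qed
  also have "\<dots> = ennreal \<Phi> * (\<integral>\<^sup>+s. indicator {\<tau>..<t} s * ennreal ((t - s) powr (- \<kappa>)) \<partial>lborel)"
    by (rule nn_integral_cmult) measurable
  finally show ?thesis .
qed

definition profile_diff :: "real \<Rightarrow> 'a \<Rightarrow> real" where
  "profile_diff t x = u t x - limit_mass * heat_kernel t x"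

lemma profile_diff_measurable [measurable]: "t \<ge> 0 \<Longrightarrow> profile_diff t \<in> borel_measurable borel"
  unfolding profile_diff_def by measurable

lemma L1_dist_eq: "L1_dist t = (\<integral>\<^sup>+x. ennreal \<bar>profile_diff t x\<bar> \<partial>lborel)"
  by (simp add: L1_dist_def profile_diff_def)

lemma L1_dist_finite:
  assumes t: "t > 0"
  shows "L1_dist t < top"
proof -
  have "integrable lborel (profile_diff t)"
    unfolding profile_diff_def
    using integrable_u[of t] has_bochner_integral_heat_kernel'[OF t, of 0] t
    by (auto simp: has_bochner_integral_iff)
  then have "(\<integral>\<^sup>+x. ennreal (norm (profile_diff t x)) \<partial>lborel) < \<infinity>"
    by (simp add: integrable_iff_bounded)
  then show ?thesis by (simp add: L1_dist_eq)
qed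

text \<open>The heat flow over time \<open>\<tau>\<close> maps the profile at \<open>\<tau>\<close>
  to the profile at \<open>2 * \<tau>\<close>, so the difference evolves by the heat flow up to what
  is absorbed in between.\<close>

lemma profile_step:
  assumes \<tau>: "\<tau> > 0"
  shows "ennreal \<bar>profile_diff (2 * \<tau>) x\<bar> \<le> (\<integral>\<^sup>+y. ennreal (heat_kernel \<tau> (x - y)) * ennreal \<bar>profile_diff \<tau> y\<bar> \<partial>lborel) + absorbed 0 1 \<tau> (2 * \<tau>) x"
proof -
  have [measurable]: "u \<tau> \<in> borel_measurable borel" using \<tau> by simp
  define A where "A = (LINT y|lborel. heat_kernel \<tau> (x - y) * u \<tau> y)"
  have \<tau>2: "0 \<le> \<tau>" "\<tau> < 2 * \<tau>" using \<tau> by auto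
  have 1: "absorbed 0 1 \<tau> (2 * \<tau>) x = ennreal \<bar>u (2 * \<tau>) x - A\<bar>"
    using duhamel_abs[OF \<tau>2, of x] by (simp add: A_def)
  have i1: "integrable lborel (\<lambda>y. heat_kernel \<tau> (x - y) * u \<tau> y)"
    using u_bound[OF \<tau>] by (intro integrable_heat_kernel_mult[OF \<tau>, where C = M]) auto
  have G: "has_bochner_integral lborel (\<lambda>y. heat_kernel \<tau> (x - y) * heat_kernel \<tau> y) (heat_kernel (2 * \<tau>) x)"
    using heat_kernel_semigroup[OF \<tau> \<tau>, of x 0] by (intro has_bochner_integral_nn_integral) auto
  have "A - limit_mass * heat_kernel (2 * \<tau>) x = (LINT y|lborel. heat_kernel \<tau> (x - y) * profile_diff \<tau> y)"
  proof -
    have "(LINT y|lborel. heat_kernel \<tau> (x - y) * profile_diff \<tau> y) =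
       (LINT y|lborel. heat_kernel \<tau> (x - y) * u \<tau> y - limit_mass * (heat_kernel \<tau> (x - y) * heat_kernel \<tau> y))"
      by (simp add: profile_diff_def algebra_simps)
    also have "\<dots> = A - limit_mass * heat_kernel (2 * \<tau>) x"
      using i1 G by (simp add: A_def has_bochner_integral_iff)
    finally show ?thesis by simp
  qed
  then have "ennreal \<bar>A - limit_mass * heat_kernel (2 * \<tau>) x\<bar> \<le> (\<integral>\<^sup>+y. ennreal \<bar>heat_kernel \<tau> (x - y) * profile_diff \<tau> y\<bar> \<partial>lborel)"
    by (simp add: ennreal_abs_integral_le)
  also have "\<dots> = (\<integral>\<^sup>+y. ennreal (heat_kernel \<tau> (x - y)) * ennreal \<bar>profile_diff \<tau> y\<bar> \<partial>lborel)"
    by (simp add: abs_mult ennreal_mult)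
  finally have 2: "ennreal \<bar>A - limit_mass * heat_kernel (2 * \<tau>) x\<bar> \<le> (\<integral>\<^sup>+y. ennreal (heat_kernel \<tau> (x - y)) * ennreal \<bar>profile_diff \<tau> y\<bar> \<partial>lborel)" .
  have "\<bar>profile_diff (2 * \<tau>) x\<bar> \<le> \<bar>A - limit_mass * heat_kernel (2 * \<tau>) x\<bar> + \<bar>u (2 * \<tau>) x - A\<bar>"
    by (simp add: profile_diff_def)
  then have "ennreal \<bar>profile_diff (2 * \<tau>) x\<bar> \<le> ennreal \<bar>A - limit_mass * heat_kernel (2 * \<tau>) x\<bar> + ennreal \<bar>u (2 * \<tau>) x - A\<bar>"
    by (simp add: ennreal_leI flip: ennreal_plus)
  also have "\<dots> \<le> (\<integral>\<^sup>+y. ennreal (heat_kernel \<tau> (x - y)) * ennreal \<bar>profile_diff \<tau> y\<bar> \<partial>lborel) + absorbed 0 1 \<tau> (2 * \<tau>) x"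
    unfolding 1 by (intro add_right_mono 2)
  finally show ?thesis .
qed

definition gradient_diff :: "real \<Rightarrow> 'a \<Rightarrow> 'a" where
  "gradient_diff t x = gradient (u t) x - limit_mass *\<^sub>R gradient (heat_kernel t) x"

text \<open>As for the function itself, with the direction \<open>e\<close> chosen along the
  gradient difference; the derivative falls on the kernel, so the right side involves only the
  profile difference at \<open>\<tau>\<close>.\<close>

lemma gradient_diff_step:
  fixes \<tau> :: real
  defines "c \<equiv> 2 powr (real DIM('a) / 2)"
  assumes \<tau>: "\<tau> > 0"
  shows "ennreal (norm (gradient_diff (2 * \<tau>) x)) \<le>
    ennreal (c * \<tau> powr (-1/2)) * (\<integral>\<^sup>+y. ennreal (heat_kernel (2 * \<tau>) (x - y)) * ennreal \<bar>profile_diff \<tau> y\<bar> \<partial>lborel)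
    + ennreal c * absorbed (1/2) 2 \<tau> (2 * \<tau>) x"
proof -
  have [measurable]: "u \<tau> \<in> borel_measurable borel" using \<tau> by simp
  define v where "v = gradient_diff (2 * \<tau>) x"
  define e where "e = sgn v"
  have e: "norm e \<le> 1" by (simp add: e_def norm_sgn)
  have ve: "v \<bullet> e = norm v"
    by (cases "v = 0") (auto simp: e_def sgn_div_norm power2_norm_eq_inner[symmetric] power2_eq_square)
  define L where "L = (LINT y|lborel. heat_dir e \<tau> (x - y) * u \<tau> y)"
  have i1: "integrable lborel (\<lambda>y. heat_dir e \<tau> (x - y) * u \<tau> y)" by (rule integrable_heat_dir_u[OF \<tau> \<tau> e])
  note G = integral_heat_dir_heat_kernel[OF \<tau> e, of x]
  have "(LINT y|lborel. heat_dir e \<tau> (x - y) * profile_diff \<tau> y) =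
       (LINT y|lborel. heat_dir e \<tau> (x - y) * u \<tau> y - limit_mass * (heat_dir e \<tau> (x - y) * heat_kernel \<tau> y))"
    by (simp add: profile_diff_def algebra_simps)
  also have "\<dots> = L - limit_mass * heat_dir e (2 * \<tau>) x"
    using i1 G by (simp add: L_def has_bochner_integral_iff)
  finally have L: "L - limit_mass * heat_dir e (2 * \<tau>) x = (LINT y|lborel. heat_dir e \<tau> (x - y) * profile_diff \<tau> y)" by simp
  have "norm v = gradient (u (2 * \<tau>)) x \<bullet> e - limit_mass * heat_dir e (2 * \<tau>) x"
    unfolding ve[symmetric] using \<tau>
    by (simp add: v_def gradient_diff_def inner_diff_left gradient_heat_kernel_inner)
  then have "norm v \<le> \<bar>L - limit_mass * heat_dir e (2 * \<tau>) x\<bar> + \<bar>gradient (u (2 * \<tau>)) x \<bullet> e - L\<bar>" by linarith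
  then have "ennreal (norm v) \<le> ennreal \<bar>L - limit_mass * heat_dir e (2 * \<tau>) x\<bar> + ennreal \<bar>gradient (u (2 * \<tau>)) x \<bullet> e - L\<bar>"
    by (simp add: ennreal_leI flip: ennreal_plus)
  also have "\<dots> \<le> ennreal (c * \<tau> powr (-1/2)) * (\<integral>\<^sup>+y. ennreal (heat_kernel (2 * \<tau>) (x - y)) * ennreal \<bar>profile_diff \<tau> y\<bar> \<partial>lborel)
    + ennreal c * absorbed (1/2) 2 \<tau> (2 * \<tau>) x"
  proof (rule add_mono)
    show "ennreal \<bar>L - limit_mass * heat_dir e (2 * \<tau>) x\<bar> \<le> ennreal (c * \<tau> powr (-1/2)) * (\<integral>\<^sup>+y. ennreal (heat_kernel (2 * \<tau>) (x - y)) * ennreal \<bar>profile_diff \<tau> y\<bar> \<partial>lborel)"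
      unfolding L c_def using \<tau> by (intro heat_dir_flow_bound e) auto
    have "0 < \<tau>" "\<tau> < 2 * \<tau>" using \<tau> by auto
    from duhamel_gradient[OF this e, of x]
    show "ennreal \<bar>gradient (u (2 * \<tau>)) x \<bullet> e - L\<bar> \<le> ennreal c * absorbed (1/2) 2 \<tau> (2 * \<tau>) x"
      by (simp add: L_def c_def)
  qed
  finally show ?thesis by (simp add: v_def)
qed

text \<open>The \<open>L^1\<close> distance at time \<open>\<tau>\<close> is turned into the heat
  rates at time \<open>2 * \<tau>\<close> by the smoothing of the kernel; the source on
  \<open>[\<tau>, 2\<tau>]\<close> contributes the same rates times
  \<open>\<tau> powr (- \<nu>)\<close>.\<close>

lemma profile_estimates:
  assumes qc: "(real DIM('a) + 1) * (q - 1) > 1"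
  defines "\<nu> \<equiv> ((real DIM('a) + 1) * (q - 1) - 1) / 2"
  shows "\<exists>K\<ge>1. \<forall>\<tau>\<ge>2.
     (\<forall>x. \<bar>profile_diff (2 * \<tau>) x\<bar> \<le> K * \<tau> powr (- (real DIM('a) / 2)) * (enn2real (L1_dist \<tau>) + \<tau> powr (- \<nu>))) \<and>
     (\<forall>x. norm (gradient_diff (2 * \<tau>) x) \<le> K * \<tau> powr (- (1/2 + real DIM('a) / 2)) * (enn2real (L1_dist \<tau>) + \<tau> powr (- \<nu>))) \<and>
     (\<integral>\<^sup>+x. ennreal (norm (gradient_diff (2 * \<tau>) x)) \<partial>lborel) \<le> ennreal (K * \<tau> powr (- (1/2)) * (enn2real (L1_dist \<tau>) + \<tau> powr (- \<nu>)))"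
proof -
  define N where "N = real DIM('a)"
  define c where "c = 2 powr (real DIM('a) / 2)"
  have c: "c \<ge> 1" unfolding c_def by (intro ge_one_powr_ge_zero) auto
  obtain K where K: "K \<ge> 0" "\<And>s y. s \<ge> 1 \<Longrightarrow> F s y \<le> K * s powr (- (\<nu> + 1 + N / 2))"
     "\<And>s. s \<ge> 2 \<Longrightarrow> source s \<le> ennreal (K * s powr (- (\<nu> + 1)))"
    using source_decay[OF qc] unfolding N_def \<nu>_def by blast
  have \<nu>: "\<nu> > 0" using qc by (simp add: \<nu>_def)
  define K1 where "K1 = c * (1 + 2 * K)"
  have cK: "c \<le> K1" "c * (2 * K) \<le> K1" "1 \<le> K1" "K \<le> K1"
  proof -
    have "1 * (1 + 2 * K) \<le> K1" unfolding K1_def using c K(1) by (intro mult_right_mono) auto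
    then show "1 \<le> K1" "K \<le> K1" using K(1) by auto
    show "c \<le> K1" "c * (2 * K) \<le> K1" unfolding K1_def using c K(1) by (auto simp: distrib_left)
  qed
  have "(\<forall>x. \<bar>profile_diff (2 * \<tau>) x\<bar> \<le> K1 * \<tau> powr (- (N / 2)) * (enn2real (L1_dist \<tau>) + \<tau> powr (- \<nu>))) \<and>
     (\<forall>x. norm (gradient_diff (2 * \<tau>) x) \<le> K1 * \<tau> powr (- (1/2 + N / 2)) * (enn2real (L1_dist \<tau>) + \<tau> powr (- \<nu>))) \<and>
     (\<integral>\<^sup>+x. ennreal (norm (gradient_diff (2 * \<tau>) x)) \<partial>lborel) \<le> ennreal (K1 * \<tau> powr (- (1/2)) * (enn2real (L1_dist \<tau>) + \<tau> powr (- \<nu>)))"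
    if \<tau>: "\<tau> \<ge> 2" for \<tau>
  proof -
    define d where "d = enn2real (L1_dist \<tau>)"
    have d: "d \<ge> 0" "L1_dist \<tau> = ennreal d"
      using L1_dist_finite[of \<tau>] \<tau> by (auto simp: d_def)
    have [measurable]: "profile_diff \<tau> \<in> borel_measurable borel" using \<tau> by simp
    \<comment> \<open>Bounds the source from time \<open>\<tau>\<close> on. Time integration
      multiplies it by \<open>\<tau>\<close> for the function and by \<open>2 * sqrt \<tau>\<close>
      for the gradient, which leaves the heat rate times \<open>\<tau> powr (- \<nu>)\<close> in
      both cases.\<close>
    define \<Phi> where "\<Phi> = K * \<tau> powr (- (\<nu> + 1 + N / 2))"
    have \<Phi>0: "\<Phi> \<ge> 0" using K(1) by (simp add: \<Phi>_def)
    have \<Phi>: "F s y \<le> \<Phi>" if "\<tau> \<le> s" for s y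
    proof -
      have "F s y \<le> K * s powr (- (\<nu> + 1 + N / 2))" using that \<tau> by (intro K(2)) auto
      also have "\<dots> \<le> \<Phi>" unfolding \<Phi>_def using that \<tau> \<nu> K(1) by (intro mult_left_mono powr_mono2') (auto simp: N_def)
      finally show ?thesis .
    qed
    have half: "(\<integral>\<^sup>+s. indicator {\<tau>..<2 * \<tau>} s * ennreal ((2 * \<tau> - s) powr (- (1/2))) \<partial>lborel) = ennreal (2 * \<tau> powr (1/2))"
      using nn_integral_inverse_sqrt_right[of \<tau> "2 * \<tau>"] \<tau> by (simp add: powr_half_sqrt)
    have zero: "(\<integral>\<^sup>+s. indicator {\<tau>..<2 * \<tau>} s * ennreal ((2 * \<tau> - s) powr (- 0)) \<partial>lborel) = ennreal \<tau>"
    proof -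
      have "(\<integral>\<^sup>+s. indicator {\<tau>..<2 * \<tau>} s * ennreal ((2 * \<tau> - s) powr (- 0)) \<partial>lborel) = (\<integral>\<^sup>+s. indicator {\<tau>..<2 * \<tau>} s \<partial>lborel)"
        by (intro nn_integral_cong) (auto simp: indicator_def)
      also have "\<dots> = ennreal \<tau>" using \<tau> by simp
      finally show ?thesis .
    qed
    have pb: "(4 * pi * r) powr (- N / 2) \<le> \<tau> powr (- (N / 2))" if "r \<ge> \<tau>" for r
    proof -
      have "1 * \<tau> \<le> 4 * pi * r" using that \<tau> pi_ge_two by (intro mult_mono) auto
      then have "(4 * pi * r) powr (- N / 2) \<le> \<tau> powr (- N / 2)" using \<tau> by (intro powr_mono2') (auto simp: N_def)
      then show ?thesis by simp
    qed
    define E where "E = d + \<tau> powr (- \<nu>)"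
    have E: "E \<ge> 0" using d by (simp add: E_def)
    have 1: "\<bar>profile_diff (2 * \<tau>) x\<bar> \<le> K1 * \<tau> powr (- (N / 2)) * E" for x
    proof -
      have "ennreal \<bar>profile_diff (2 * \<tau>) x\<bar> \<le> ennreal ((4 * pi * \<tau>) powr (- N / 2)) * ennreal d + ennreal \<Phi> * ennreal \<tau>"
      proof (rule order.trans[OF profile_step add_mono])
        show "(\<integral>\<^sup>+y. ennreal (heat_kernel \<tau> (x - y)) * ennreal \<bar>profile_diff \<tau> y\<bar> \<partial>lborel) \<le> ennreal ((4 * pi * \<tau>) powr (- N / 2)) * ennreal d"
          using heat_flow_le[of "\<lambda>y. ennreal \<bar>profile_diff \<tau> y\<bar>" \<tau> x] \<tau> unfolding d(2)[symmetric] L1_dist_eq N_def by simp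
        show "absorbed 0 1 \<tau> (2 * \<tau>) x \<le> ennreal \<Phi> * ennreal \<tau>"
          using absorbed_sup[of 1 \<tau> "2 * \<tau>" \<Phi> 0 x] \<Phi> unfolding zero by simp
      qed (use \<tau> in simp)
      also have "\<dots> = ennreal ((4 * pi * \<tau>) powr (- N / 2) * d + \<Phi> * \<tau>)"
        using d \<Phi>0 \<tau> by (simp flip: ennreal_mult ennreal_plus)
      finally have "\<bar>profile_diff (2 * \<tau>) x\<bar> \<le> (4 * pi * \<tau>) powr (- N / 2) * d + \<Phi> * \<tau>"
        using d \<Phi>0 \<tau> by (subst (asm) ennreal_le_iff) auto
      also have "\<Phi> * \<tau> = K * (\<tau> powr (- (\<nu> + 1 + N / 2)) * \<tau> powr 1)" using \<tau> by (simp add: \<Phi>_def)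
      also have "\<dots> = K * (\<tau> powr (- (N / 2)) * \<tau> powr (- \<nu>))"
        unfolding powr_add[symmetric] by (rule arg_cong[where f="\<lambda>r. K * \<tau> powr r"]) simp
      also have "(4 * pi * \<tau>) powr (- N / 2) * d + K * (\<tau> powr (- (N / 2)) * \<tau> powr (- \<nu>)) \<le>
          K1 * (\<tau> powr (- (N / 2)) * d) + K1 * (\<tau> powr (- (N / 2)) * \<tau> powr (- \<nu>))"
      proof (rule add_mono)
        have "(4 * pi * \<tau>) powr (- N / 2) * d \<le> \<tau> powr (- (N / 2)) * d" by (intro mult_right_mono pb d) simp
        also have "\<dots> \<le> K1 * (\<tau> powr (- (N / 2)) * d)" using mult_right_mono[OF cK(3), of "\<tau> powr (- (N / 2)) * d"] d by simp
        finally show "(4 * pi * \<tau>) powr (- N / 2) * d \<le> K1 * (\<tau> powr (- (N / 2)) * d)" .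
        show "K * (\<tau> powr (- (N / 2)) * \<tau> powr (- \<nu>)) \<le> K1 * (\<tau> powr (- (N / 2)) * \<tau> powr (- \<nu>))"
          using cK by (intro mult_right_mono) auto
      qed
      finally show ?thesis by (simp add: E_def distrib_left mult.assoc)
    qed
    have 2: "norm (gradient_diff (2 * \<tau>) x) \<le> K1 * \<tau> powr (- (1/2 + N / 2)) * E" for x
    proof -
      have "ennreal (norm (gradient_diff (2 * \<tau>) x)) \<le> ennreal (c * \<tau> powr (-1/2)) * (ennreal ((4 * pi * (2 * \<tau>)) powr (- N / 2)) * ennreal d)
          + ennreal c * (ennreal \<Phi> * ennreal (2 * \<tau> powr (1/2)))"
      proof (rule order.trans[OF gradient_diff_step, folded c_def, OF _ add_mono])
        show "ennreal (c * \<tau> powr (-1/2)) * (\<integral>\<^sup>+y. ennreal (heat_kernel (2 * \<tau>) (x - y)) * ennreal \<bar>profile_diff \<tau> y\<bar> \<partial>lborel) \<le>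
           ennreal (c * \<tau> powr (-1/2)) * (ennreal ((4 * pi * (2 * \<tau>)) powr (- N / 2)) * ennreal d)"
          using heat_flow_le[of "\<lambda>y. ennreal \<bar>profile_diff \<tau> y\<bar>" "2 * \<tau>" x] \<tau> unfolding d(2)[symmetric] L1_dist_eq N_def
          by (intro mult_left_mono) auto
        show "ennreal c * absorbed (1/2) 2 \<tau> (2 * \<tau>) x \<le> ennreal c * (ennreal \<Phi> * ennreal (2 * \<tau> powr (1/2)))"
          using absorbed_sup[of 2 \<tau> "2 * \<tau>" \<Phi> "1/2" x] \<Phi> unfolding half by (intro mult_left_mono) auto
      qed (use \<tau> in simp)
      also have "\<dots> = ennreal (c * \<tau> powr (-1/2) * ((4 * pi * (2 * \<tau>)) powr (- N / 2) * d) + c * (\<Phi> * (2 * \<tau> powr (1/2))))"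
        using d \<Phi>0 c by (simp flip: ennreal_mult ennreal_plus)
      finally have "norm (gradient_diff (2 * \<tau>) x) \<le> c * \<tau> powr (-1/2) * ((4 * pi * (2 * \<tau>)) powr (- N / 2) * d) + c * (\<Phi> * (2 * \<tau> powr (1/2)))"
        using d \<Phi>0 c by (subst (asm) ennreal_le_iff) auto
      also have "c * (\<Phi> * (2 * \<tau> powr (1/2))) = c * (2 * K) * (\<tau> powr (- (\<nu> + 1 + N / 2)) * \<tau> powr (1/2))"
        by (simp add: \<Phi>_def)
      also have "\<dots> = c * (2 * K) * (\<tau> powr (- (1/2 + N / 2)) * \<tau> powr (- \<nu>))"
        unfolding powr_add[symmetric] by (rule arg_cong[where f="\<lambda>r. c * (2 * K) * \<tau> powr r"]) simp
      also have "c * \<tau> powr (-1/2) * ((4 * pi * (2 * \<tau>)) powr (- N / 2) * d) + c * (2 * K) * (\<tau> powr (- (1/2 + N / 2)) * \<tau> powr (- \<nu>)) \<le>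
          K1 * (\<tau> powr (- (1/2 + N / 2)) * d) + K1 * (\<tau> powr (- (1/2 + N / 2)) * \<tau> powr (- \<nu>))"
      proof (rule add_mono)
        have "c * \<tau> powr (-1/2) * ((4 * pi * (2 * \<tau>)) powr (- N / 2) * d) \<le> K1 * \<tau> powr (-1/2) * (\<tau> powr (- (N / 2)) * d)"
          using cK c d \<tau> by (intro mult_mono pb) auto
        also have "\<dots> = K1 * (\<tau> powr (-1/2) * \<tau> powr (- (N / 2)) * d)" by simp
        also have "\<tau> powr (-1/2) * \<tau> powr (- (N / 2)) = \<tau> powr (- (1/2 + N / 2))" unfolding powr_add[symmetric] by simp
        finally show "c * \<tau> powr (-1/2) * ((4 * pi * (2 * \<tau>)) powr (- N / 2) * d) \<le> K1 * (\<tau> powr (- (1/2 + N / 2)) * d)" .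
        show "c * (2 * K) * (\<tau> powr (- (1/2 + N / 2)) * \<tau> powr (- \<nu>)) \<le> K1 * (\<tau> powr (- (1/2 + N / 2)) * \<tau> powr (- \<nu>))"
          using cK by (intro mult_right_mono) auto
      qed
      finally show ?thesis by (simp add: E_def distrib_left mult.assoc)
    qed
    have 3: "(\<integral>\<^sup>+x. ennreal (norm (gradient_diff (2 * \<tau>) x)) \<partial>lborel) \<le> ennreal (K1 * \<tau> powr (- (1/2)) * E)"
    proof -
      define S where "S = K * \<tau> powr (- (\<nu> + 1))"
      have S0: "S \<ge> 0" using K(1) by (simp add: S_def)
      have src: "source s \<le> ennreal S" if "\<tau> \<le> s" for s
      proof -
        have "source s \<le> ennreal (K * s powr (- (\<nu> + 1)))" using that \<tau> by (intro K(3)) simp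
        also have "\<dots> \<le> ennreal S"
          unfolding S_def using that \<tau> \<nu> K(1) by (intro ennreal_leI mult_left_mono powr_mono2') auto
        finally show ?thesis .
      qed
      have "(\<integral>\<^sup>+x. ennreal (norm (gradient_diff (2 * \<tau>) x)) \<partial>lborel) \<le>
        (\<integral>\<^sup>+x. ennreal (c * \<tau> powr (-1/2)) * (\<integral>\<^sup>+y. ennreal (heat_kernel (2 * \<tau>) (x - y)) * ennreal \<bar>profile_diff \<tau> y\<bar> \<partial>lborel)
         + ennreal c * absorbed (1/2) 2 \<tau> (2 * \<tau>) x \<partial>lborel)"
        unfolding c_def using \<tau> by (intro nn_integral_mono gradient_diff_step) simp
      also have "\<dots> = ennreal (c * \<tau> powr (-1/2)) * L1_dist \<tau> + ennreal c * (\<integral>\<^sup>+x. absorbed (1/2) 2 \<tau> (2 * \<tau>) x \<partial>lborel)"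
        using \<tau> by (simp add: nn_integral_add nn_integral_cmult nn_integral_heat_flow L1_dist_eq)
      also have "(\<integral>\<^sup>+x. absorbed (1/2) 2 \<tau> (2 * \<tau>) x \<partial>lborel) =
          (\<integral>\<^sup>+s. indicator {\<tau>..<2 * \<tau>} s * ennreal ((2 * \<tau> - s) powr (- (1/2))) * source s \<partial>lborel)"
        by (rule absorbed_L1) simp
      also have "\<dots> \<le> (\<integral>\<^sup>+s. ennreal S * (indicator {\<tau>..<2 * \<tau>} s * ennreal ((2 * \<tau> - s) powr (- (1/2)))) \<partial>lborel)"
        by (intro nn_integral_mono) (auto simp: indicator_def mult.commute[of "ennreal S"] intro!: mult_left_mono src)
      also have "\<dots> = ennreal S * ennreal (2 * \<tau> powr (1/2))"
        unfolding half[symmetric] by (rule nn_integral_cmult) measurable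
      also have "ennreal (c * \<tau> powr (-1/2)) * L1_dist \<tau> + ennreal c * (ennreal S * ennreal (2 * \<tau> powr (1/2))) =
          ennreal (c * \<tau> powr (-1/2) * d + c * (S * (2 * \<tau> powr (1/2))))"
        unfolding d(2) using d(1) S0 c by (simp flip: ennreal_mult ennreal_plus)
      also have "\<dots> \<le> ennreal (K1 * \<tau> powr (- (1/2)) * E)"
      proof (rule ennreal_leI)
        have "c * (S * (2 * \<tau> powr (1/2))) = c * (2 * K) * (\<tau> powr (- (\<nu> + 1)) * \<tau> powr (1/2))"
          by (simp add: S_def)
        also have "\<dots> = c * (2 * K) * (\<tau> powr (- (1/2)) * \<tau> powr (- \<nu>))"
          unfolding powr_add[symmetric] by (rule arg_cong[where f="\<lambda>r. c * (2 * K) * \<tau> powr r"]) simp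
        also have "\<dots> \<le> K1 * (\<tau> powr (- (1/2)) * \<tau> powr (- \<nu>))" using cK by (intro mult_right_mono) auto
        finally have "c * (S * (2 * \<tau> powr (1/2))) \<le> K1 * (\<tau> powr (- (1/2)) * \<tau> powr (- \<nu>))" .
        moreover have "c * \<tau> powr (-1/2) * d \<le> K1 * \<tau> powr (-1/2) * d"
          using cK d by (intro mult_right_mono) auto
        ultimately show "c * \<tau> powr (-1/2) * d + c * (S * (2 * \<tau> powr (1/2))) \<le> K1 * \<tau> powr (- (1/2)) * E"
          by (simp add: E_def distrib_left mult.assoc)
      qed
      finally show ?thesis by (simp add: add_left_mono mult_left_mono)
    qed
    show ?thesis using 1 2 3 unfolding E_def d_def by blast
  qed
  then show ?thesis using cK(3) unfolding N_def by blast
qed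

end

text \<open>For finite exponent \<open>r\<close>, \<open>|f|^r \<le> S^(r-1) |f|\<close>. Strict
  positivity of \<open>A\<close> and \<open>S\<close> makes \<open>powr 0\<close> equal to 1 at the
  end points \<open>p = \<infinity>\<close> and \<open>p = 1\<close>, since \<open>0 powr 0\<close>
  is 0.\<close>

lemma Lp_norm_interpolation:
  fixes f :: "'a::euclidean_space \<Rightarrow> 'b::{real_normed_vector, second_countable_topology}"
  assumes [measurable]: "f \<in> borel_measurable borel" and S: "S > 0" "\<And>x. norm (f x) \<le> S"
    and A: "A > 0" "(\<integral>\<^sup>+x. ennreal (norm (f x)) \<partial>lborel) \<le> ennreal A" and p: "p \<ge> 1"
  shows "Lp_norm p f \<le> ennreal (A powr (enn2real (1 / p)) * S powr (1 - enn2real (1 / p)))"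
proof (cases "p = \<infinity>")
  case True
  have "esssup lebesgue (\<lambda>x. ennreal (norm (f x))) \<le> ennreal S"
    using S by (intro esssup_I measurable_completion) (auto intro!: ennreal_leI)
  then show ?thesis using True S A by (simp add: Lp_norm_def)
next
  case False
  then obtain r where r: "p = ennreal r" "r \<ge> 1"
    using p by (cases p) (auto simp: ennreal_ge_1)
  have inv: "enn2real (1 / p) = 1 / r"
    using r divide_ennreal[of 1 r] by (simp flip: ennreal_1)
  have pr: "enn2real p = r" using r by simp
  define J where "J = (\<integral>\<^sup>+x. ennreal (norm (f x) powr r) \<partial>lebesgue)"
  have "J = (\<integral>\<^sup>+x. ennreal (norm (f x) powr r) \<partial>lborel)"
    unfolding J_def by (rule nn_integral_completion)
  also have "\<dots> \<le> (\<integral>\<^sup>+x. ennreal (S powr (r - 1)) * ennreal (norm (f x)) \<partial>lborel)"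
  proof (rule nn_integral_mono)
    fix x
    have "norm (f x) powr r = norm (f x) powr (r - 1) * norm (f x)"
      by (cases "f x = 0") (auto simp: powr_diff)
    also have "\<dots> \<le> S powr (r - 1) * norm (f x)"
      using S(2)[of x] r by (intro mult_right_mono powr_mono2) auto
    finally show "ennreal (norm (f x) powr r) \<le> ennreal (S powr (r - 1)) * ennreal (norm (f x))"
      by (simp add: ennreal_leI flip: ennreal_mult)
  qed
  also have "\<dots> \<le> ennreal (S powr (r - 1)) * ennreal A"
    using A by (subst nn_integral_cmult) (auto intro!: mult_left_mono)
  also have "\<dots> = ennreal (S powr (r - 1) * A)" using A by (simp add: ennreal_mult)
  finally have J: "J \<le> ennreal (S powr (r - 1) * A)" .
  then have fin: "J \<noteq> \<infinity>" by (auto simp: top_unique)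
  have "enn2real J \<le> S powr (r - 1) * A"
    using J A by (intro enn2real_leI) auto
  then have "enn2real J powr (1 / r) \<le> (S powr (r - 1) * A) powr (1 / r)"
    using r by (intro powr_mono2) auto
  also have "\<dots> = A powr (1 / r) * S powr (1 - 1 / r)"
    using r by (simp add: powr_mult powr_powr diff_divide_distrib)
  finally show ?thesis
    unfolding inv using False fin by (simp add: Lp_norm_def pr Let_def J_def[symmetric] ennreal_leI)
qed

text \<open>With \<open>r = 1/p\<close> the interpolated power is
  \<open>\<kappa> r + (\<kappa> + N/2)(1 - r)\<close>, which is exactly
  \<open>\<kappa> + decay_exponent\<close>. The weight cancels it and leaves \<open>E t\<close>,
  required positive for the sake of \<open>powr\<close>.\<close>

lemma Lp_norm_decay:
  fixes f :: "real \<Rightarrow> 'a::euclidean_space \<Rightarrow> 'b::{real_normed_vector, second_countable_topology}"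
  assumes meas: "\<And>t. t \<ge> T \<Longrightarrow> f t \<in> borel_measurable borel"
    and sup: "\<And>t x. t \<ge> T \<Longrightarrow> norm (f t x) \<le> t powr (- (\<kappa> + real DIM('a) / 2)) * E t"
    and L1: "\<And>t. t \<ge> T \<Longrightarrow> (\<integral>\<^sup>+x. ennreal (norm (f t x)) \<partial>lborel) \<le> ennreal (t powr (- \<kappa>) * E t)"
    and E: "\<And>t. t \<ge> T \<Longrightarrow> E t > 0" "(E \<longlongrightarrow> 0) at_top" and p: "p \<ge> 1"
  shows "((\<lambda>t. ennreal (t powr (decay_exponent DIM('a) p + \<kappa>)) * Lp_norm p (f t)) \<longlongrightarrow> 0) at_top"
proof (rule tendsto_sandwich[where f = "\<lambda>_. 0" and h = "\<lambda>t. ennreal (E t)"])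
  define r where "r = enn2real (1 / p)"
  show "\<forall>\<^sub>F t in at_top. ennreal (t powr (decay_exponent DIM('a) p + \<kappa>)) * Lp_norm p (f t) \<le> ennreal (E t)"
    using eventually_ge_at_top[of "max T 1"]
  proof eventually_elim
    case (elim t)
    define N where "N = real DIM('a)"
    have t: "t \<ge> T" "t > 0" using elim by auto
    have ET: "E t > 0" using E(1)[OF t(1)] .
    have "Lp_norm p (f t) \<le> ennreal ((t powr (- \<kappa>) * E t) powr r * (t powr (- (\<kappa> + N / 2)) * E t) powr (1 - r))"
      unfolding r_def N_def using t ET by (intro Lp_norm_interpolation meas sup L1 p) auto
    also have "(t powr (- \<kappa>) * E t) powr r * (t powr (- (\<kappa> + N / 2)) * E t) powr (1 - r) =
        (t powr (- \<kappa> * r) * t powr (- (\<kappa> + N / 2) * (1 - r))) * (E t powr r * E t powr (1 - r))"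
      unfolding powr_mult powr_powr by (simp add: mult_ac)
    also have "E t powr r * E t powr (1 - r) = E t"
      using ET by (simp add: powr_add[symmetric])
    finally have "Lp_norm p (f t) \<le> ennreal ((t powr (- \<kappa> * r) * t powr (- (\<kappa> + N / 2) * (1 - r))) * E t)" .
    then have "ennreal (t powr (decay_exponent DIM('a) p + \<kappa>)) * Lp_norm p (f t) \<le>
       ennreal (t powr (decay_exponent DIM('a) p + \<kappa>)) * ennreal ((t powr (- \<kappa> * r) * t powr (- (\<kappa> + N / 2) * (1 - r))) * E t)"
      by (rule mult_left_mono) simp
    also have "\<dots> = ennreal ((t powr (decay_exponent DIM('a) p + \<kappa>) * (t powr (- \<kappa> * r) * t powr (- (\<kappa> + N / 2) * (1 - r)))) * E t)"
      using ET by (simp add: mult.assoc flip: ennreal_mult)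
    also have "t powr (decay_exponent DIM('a) p + \<kappa>) * (t powr (- \<kappa> * r) * t powr (- (\<kappa> + N / 2) * (1 - r))) = 1"
    proof -
      have "decay_exponent DIM('a) p + \<kappa> + (- \<kappa> * r + - (\<kappa> + N / 2) * (1 - r)) = 0"
        by (simp add: decay_exponent_def r_def N_def algebra_simps)
      then show ?thesis unfolding powr_add[symmetric] using t by simp
    qed
    finally show ?case by simp
  qed
  show "((\<lambda>t. ennreal (E t)) \<longlongrightarrow> 0) at_top"
    using tendsto_ennrealI[OF E(2)] by simp
qed (auto intro: always_eventually)

context viscous_HJ
begin

section \<open>Space-time integrability of the source, and convergence in every
  \<open>L^p\<close>\<close>

lemma integrable_F_pair: "integrable (lborel \<Otimes>\<^sub>M lborel) (\<lambda>p. F (fst p) (snd p))"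
  and nn_integral_F_pair: "(\<integral>\<^sup>+p. ennreal (F (fst p) (snd p)) \<partial>(lborel \<Otimes>\<^sub>M lborel)) = tail 0"
proof -
  show eq: "(\<integral>\<^sup>+p. ennreal (F (fst p) (snd p)) \<partial>(lborel \<Otimes>\<^sub>M lborel)) = tail 0"
  proof -
    have "(\<integral>\<^sup>+s. (\<integral>\<^sup>+y. ennreal (F (fst (s, y)) (snd (s, y))) \<partial>lborel) \<partial>lborel) = (\<integral>\<^sup>+p. ennreal (F (fst p) (snd p)) \<partial>(lborel \<Otimes>\<^sub>M lborel))"
      by (rule lborel.nn_integral_fst) measurable
    moreover have "(\<integral>\<^sup>+s. (\<integral>\<^sup>+y. ennreal (F (fst (s, y)) (snd (s, y))) \<partial>lborel) \<partial>lborel) = tail 0"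
      unfolding tail_def by (intro nn_integral_cong) (auto simp: indicator_def source_def F_def)
    ultimately show ?thesis by simp
  qed
  have "tail 0 < \<infinity>" using tail_0_le by (rule order.strict_trans1) simp
  then show "integrable (lborel \<Otimes>\<^sub>M lborel) (\<lambda>p. F (fst p) (snd p))"
    using eq by (intro integrableI_nonneg) auto
qed

lemma iterated_integral_F: "(LINT s|lborel. (LINT y|lborel. F s y)) = enn2real (tail 0)"
proof -
  have "(LINT s|lborel. (LINT y|lborel. F s y)) = (LINT p|(lborel \<Otimes>\<^sub>M lborel). F (fst p) (snd p))"
    using lborel_pair.integral_fst'[OF integrable_F_pair] by simp
  also have "\<dots> = enn2real (tail 0)"
    unfolding nn_integral_F_pair[symmetric] by (rule integral_eq_nn_integral) auto
  finally show ?thesis .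
qed

lemma Lp_asymptotics:
  assumes qc: "(real DIM('a) + 1) * (q - 1) > 1" and p: "p \<ge> 1"
  shows "((\<lambda>t. ennreal (t powr decay_exponent DIM('a) p) * Lp_norm p (profile_diff t)) \<longlongrightarrow> 0) at_top"
    and "((\<lambda>t. ennreal (t powr (decay_exponent DIM('a) p + 1 / 2)) * Lp_norm p (gradient_diff t)) \<longlongrightarrow> 0) at_top"
proof -
  define N where "N = real DIM('a)"
  define \<nu> where "\<nu> = ((real DIM('a) + 1) * (q - 1) - 1) / 2"
  have \<nu>: "\<nu> > 0" using qc by (simp add: \<nu>_def)
  define d where "d t = enn2real (L1_dist t)" for t
  have d0: "d t \<ge> 0" for t by (simp add: d_def)
  have dlim: "(d \<longlongrightarrow> 0) at_top"
    unfolding d_def using tendsto_enn2real[of L1_dist 0 at_top] L1_dist_tendsto_0 by simp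
  obtain K where K: "K \<ge> 1"
    "\<And>\<tau> x. \<tau> \<ge> 2 \<Longrightarrow> \<bar>profile_diff (2 * \<tau>) x\<bar> \<le> K * \<tau> powr (- (N / 2)) * (d \<tau> + \<tau> powr (- \<nu>))"
    "\<And>\<tau> x. \<tau> \<ge> 2 \<Longrightarrow> norm (gradient_diff (2 * \<tau>) x) \<le> K * \<tau> powr (- (1/2 + N / 2)) * (d \<tau> + \<tau> powr (- \<nu>))"
    "\<And>\<tau>. \<tau> \<ge> 2 \<Longrightarrow> (\<integral>\<^sup>+x. ennreal (norm (gradient_diff (2 * \<tau>) x)) \<partial>lborel) \<le> ennreal (K * \<tau> powr (- (1/2)) * (d \<tau> + \<tau> powr (- \<nu>)))"
    using profile_estimates[OF qc] unfolding N_def d_def \<nu>_def by blast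
  \<comment> \<open>Passing from \<open>\<tau> = t / 2\<close> to \<open>t\<close> costs
    \<open>2 powr a\<close>; the largest exponent \<open>a\<close> that occurs is
    \<open>1/2 + N / 2\<close>. In \<open>E\<close> the summand \<open>d t\<close> serves the
    \<open>L^1\<close> bound of the profile, used at time \<open>t\<close> itself, and the power of
    \<open>t / 2\<close> makes \<open>E\<close> positive.\<close>
  define B where "B = K * 2 powr (1/2 + N / 2)"
  define E where "E t = d t + B * (d (t / 2) + (t / 2) powr (- \<nu>))" for t
  have B: "B \<ge> K * 2 powr a" "B > 0" if "a \<le> 1/2 + N / 2" for a
    using that K(1) by (auto simp: B_def intro!: mult_left_mono powr_mono)
  have Epos: "E t > 0" if "t \<ge> 4" for t
    unfolding E_def using d0[of t] d0[of "t / 2"] B(2)[of 0] that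
    by (intro add_nonneg_pos mult_pos_pos) (auto simp: N_def)
  have half: "filterlim (\<lambda>t::real. t / 2) at_top at_top" by real_asymp
  have "((\<lambda>t. d (t / 2)) \<longlongrightarrow> 0) at_top" by (rule filterlim_compose[OF dlim half])
  moreover have "((\<lambda>t. (t / 2) powr (- \<nu>)) \<longlongrightarrow> 0) at_top"
    by (rule tendsto_neg_powr[OF _ half]) (use \<nu> in simp)
  ultimately have "(E \<longlongrightarrow> 0 + B * (0 + 0)) at_top"
    unfolding E_def by (intro tendsto_intros dlim)
  then have Elim: "(E \<longlongrightarrow> 0) at_top" by simp
  have conv: "K * (t / 2) powr (- a) * (d (t / 2) + (t / 2) powr (- \<nu>)) \<le> t powr (- a) * E t"
    if t: "t \<ge> 4" and a: "a \<le> 1/2 + N / 2" for t a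
  proof -
    have "K * (t / 2) powr (- a) = t powr (- a) * (K * 2 powr a)"
      using t by (simp add: powr_divide powr_minus divide_simps)
    also have "\<dots> \<le> t powr (- a) * B" using B(1)[OF a] by (intro mult_left_mono) auto
    finally have "K * (t / 2) powr (- a) * (d (t / 2) + (t / 2) powr (- \<nu>)) \<le> t powr (- a) * B * (d (t / 2) + (t / 2) powr (- \<nu>))"
      using d0 by (intro mult_right_mono) auto
    also have "\<dots> \<le> t powr (- a) * E t"
      unfolding E_def mult.assoc using d0 by (intro mult_left_mono) auto
    finally show ?thesis .
  qed
  have "((\<lambda>t. ennreal (t powr (decay_exponent DIM('a) p + 0)) * Lp_norm p (profile_diff t)) \<longlongrightarrow> 0) at_top"
  proof (rule Lp_norm_decay[where T = 4 and E = E])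
    show "norm (profile_diff t x) \<le> t powr (- (0 + real DIM('a) / 2)) * E t" if "t \<ge> 4" for t x
      using K(2)[of "t / 2" x] conv[OF that, of "N / 2"] that by (simp add: N_def)
    show "(\<integral>\<^sup>+x. ennreal (norm (profile_diff t x)) \<partial>lborel) \<le> ennreal (t powr (- 0) * E t)" if "t \<ge> 4" for t
    proof -
      have "d t \<le> E t" unfolding E_def using d0[of "t / 2"] B(2)[of 0] by (simp add: N_def)
      then have "ennreal (d t) \<le> ennreal (E t)" by (rule ennreal_leI)
      moreover have "ennreal (d t) = L1_dist t" using L1_dist_finite[of t] that by (simp add: d_def)
      ultimately show ?thesis using that by (simp add: L1_dist_eq)
    qed
  qed (use Epos Elim p in auto)
  then show "((\<lambda>t. ennreal (t powr decay_exponent DIM('a) p) * Lp_norm p (profile_diff t)) \<longlongrightarrow> 0) at_top"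
    by simp
  show "((\<lambda>t. ennreal (t powr (decay_exponent DIM('a) p + 1 / 2)) * Lp_norm p (gradient_diff t)) \<longlongrightarrow> 0) at_top"
  proof (rule Lp_norm_decay[where T = 4 and E = E])
    show "gradient_diff t \<in> borel_measurable borel" if "t \<ge> 4" for t
    proof -
      have t: "t > 0" using that by simp
      note [measurable] = gradient_measurable[OF t]
      have "gradient_diff t = (\<lambda>x. gradient (u t) x - limit_mass *\<^sub>R (- (heat_kernel t x / (2 * t)) *\<^sub>R x))"
        using t by (simp add: gradient_diff_def gradient_heat_kernel fun_eq_iff)
      also have "\<dots> \<in> borel_measurable borel" by measurable
      finally show ?thesis .
    qed
    show "norm (gradient_diff t x) \<le> t powr (- (1/2 + real DIM('a) / 2)) * E t" if "t \<ge> 4" for t x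
      using K(3)[of "t / 2" x] conv[OF that, of "1/2 + N / 2"] that by (simp add: N_def)
    show "(\<integral>\<^sup>+x. ennreal (norm (gradient_diff t x)) \<partial>lborel) \<le> ennreal (t powr (- (1/2)) * E t)" if "t \<ge> 4" for t
    proof -
      have "(\<integral>\<^sup>+x. ennreal (norm (gradient_diff t x)) \<partial>lborel) \<le> ennreal (K * (t / 2) powr (- (1/2)) * (d (t / 2) + (t / 2) powr (- \<nu>)))"
        using K(4)[of "t / 2"] that by simp
      also have "\<dots> \<le> ennreal (t powr (- (1/2)) * E t)"
        by (intro ennreal_leI conv that) (simp add: N_def)
      finally show ?thesis .
    qed
  qed (use Epos Elim p in auto)
qed

end

text \<open>By continuity the sublevel set is closed, and a closed set of full measure is the whole
  space.\<close>

lemma norm_le_Lp_norm_infinity: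
  fixes f :: "'a::euclidean_space \<Rightarrow> 'b::real_normed_vector"
  assumes cont: "continuous_on UNIV f" and le: "Lp_norm \<infinity> f \<le> ennreal B" and B: "B \<ge> 0"
  shows "norm (f x) \<le> B"
proof -
  have "AE x in lebesgue. ennreal (norm (f x)) \<le> esssup lebesgue (\<lambda>x. ennreal (norm (f x)))"
    by (rule esssup_AE)
  then have "AE x in lebesgue. x \<in> {x. norm (f x) \<le> B}"
  proof eventually_elim
    case (elim x)
    also have "esssup lebesgue (\<lambda>x. ennreal (norm (f x))) \<le> ennreal B" using le by (simp add: Lp_norm_def)
    finally show ?case using B by simp
  qed
  moreover have "closed {x. norm (f x) \<le> B}"
    using cont by (intro closed_Collect_le continuous_intros) auto
  ultimately have "x \<in> {x. norm (f x) \<le> B}" by (intro mem_closed_if_AE_lebesgue)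
  then show ?thesis by simp
qed

text \<open>Continuity upgrades all almost-everywhere information: the bounds for positive times,
  and the sign of \<open>u 0\<close>, which agrees with the datum almost everywhere.\<close>

lemma the_solution_viscous_HJ:
  fixes q :: real and u\<^sub>0 :: "'a::euclidean_space \<Rightarrow> real" and u :: "real \<Rightarrow> 'a \<Rightarrow> real"
  assumes q: "q > 1" and int: "integrable lebesgue u\<^sub>0" and W: "W1_inf u\<^sub>0"
    and pos: "AE x in lebesgue. u\<^sub>0 x \<ge> 0" and sol: "is_the_solution q u\<^sub>0 u"
  shows "\<exists>M. viscous_HJ q M u"
proof -
  have cs: "classical_solution q u\<^sub>0 u" using sol by (simp add: is_the_solution_def)
  have c: "continuous_on ({0..} \<times> UNIV) (\<lambda>(t, x). u t x)" and C21: "C21 u"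
    and pde: "\<And>t x. t > 0 \<Longrightarrow> deriv (\<lambda>s. u s x) t - laplacian (u t) x + norm (gradient (u t) x) powr q = 0"
    and init: "AE x in lebesgue. u 0 x = u\<^sub>0 x"
    using cs by (auto simp: classical_solution_def)
  have slice: "continuous_on UNIV (u t)" if "t \<ge> 0" for t
  proof -
    have "continuous_on UNIV (\<lambda>y. (t, y))" by (intro continuous_intros)
    from continuous_on_compose2[OF c this] that show ?thesis by (simp add: image_subset_iff)
  qed
  have gslice: "continuous_on UNIV (gradient (u t))" if "t > 0" for t
  proof -
    have "continuous_on UNIV (\<lambda>y. (t, y))" by (intro continuous_intros)
    moreover have "continuous_on ({0<..} \<times> UNIV) (\<lambda>(t, x). gradient (u t) x)" using C21 by (simp add: C21_def)
    ultimately show ?thesis using continuous_on_compose2 that by (force simp: image_subset_iff)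
  qed
  obtain g where g: "has_weak_gradient u\<^sub>0 g" "Lp_norm \<infinity> g < \<infinity>" and u0: "Lp_norm \<infinity> u\<^sub>0 < \<infinity>"
    using W by (auto simp: W1_inf_def)
  \<comment> \<open>The gradient bound in \<open>is_the_solution\<close> holds for every weak
    gradient of the datum, in particular for the bounded one supplied by
    \<open>W1_inf\<close>.\<close>
  define M where "M = max (enn2real (Lp_norm \<infinity> u\<^sub>0)) (enn2real (Lp_norm \<infinity> g))"
  have M: "M \<ge> 0" by (simp add: M_def le_max_iff_disj)
  have "Lp_norm \<infinity> u\<^sub>0 = ennreal (enn2real (Lp_norm \<infinity> u\<^sub>0))" "Lp_norm \<infinity> g = ennreal (enn2real (Lp_norm \<infinity> g))"
    using u0 g(2) by simp_all
  then have bM: "Lp_norm \<infinity> u\<^sub>0 \<le> ennreal M" "Lp_norm \<infinity> g \<le> ennreal M"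
    unfolding M_def by (metis ennreal_leI max.cobounded1, metis ennreal_leI max.cobounded2)
  have ub: "\<bar>u t x\<bar> \<le> M" if "t > 0" for t x
  proof -
    have "Lp_norm \<infinity> (u t) \<le> ennreal M" using sol that bM(1) unfolding is_the_solution_def by (meson order.trans)
    from norm_le_Lp_norm_infinity[OF slice this M] that show ?thesis by simp
  qed
  have gb: "norm (gradient (u t) x) \<le> M" if "t > 0" for t x
  proof -
    have "Lp_norm \<infinity> (gradient (u t)) \<le> ennreal M" using sol that g(1) bM(2) unfolding is_the_solution_def by (meson order.trans)
    from norm_le_Lp_norm_infinity[OF gslice[OF that] this M] show ?thesis .
  qed
  have "AE x in lebesgue. x \<in> {x. 0 \<le> u 0 x}"
    using pos init by eventually_elim simp
  moreover have "closed {x. 0 \<le> u 0 x}"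
    using slice[of 0] by (intro closed_Collect_le continuous_intros) auto
  ultimately have nonneg: "0 \<le> u 0 x" for x
    using mem_closed_if_AE_lebesgue by blast
  have m0: "u 0 \<in> borel_measurable borel" by (intro borel_measurable_continuous_onI slice) simp
  have "integrable lebesgue (u 0)"
    using int init m0 by (subst integrable_cong_AE[of _ _ u\<^sub>0]) (auto intro: measurable_completion)
  then have "integrable lborel (u 0)" using m0 by (simp add: integrable_completion)
  then have "viscous_HJ q M u"
    using q c C21 pde ub gb nonneg by unfold_locales auto
  then show ?thesis by blast
qed

theorem theorem2p1:
  fixes q :: real and u\<^sub>0 :: "'a::euclidean_space \<Rightarrow> real" and u :: "real \<Rightarrow> 'a \<Rightarrow> real"
  assumes "q > (real DIM('a) + 2) / (real DIM('a) + 1)"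
    and "integrable lebesgue u\<^sub>0" and "W1_inf u\<^sub>0"
    and "AE x in lebesgue. u\<^sub>0 x \<ge> 0" and "\<not> (AE x in lebesgue. u\<^sub>0 x = 0)"
    and "is_the_solution q u\<^sub>0 u"
  shows
    "(\<forall>t>0. integrable lebesgue (u t)) \<and>
     set_integrable lebesgue ({0<..} \<times> UNIV) (\<lambda>(s, x). norm (gradient (u s) x) powr q) \<and>
     ((\<lambda>t. LINT x|lebesgue. u t x) \<longlongrightarrow> I_infty u) at_top \<and>
     I_infty u = (LINT x|lebesgue. u\<^sub>0 x)
       - (LINT s:{0<..}|lebesgue. (LINT x|lebesgue. norm (gradient (u s) x) powr q)) \<and>
     (\<forall>p\<ge>1.
       ((\<lambda>t. ennreal (t powr decay_exponent DIM('a) p)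
          * Lp_norm p (\<lambda>x. u t x - I_infty u * heat_kernel t x)) \<longlongrightarrow> 0) at_top \<and>
       ((\<lambda>t. ennreal (t powr (decay_exponent DIM('a) p + 1 / 2))
          * Lp_norm p (\<lambda>x. gradient (u t) x - I_infty u *\<^sub>R gradient (heat_kernel t) x))
          \<longlongrightarrow> 0) at_top)"
proof -
  \<comment> \<open>Equivalent to \<open>q > q_c\<close>, since
    \<open>q_c - 1 = 1 / (N + 1)\<close>; this is the form in which the threshold is used.\<close>
  have qc: "(real DIM('a) + 1) * (q - 1) > 1"
    using assms(1) by (simp add: field_simps)
  then have "0 < (real DIM('a) + 1) * (q - 1)" by simp
  then have q: "q > 1" by (simp add: zero_less_mult_iff)
  obtain M where "viscous_HJ q M u" using the_solution_viscous_HJ[OF q assms(2,3,4,6)] by blast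
  then interpret viscous_HJ q M u .
  have um: "u t \<in> borel_measurable lborel" if "t \<ge> 0" for t using that by simp
  have mass_leb: "(LINT x|lebesgue. u t x) = mass t" if "t \<ge> 0" for t
    unfolding mass_def by (rule integral_completion[OF um[OF that]])
  have "\<forall>\<^sub>F t in at_top. (LINT x|lebesgue. u t x) = mass t"
    using eventually_ge_at_top[of 0] by eventually_elim (rule mass_leb)
  then have lim: "((\<lambda>t. LINT x|lebesgue. u t x) \<longlongrightarrow> limit_mass) at_top"
    using mass_tendsto by (simp add: tendsto_cong)
  have I: "I_infty u = limit_mass"
    unfolding I_infty_def by (rule tendsto_Lim[OF _ lim]) simp
  have 1: "integrable lebesgue (u t)" if "t > 0" for t
    using integrable_u[of t] um[of t] that by (simp add: integrable_completion)
  \<comment> \<open>The zero extension built into \<open>F\<close> is precisely the indicator in the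
    set integral.\<close>
  have "(\<lambda>p. indicator ({0<..} \<times> UNIV) p *\<^sub>R (case p of (s, x) \<Rightarrow> norm (gradient (u s) x) powr q)) = (\<lambda>p. F (fst p) (snd p))"
    by (auto simp: F_def indicator_def fun_eq_iff)
  then have 2: "set_integrable lebesgue ({0<..} \<times> UNIV) (\<lambda>(s, x). norm (gradient (u s) x) powr q)"
    unfolding set_integrable_def using integrable_F_pair by (simp add: lborel_prod integrable_completion)
  have "(LINT s:{0<..}|lebesgue. (LINT x|lebesgue. norm (gradient (u s) x) powr q)) = (LINT s|lebesgue. (LINT y|lborel. F s y))"
    unfolding set_lebesgue_integral_def
  proof (intro Bochner_Integration.integral_cong refl)
    fix s :: real
    show "indicator {0<..} s *\<^sub>R (LINT x|lebesgue. norm (gradient (u s) x) powr q) = (LINT y|lborel. F s y)"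
    proof (cases "s > 0")
      case True
      have [measurable]: "gradient (u s) \<in> borel_measurable borel" using True by simp
      have "(LINT x|lebesgue. norm (gradient (u s) x) powr q) = (LINT x|lborel. norm (gradient (u s) x) powr q)"
        by (rule integral_completion) measurable
      then show ?thesis using True by (simp add: F_def)
    qed (simp add: F_def)
  qed
  also have "\<dots> = (LINT s|lborel. (LINT y|lborel. F s y))"
    by (rule integral_completion) measurable
  finally have 3: "(LINT s:{0<..}|lebesgue. (LINT x|lebesgue. norm (gradient (u s) x) powr q)) = enn2real (tail 0)"
    unfolding iterated_integral_F .
  have "(LINT x|lebesgue. u\<^sub>0 x) = (LINT x|lebesgue. u 0 x)"
  proof (rule integral_cong_AE)
    have "AE x in lebesgue. u 0 x = u\<^sub>0 x"
      using assms(6) unfolding is_the_solution_def classical_solution_def by blast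
    then show "AE x in lebesgue. u\<^sub>0 x = u 0 x"
      by eventually_elim simp
  qed (use assms(2) um[of 0] in \<open>auto intro: measurable_completion\<close>)
  then have 4: "(LINT x|lebesgue. u\<^sub>0 x) = mass 0" using mass_leb[of 0] by simp
  show ?thesis
    using 1 2 lim Lp_asymptotics[OF qc] unfolding I 3 4
    by (auto simp: limit_mass_def profile_diff_def[abs_def] gradient_diff_def[abs_def])
qed

end
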